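(* For every $(\alpha,\beta)\in\Omega$, $$m_{\alpha,\beta}=E_c(W)=\frac14\|\nabla W\|_{L^2(\mathbb R^4)}^2,$$ where $W(x)=\big(1+\frac{|x|^2}{8}\big)^{-1}$ is the ground state of the massless equation $-\Delta\varphi=|\varphi|^2\varphi$ on $\mathbb R^4$.
   Context: Functions are complex-valued on $\mathbb R^4$. $E(\varphi)=\int_{\mathbb R^4}\left[\frac12|\nabla\varphi|^2-\frac14|\varphi|^4+\frac3{10}|\varphi|^{10/3}\right]dx$ and $E_c(\varphi)=\int_{\mathbb R^4}\left[\frac12|\nabla\varphi|^2-\frac14|\varphi|^4\right]dx$. $\Omega=\{(\alpha,\beta)\in\mathbb R^2:\alpha\ge0,\ 5\alpha+6\beta\ge0,\ (\alpha,\beta)\ne(0,0)\}$. For $(\alpha,\beta)\in\Omega$ and $\varphi\in H^1(\mathbb R^4)$, $$K_{\alpha,\beta}(\varphi)=(\alpha+\beta)\int_{\mathbb R^4}\left[|\nabla\varphi|^2-|\varphi|^4\right]dx+\Big(\alpha+\frac65\beta\Big)\int_{\mathbb R^4}|\varphi|^{10/3}dx,$$ (this is $\frac{d}{d\lambda}|_{\lambda=0}E(e^{\alpha\lambda}\varphi(e^{-\beta\lambda}\cdot))$), and $m_{\alpha,\beta}=\inf\{E(\varphi):\varphi\in H^1(\mathbb R^4)\setminus\{0\},\ K_{\alpha,\beta}(\varphi)=0\}$. *)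

theory Defs
  imports "HOL-Analysis.Analysis"
begin

section \<open>Sobolev functions on \<open>\<real>\<^sup>4\<close>\<close>

definition partial :: "4 \<Rightarrow> (real^4 \<Rightarrow> 'b::real_normed_vector) \<Rightarrow> real^4 \<Rightarrow> 'b" where
  "partial i f x = frechet_derivative f (at x) (axis i 1)"

text \<open>All iterated partial derivatives exist and are (Frechet) differentiable, hence continuous.\<close>

definition smooth :: "(real^4 \<Rightarrow> real) \<Rightarrow> bool" where
  "smooth f \<longleftrightarrow> (\<forall>is. foldr partial is f differentiable_on UNIV)"

definition test_function :: "(real^4 \<Rightarrow> real) \<Rightarrow> bool" where
  "test_function \<eta> \<longleftrightarrow> smooth \<eta> \<and> compact (closure {x. \<eta> x \<noteq> 0})"

definition locally_integrable :: "(real^4 \<Rightarrow> complex) \<Rightarrow> bool" where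
  "locally_integrable f \<longleftrightarrow> (\<forall>K. compact K \<longrightarrow> set_integrable lebesgue K f)"

text \<open>The real inner product structure of \<^typ>\<open>complex^4\<close> gives
  \<open>norm (G x) ^ 2 = (\<Sum>i. cmod (G x $ i) ^ 2)\<close>.\<close>

definition has_weak_gradient :: "(real^4 \<Rightarrow> complex) \<Rightarrow> (real^4 \<Rightarrow> complex^4) \<Rightarrow> bool" where
  "has_weak_gradient \<phi> G \<longleftrightarrow>
     locally_integrable \<phi> \<and> (\<forall>i. locally_integrable (\<lambda>x. G x $ i)) \<and>
     (\<forall>\<eta> i. test_function \<eta> \<longrightarrow>
        (\<integral>x. partial i \<eta> x *\<^sub>R \<phi> x \<partial>lebesgue) = - (\<integral>x. \<eta> x *\<^sub>R G x $ i \<partial>lebesgue))"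

text \<open>The weak gradient is unique up to null sets, so that the integrals below do not depend on
  the representative chosen here.\<close>

definition weak_gradient :: "(real^4 \<Rightarrow> complex) \<Rightarrow> real^4 \<Rightarrow> complex^4" where
  "weak_gradient \<phi> = (SOME G. has_weak_gradient \<phi> G)"

text \<open>Elements of \<open>H\<^sup>1\<close> are represented by functions, not by classes modulo null sets; the zero
  element is therefore the set of functions vanishing almost everywhere.\<close>

definition H1 :: "(real^4 \<Rightarrow> complex) set" where
  "H1 = {\<phi>. \<phi> \<in> borel_measurable lebesgue \<and> integrable lebesgue (\<lambda>x. cmod (\<phi> x) ^ 2) \<and>
            (\<exists>G. has_weak_gradient \<phi> G \<and> integrable lebesgue (\<lambda>x. norm (G x) ^ 2))}"

definition H1_zero :: "(real^4 \<Rightarrow> complex) set" where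
  "H1_zero = {\<phi>. AE x in lebesgue. \<phi> x = 0}"

definition L2_norm :: "(real^4 \<Rightarrow> 'b::real_normed_vector) \<Rightarrow> real" where
  "L2_norm f = sqrt (\<integral>x. norm (f x) ^ 2 \<partial>lebesgue)"

section \<open>Functionals\<close>

text \<open>By the Sobolev embedding \<open>H\<^sup>1 \<subseteq> L\<^sup>2 \<inter> L\<^sup>4\<close> all integrals below converge for functions in
  \<^term>\<open>H1\<close>.\<close>

definition energy :: "(real^4 \<Rightarrow> complex) \<Rightarrow> real" where
  "energy \<phi> = (\<integral>x. 1/2 * norm (weak_gradient \<phi> x) ^ 2 - 1/4 * cmod (\<phi> x) ^ 4
                   + 3/10 * cmod (\<phi> x) powr (10/3) \<partial>lebesgue)"

definition energy_c :: "(real^4 \<Rightarrow> complex) \<Rightarrow> real" where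
  "energy_c \<phi> = (\<integral>x. 1/2 * norm (weak_gradient \<phi> x) ^ 2 - 1/4 * cmod (\<phi> x) ^ 4 \<partial>lebesgue)"

definition Omega :: "(real \<times> real) set" where
  "Omega = {(\<alpha>, \<beta>). \<alpha> \<ge> 0 \<and> 5 * \<alpha> + 6 * \<beta> \<ge> 0 \<and> (\<alpha>, \<beta>) \<noteq> (0, 0)}"

definition K :: "real \<Rightarrow> real \<Rightarrow> (real^4 \<Rightarrow> complex) \<Rightarrow> real" where
  "K \<alpha> \<beta> \<phi> =
     (\<alpha> + \<beta>) * (\<integral>x. norm (weak_gradient \<phi> x) ^ 2 - cmod (\<phi> x) ^ 4 \<partial>lebesgue)
     + (\<alpha> + 6/5 * \<beta>) * (\<integral>x. cmod (\<phi> x) powr (10/3) \<partial>lebesgue)"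

text \<open>The infimum is taken in the extended reals, where it is meaningful without knowing that
  the constraint set is nonempty or that the energy is bounded below on it.\<close>

definition m :: "real \<Rightarrow> real \<Rightarrow> ereal" where
  "m \<alpha> \<beta> = Inf {ereal (energy \<phi>) | \<phi>. \<phi> \<in> H1 - H1_zero \<and> K \<alpha> \<beta> \<phi> = 0}"

section \<open>The function \<open>W\<close>\<close>

text \<open>\<open>W\<close> has a square integrable gradient and lies in \<open>L\<^sup>4\<close>, but it is not in \<open>L\<^sup>2\<close>.\<close>

definition W :: "real^4 \<Rightarrow> complex" where
  "W x = of_real (inverse (1 + norm x ^ 2 / 8))"

lemma W_has_derivative:
  "(W has_derivative (\<lambda>h. - of_real (x \<bullet> h / 4) * W x ^ 2)) (at x)"
proof -
  have "x \<bullet> x + 8 > 0"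
    by (simp add: add_nonneg_pos)
  then have "complex_of_real (x \<bullet> x + 8) \<noteq> 0"
    unfolding of_real_eq_0_iff by simp
  then have nz: "complex_of_real (x \<bullet> x) + 8 \<noteq> 0"
    by simp
  show ?thesis
    unfolding W_def power2_norm_eq_inner using nz
    by (auto intro!: derivative_eq_intros simp: inner_commute power2_eq_square field_simps)
qed

lemma partial_W: "partial i W = (\<lambda>x. - of_real (x $ i / 4) * W x ^ 2)"
  by (simp add: fun_eq_iff partial_def inner_axis
      frechet_derivative_at[OF W_has_derivative, symmetric])

lemma W_massless_equation: "- (\<Sum>i\<in>UNIV. partial i (partial i W) x) = cmod (W x) ^ 2 * W x"
proof -
  define r where "r = 1 + x \<bullet> x / 8"
  have pos: "r > 0"
    by (simp add: r_def add_pos_nonneg)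
  have W: "W x = of_real (inverse r)"
    by (simp add: W_def r_def power2_norm_eq_inner)
  have "partial i (partial i W) x = of_real (x $ i ^ 2 / 8 * inverse r ^ 3 - inverse r ^ 2 / 4)" for i
  proof -
    have "((\<lambda>x. - of_real (x $ i / 4) * W x ^ 2) has_derivative
        (\<lambda>h. - of_real (h $ i / 4) * W x ^ 2
             + of_real (x $ i / 4) * (2 * W x * of_real (x \<bullet> h / 4) * W x ^ 2))) (at x)"
      by (rule derivative_eq_intros W_has_derivative bounded_linear.has_derivative[OF bounded_linear_vec_nth]
            refl | simp add: fun_eq_iff algebra_simps power2_eq_square)+
    then show ?thesis
      unfolding partial_W partial_def[of i "\<lambda>x. _ x * _ x"]
      by (simp add: frechet_derivative_at[symmetric] inner_axis W power2_eq_square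
          power3_eq_cube algebra_simps)
  qed
  then have "(\<Sum>i\<in>UNIV. partial i (partial i W) x)
      = of_real ((\<Sum>i\<in>UNIV. x $ i ^ 2) / 8 * inverse r ^ 3 - inverse r ^ 2)"
    by (simp add: sum_subtractf sum_distrib_right sum_divide_distrib)
  also have "(\<Sum>i\<in>UNIV. x $ i ^ 2) / 8 = r - 1"
    by (simp add: r_def inner_vec_def power2_eq_square)
  also have "(r - 1) * inverse r ^ 3 - inverse r ^ 2 = - (inverse r ^ 3)"
    using pos by (simp add: power2_eq_square power3_eq_cube field_simps)
  finally show ?thesis
    using pos by (simp add: W power2_eq_square power3_eq_cube norm_inverse)
qed

end

theory Submission
  imports Defs
begin

text \<open>Eliminating the quartic term with the constraint \<open>K \<alpha> \<beta> \<phi> = 0\<close> gives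
  \<open>energy \<phi> \<ge> \<parallel>\<nabla>\<phi>\<parallel>\<^sup>2 / 4\<close> and \<open>\<parallel>\<nabla>\<phi>\<parallel>\<^sup>2 \<le> \<parallel>\<phi>\<parallel>\<^sub>4\<^sup>4\<close>, so the lower bound is the sharp Sobolev inequality
  \<open>\<parallel>\<phi>\<parallel>\<^sub>4\<^sup>4 \<parallel>\<nabla>W\<parallel>\<^sup>2 \<le> \<parallel>\<nabla>\<phi>\<parallel>\<^sup>4\<close>. For \<open>C\<^sup>1\<close> functions \<open>f \<ge> 0\<close> with compact support it is proved by mass
  transport, following Cordero-Erausquin, Nazaret and Villani, with the Knothe map \<open>T\<close> in place of the
  Brenier map: \<open>T\<close> pushes \<open>f\<^sup>4\<close> forward to a multiple of \<open>W\<^sup>4\<close> restricted to a large cube, its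
  Jacobian is triangular, and the arithmetic-geometric mean inequality for the diagonal entries,
  integration by parts against \<open>f\<^sup>3\<close> and the Cauchy-Schwarz inequality give the estimate, which is an
  equality for \<open>f = W\<close> and \<open>T = id\<close>. Restricting the target to a cube makes \<open>T\<close> bounded, so that no
  boundary terms occur. Mollification, truncation and Fatou's lemma extend the inequality to
  \<open>H\<^sup>1\<close>.

  For the upper bound, compactly supported truncations of \<open>W\<close> are rescaled by
  \<open>\<phi> \<mapsto> (c / r) \<phi>(x / r)\<close>. The gradient and quartic terms do not depend on \<open>r\<close>, while the
  term of order \<open>10/3\<close> is multiplied by \<open>r\<^bsup>2/3\<^esup>\<close>; hence the constraint can be solved for \<open>r\<close>
  with \<open>c\<close> arbitrarily close to the value at which the first two terms balance.\<close>

section \<open>Monotone transport on the line\<close>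

text \<open>The arithmetic-geometric mean step only sees the diagonal of the Jacobian, and the
  determinant of a triangular matrix is the product of its diagonal; hence a map built from
  one-dimensional quantiles, differentiable along lines by elementary means, can replace the
  gradient of a convex function. The number 4 is both the dimension and the critical exponent: the
  fourth root taken in that step turns the densities \<open>f^4\<close> and \<open>W^4\<close> back
  into \<open>f\<close> and \<open>W\<close>.

  The answer does not depend on (\<alpha>, \<beta>) because of a coincidence of constants: on Omega
  the ratio of the two coefficients of \<open>K\<close> is at most 6/5, and 1/4 * 6/5 = 3/10 is the
  coefficient of the last term of the energy.

  The extremal \<open>W\<close> decays like \<open>|x|^(-2)\<close> and just misses
  \<open>L^2\<close> in dimension four. It is therefore not admissible, and the upper bound has to
  be approached by truncations. For the lower bound the transport argument asks for nonnegative real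
  functions, whereas elements of \<open>H1\<close> are complex; a differentiable substitute for the
  modulus bridges the gap.\<close>

definition cdf :: "real \<Rightarrow> (real \<Rightarrow> real) \<Rightarrow> real \<Rightarrow> real" where
  "cdf a g s = (\<integral>r. indicator {a..s} r * g r \<partial>lborel)"

text \<open>The inverse of the distribution function of \<open>g\<close> on \<open>[-R, R]\<close>, normalised to vanish at \<open>- R\<close>:
  the value at \<open>v\<close> is read off from the measure of the sublevel set. In this form joint measurability
  in parameters is immediate. The enlarged interval makes it an inverse in a neighbourhood of
  the values taken on \<open>[-R, R]\<close>, hence differentiable up to the end points.\<close>

definition quantile :: "real \<Rightarrow> (real \<Rightarrow> real) \<Rightarrow> real \<Rightarrow> real" where
  "quantile R g v = - (R + 1) + (\<integral>c. indicator {- (R + 1)..R + 1} c *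
     (if cdf (- (R + 2)) g c - cdf (- (R + 2)) g (- R) < v then 1 else 0) \<partial>lborel)"

text \<open>The last component of the Knothe map is a quantile whose density and argument both
  depend on the preceding coordinates, so measurability is needed in all parameters jointly.\<close>

lemma cdf_measurable [measurable]:
  assumes [measurable]: "case_prod g \<in> borel_measurable (N \<Otimes>\<^sub>M borel)" "s \<in> borel_measurable N"
  shows "(\<lambda>x. cdf a (g x) (s x)) \<in> borel_measurable N"
proof -
  have [measurable]: "(\<lambda>z. g (fst z) (snd z)) \<in> borel_measurable (N \<Otimes>\<^sub>M lborel)"
    using assms(1) by (simp add: case_prod_beta')
  \<comment> \<open>Written with two inequalities, the moving end point \<open>s x\<close> becomes
    part of a jointly measurable integrand.\<close>
  have "(\<lambda>x. \<integral>r. (if a \<le> r \<and> r \<le> s x then 1 else 0) * g x r \<partial>lborel) \<in> borel_measurable N"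
    by measurable
  then show ?thesis
    by (simp add: cdf_def indicator_def of_bool_def cong: if_cong)
qed

lemma quantile_measurable [measurable]:
  assumes [measurable]: "case_prod g \<in> borel_measurable (N \<Otimes>\<^sub>M borel)" "v \<in> borel_measurable N"
  shows "(\<lambda>x. quantile R (g x) (v x)) \<in> borel_measurable N"
  unfolding quantile_def using assms(1) by measurable

lemma cdf_eq_integral:
  assumes "continuous_on UNIV g"
  shows "cdf a g s = integral {a..s} g"
  using assms
  unfolding cdf_def
  using set_borel_integral_eq_integral(2)[of "{a..s}" g, OF borel_integrable_atLeastAtMost']
  by (simp add: set_lebesgue_integral_def continuous_on_subset)

lemma cdf_has_derivative:
  assumes g: "continuous_on UNIV g" and s: "a < s"
  shows "(cdf a g has_real_derivative g s) (at s)"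
proof -
  have "((\<lambda>x. integral {a..x} g) has_real_derivative g s) (at s within {a..s+1})"
    using s g by (intro integral_has_real_derivative) (auto intro: continuous_on_subset)
  moreover have "at s within {a..s+1} = at s"
    using s by (intro at_within_interior) auto
  ultimately show ?thesis
    using g by (subst cdf_eq_integral[OF g, THEN ext[where f = "cdf a g"]]) simp
qed

lemma cdf_diff:
  assumes g: "continuous_on UNIV g" and "a \<le> s" "s \<le> t"
  shows "cdf a g t - cdf a g s = integral {s..t} g"
proof -
  have "g integrable_on {a..t}"
    by (rule integrable_continuous_interval[OF continuous_on_subset[OF g]]) simp
  from Henstock_Kurzweil_Integration.integral_combine[OF assms(2,3) this] show ?thesis
    by (simp add: cdf_eq_integral[OF g])
qed

lemma cdf_strict_mono:
  assumes g: "continuous_on UNIV g" and pos: "\<And>x. g x > 0" and "a < s" "s < t"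
  shows "cdf a g s < cdf a g t"
  using DERIV_pos_imp_increasing[of s t "cdf a g"] cdf_has_derivative[OF g, of a] assms
  by (metis less_le_trans)

locale one_dim_target =
  fixes g :: "real \<Rightarrow> real" and R :: real
  assumes g_cont: "continuous_on UNIV g" and g_pos: "\<And>x. g x > 0" and R_pos: "R > 0"
begin

text \<open>Two margins of width one: \<open>quantile\<close> inverts \<open>\<Gamma>\<close> on
  radius \<open>R + 1\<close>, so that it is differentiable at the values taken at
  \<open>- R\<close> and \<open>R\<close>; the base point \<open>- (R + 2)\<close> makes
  \<open>\<Gamma>\<close> differentiable on all of that larger interval.\<close>

definition \<Gamma> where "\<Gamma> c = cdf (- (R + 2)) g c - cdf (- (R + 2)) g (- R)"

lemma \<Gamma>_deriv: "- (R + 2) < c \<Longrightarrow> (\<Gamma> has_real_derivative g c) (at c)"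
  unfolding \<Gamma>_def[abs_def] by (auto intro!: derivative_eq_intros cdf_has_derivative g_cont)

lemma \<Gamma>_less: "- (R + 2) < s \<Longrightarrow> s < t \<Longrightarrow> \<Gamma> s < \<Gamma> t"
  unfolding \<Gamma>_def using cdf_strict_mono[OF g_cont g_pos] by auto

lemma \<Gamma>_less_iff: "- (R + 2) < s \<Longrightarrow> - (R + 2) < t \<Longrightarrow> \<Gamma> s < \<Gamma> t \<longleftrightarrow> s < t"
  using \<Gamma>_less[of s t] \<Gamma>_less[of t s] by (cases s t rule: linorder_cases) auto

lemma \<Gamma>_R: "\<Gamma> (- R) = 0" "\<Gamma> R = integral {- R..R} g"
  unfolding \<Gamma>_def using cdf_diff[OF g_cont, of "-(R+2)" "-R" R] R_pos by auto

lemma quantile_\<Gamma>: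
  assumes "\<bar>y\<bar> \<le> R + 1" shows "quantile R g (\<Gamma> y) = y"
proof -
  \<comment> \<open>By strict monotonicity the sublevel set is the segment from
    \<open>- (R + 1)\<close> to \<open>y\<close>, of length \<open>y + (R + 1)\<close>; the constant
    in front of the integral compensates for the shift.\<close>
  have "(\<integral>c. indicator {- (R + 1)..R + 1} c * (if \<Gamma> c < \<Gamma> y then 1 else 0) \<partial>lborel) =
        (\<integral>c. indicator {- (R + 1)..<y} c \<partial>lborel :: real)"
    using assms by (intro Bochner_Integration.integral_cong) (auto simp: indicator_def \<Gamma>_less_iff)
  also have "\<dots> = y + (R + 1)"
    using assms by simp
  finally show ?thesis
    unfolding quantile_def \<Gamma>_def by simp
qed

lemma \<Gamma>_quantile:
  assumes "\<Gamma> (- (R + 1)) \<le> v" "v \<le> \<Gamma> (R + 1)"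
  shows "\<Gamma> (quantile R g v) = v \<and> \<bar>quantile R g v\<bar> \<le> R + 1"
proof -
  have "\<exists>y\<ge>- (R + 1). y \<le> R + 1 \<and> \<Gamma> y = v"
    using assms R_pos by (intro IVT) (auto intro!: DERIV_isCont[OF \<Gamma>_deriv])
  then obtain y where "\<bar>y\<bar> \<le> R + 1" "\<Gamma> y = v" by (metis abs_le_iff minus_le_iff)
  with quantile_\<Gamma>[of y] show ?thesis by auto
qed

lemma \<Gamma>_quantile':
  assumes "0 \<le> v" "v \<le> integral {- R..R} g"
  shows "\<Gamma> (quantile R g v) = v" "\<bar>quantile R g v\<bar> \<le> R"
proof -
  have "\<exists>y\<ge>- R. y \<le> R \<and> \<Gamma> y = v"
    using assms R_pos \<Gamma>_R by (intro IVT) (auto intro!: DERIV_isCont[OF \<Gamma>_deriv])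
  then obtain y where "\<bar>y\<bar> \<le> R" "\<Gamma> y = v" by (metis abs_le_iff minus_le_iff)
  with quantile_\<Gamma>[of y] show "\<Gamma> (quantile R g v) = v" "\<bar>quantile R g v\<bar> \<le> R" by auto
qed

lemma quantile_deriv:
  assumes "0 \<le> v" "v \<le> integral {- R..R} g"
  shows "(quantile R g has_real_derivative inverse (g (quantile R g v))) (at v)"
proof (rule DERIV_inverse_function[where f = \<Gamma> and a = "\<Gamma> (- (R + 1))" and b = "\<Gamma> (R + 1)"])
  let ?y = "quantile R g v"
  note y = \<Gamma>_quantile'[OF assms]
  show "(\<Gamma> has_real_derivative g ?y) (at ?y)"
    using y by (intro \<Gamma>_deriv) auto
  show "g ?y \<noteq> 0" using g_pos[of ?y] by auto
  have "\<Gamma> (- (R + 1)) < \<Gamma> (- R)" "\<Gamma> R < \<Gamma> (R + 1)"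
    using R_pos by (auto intro!: \<Gamma>_less)
  then show "\<Gamma> (- (R + 1)) < v" "v < \<Gamma> (R + 1)"
    using assms by (auto simp: \<Gamma>_R)
  show "\<Gamma> (quantile R g y) = y" if "\<Gamma> (- (R + 1)) < y" "y < \<Gamma> (R + 1)" for y
    using \<Gamma>_quantile[of y] that by auto
  \<comment> \<open>The inverse function rule asks for continuity of the inverse. It follows because
    \<open>\<Gamma>\<close> is inverted on the whole unit interval around \<open>?y\<close>, even
    when \<open>?y\<close> is an end point of [-R, R].\<close>
  have "isCont (quantile R g) (\<Gamma> ?y)"
  proof (rule isCont_inverse_function[where d = 1 and f = \<Gamma> and x = ?y])
    show "quantile R g (\<Gamma> z) = z" if "\<bar>z - ?y\<bar> \<le> 1" for z
      using that y by (intro quantile_\<Gamma>) auto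
    show "isCont \<Gamma> z" if "\<bar>z - ?y\<bar> \<le> 1" for z
      using that y by (intro DERIV_isCont[OF \<Gamma>_deriv]) auto
  qed simp_all
  then show "isCont (quantile R g) v" by (simp add: y)
qed

end

locale one_dim_transport = one_dim_target +
  fixes p :: "real \<Rightarrow> real" and M :: real
  assumes p_cont: "continuous_on UNIV p" and p_nonneg: "\<And>x. 0 \<le> p x"
    and M_pos: "M > 0" and p_support: "\<And>x. \<bar>x\<bar> \<ge> M \<Longrightarrow> p x = 0"
begin

definition P where "P = integral {-M..M} p"
definition Q where "Q = integral {-R..R} g"
text \<open>Matches fractions of mass: the share of \<open>p\<close> to the left of \<open>s\<close>
  equals the share of \<open>g\<close> between \<open>- R\<close> and \<open>\<tau> s\<close>. If
  \<open>P = 0\<close>, division by zero makes the argument 0 and the value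
  \<open>- R\<close>.\<close>

definition \<tau> where "\<tau> s = quantile R g (Q / P * cdf (-M) p s)"

lemma Q_pos: "Q > 0"
  using \<Gamma>_less[of "-R" R] R_pos \<Gamma>_R unfolding Q_def by auto

lemma cdf_p_deriv: "(cdf (-M) p has_real_derivative p s) (at s)"
proof (cases "s > - M")
  case True
  then show ?thesis by (rule cdf_has_derivative[OF p_cont])
next
  case False
  \<comment> \<open>At the base point \<open>- M\<close> itself \<open>cdf_has_derivative\<close>
    does not apply. As \<open>p\<close> vanishes to the left of \<open>- M\<close>, the base may be
    moved to \<open>- (M + 1)\<close>; the bracket in the sum is zero.\<close>
  have "((\<lambda>s. cdf (-(M+1)) p s + (cdf (-M) p s - cdf (-(M+1)) p s)) has_real_derivative p s) (at s)"
    if "s = - M"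
  proof -
    have eq: "cdf (-M) p t = cdf (-(M+1)) p t" for t
      unfolding cdf_def by (intro Bochner_Integration.integral_cong) (auto simp: indicator_def p_support)
    show ?thesis
      unfolding eq using that cdf_has_derivative[OF p_cont, of "-(M+1)" s] by auto
  qed
  moreover have "(cdf (-M) p has_real_derivative p s) (at s)" if "s < - M"
  proof -
    have "p s = 0" using that M_pos by (intro p_support) auto
    moreover have "((\<lambda>_. 0) has_real_derivative 0) (at s)" by simp
    then have "(cdf (-M) p has_real_derivative 0) (at s)"
      by (rule has_field_derivative_transform_within_open[of _ _ _ "{..<-M}"])
        (use that in \<open>auto simp: cdf_def\<close>)
    ultimately show ?thesis by simp
  qed
  ultimately show ?thesis using False by force
qed

lemma cdf_p_bounds: "0 \<le> cdf (-M) p s" "cdf (-M) p s \<le> P"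
proof -
  have i: "integrable lborel (\<lambda>r. indicator {u..v} r * p r)" for u v
    using borel_integrable_compact[of "{u..v}" p] continuous_on_subset[OF p_cont] by auto
  show "0 \<le> cdf (-M) p s"
    unfolding cdf_def by (intro integral_nonneg_AE) (auto simp: p_nonneg indicator_def)
  have "cdf (-M) p s \<le> cdf (-M) p M"
    unfolding cdf_def
  proof (intro integral_mono i)
    show "indicator {-M..s} x * p x \<le> indicator {-M..M} x * p x" for x
      using p_support[of x] p_nonneg[of x] by (auto simp: indicator_def)
  qed
  then show "cdf (-M) p s \<le> P"
    by (simp add: P_def cdf_eq_integral[OF p_cont])
qed

lemma P_nonneg: "P \<ge> 0"
  using cdf_p_bounds[of 0] by linarith

lemma v_bounds: "0 \<le> Q / P * cdf (-M) p s" "Q / P * cdf (-M) p s \<le> integral {-R..R} g"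
proof -
  show "0 \<le> Q / P * cdf (-M) p s"
    using P_nonneg Q_pos cdf_p_bounds(1) by (intro mult_nonneg_nonneg divide_nonneg_nonneg) auto
  have "Q * (cdf (-M) p s / P) \<le> Q * 1"
    using P_nonneg Q_pos cdf_p_bounds(2)[of s] by (intro mult_left_mono) (auto simp: divide_le_eq_1)
  then show "Q / P * cdf (-M) p s \<le> integral {-R..R} g"
    by (simp add: Q_def)
qed

lemma \<tau>_bound: "\<bar>\<tau> s\<bar> \<le> R"
  unfolding \<tau>_def by (intro \<Gamma>_quantile' v_bounds)

text \<open>The one-dimensional Monge-Ampere equation. It holds at every point, also where
  \<open>p\<close> vanishes, because the quantile is differentiable at the extreme values 0 and
  \<open>Q\<close> too.\<close>

lemma \<tau>_deriv: "(\<tau> has_real_derivative Q * p s / (P * g (\<tau> s))) (at s)"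
proof -
  have "(quantile R g has_real_derivative inverse (g (\<tau> s))) (at (Q / P * cdf (-M) p s))"
    unfolding \<tau>_def by (intro quantile_deriv v_bounds)
  then have "((\<lambda>s. quantile R g (Q / P * cdf (-M) p s)) has_real_derivative inverse (g (\<tau> s)) * (Q / P * p s)) (at s)"
    by (rule DERIV_chain2) (rule DERIV_cmult[OF cdf_p_deriv])
  then show ?thesis
    unfolding \<tau>_def[abs_def] by (simp add: field_simps)
qed

lemma \<tau>_deriv_nonneg: "Q * p s / (P * g (\<tau> s)) \<ge> 0"
  using Q_pos P_nonneg p_nonneg g_pos by (simp add: less_imp_le)

text \<open>Substitution \<open>y = \<tau> s\<close> on [-M, M], whose end points go to
  \<open>- R\<close> and \<open>R\<close>. The derivative may vanish, but nonnegativity is enough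
  for the substitution rule, and the density \<open>g (\<tau> s)\<close> cancels against the
  derivative.\<close>

lemma \<tau>_pushforward:
  assumes P: "P > 0" and h[measurable]: "h \<in> borel_measurable borel"
  shows "(\<integral>\<^sup>+s. h (\<tau> s) * ennreal (p s) \<partial>lborel) =
    ennreal (P / Q) * (\<integral>\<^sup>+y. h y * ennreal (g y) * indicator {-R..R} y \<partial>lborel)"
proof -
  have g_meas[measurable]: "g \<in> borel_measurable borel" "p \<in> borel_measurable borel"
    using g_cont p_cont by (auto intro: borel_measurable_continuous_onI)
  have cont_\<tau>: "isCont \<tau> s" for s
    using \<tau>_deriv by (rule DERIV_isCont)
  then have [measurable]: "\<tau> \<in> borel_measurable borel"
    by (intro borel_measurable_continuous_onI continuous_at_imp_continuous_on) auto
  have \<tau>M: "\<tau> (-M) = -R" "\<tau> M = R"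
  proof -
    have "cdf (-M) p (-M) = 0"
      by (simp add: cdf_eq_integral p_cont)
    then show "\<tau> (-M) = -R"
      unfolding \<tau>_def using quantile_\<Gamma>[of "-R"] R_pos by (simp add: \<Gamma>_R)
    have "Q / P * cdf (-M) p M = \<Gamma> R"
      using P unfolding \<Gamma>_R by (simp add: cdf_eq_integral p_cont P_def[symmetric] Q_def[symmetric])
    then show "\<tau> M = R"
      unfolding \<tau>_def using quantile_\<Gamma>[of "R"] R_pos by simp
  qed
  have "(\<integral>\<^sup>+y. (h y * ennreal (g y)) * indicator {\<tau> (-M)..\<tau> M} y \<partial>lborel) =
        (\<integral>\<^sup>+s. (h (\<tau> s) * ennreal (g (\<tau> s))) * ennreal (Q * p s / (P * g (\<tau> s))) * indicator {-M..M} s \<partial>lborel)"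
  proof (rule nn_integral_substitution_aux)
    have "continuous_on UNIV (g \<circ> \<tau>)"
      by (intro continuous_on_compose continuous_on_subset[OF g_cont] continuous_at_imp_continuous_on ballI cont_\<tau>) auto
    then have "continuous_on UNIV (\<lambda>s. g (\<tau> s))" by (simp add: comp_def)
    then show "continuous_on {-M..M} (\<lambda>s. Q * p s / (P * g (\<tau> s)))"
      using P g_pos p_cont
      by (intro continuous_intros) (auto intro: continuous_on_subset simp: less_le)
  qed (use \<tau>_deriv \<tau>_deriv_nonneg M_pos in auto)
  also have "\<dots> = (\<integral>\<^sup>+s. ennreal (Q / P) * (h (\<tau> s) * ennreal (p s)) \<partial>lborel)"
  proof (rule nn_integral_cong)
    fix s
    have "ennreal (g (\<tau> s)) * ennreal (Q * p s / (P * g (\<tau> s))) = ennreal (Q / P) * ennreal (p s)"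
      using g_pos[of "\<tau> s"] P Q_pos p_nonneg[of s]
      by (subst (1 2) ennreal_mult'[symmetric]) (auto simp: less_imp_le)
    then show "(h (\<tau> s) * ennreal (g (\<tau> s))) * ennreal (Q * p s / (P * g (\<tau> s))) * indicator {-M..M} s
       = ennreal (Q / P) * (h (\<tau> s) * ennreal (p s))"
      using p_support[of s] by (auto simp: indicator_def mult.assoc) (simp add: ac_simps)?
  qed
  also have "\<dots> = ennreal (Q / P) * (\<integral>\<^sup>+s. h (\<tau> s) * ennreal (p s) \<partial>lborel)"
    by (rule nn_integral_cmult) auto
  finally have "ennreal (P / Q) * (\<integral>\<^sup>+y. (h y * ennreal (g y)) * indicator {-R..R} y \<partial>lborel) =
      ennreal (P / Q) * ennreal (Q / P) * (\<integral>\<^sup>+s. h (\<tau> s) * ennreal (p s) \<partial>lborel)"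
    by (simp add: \<tau>M mult.assoc)
  also have "ennreal (P / Q) * ennreal (Q / P) = 1"
    using P Q_pos by (subst ennreal_mult'[symmetric]) auto
  finally show ?thesis by simp
qed

end

section \<open>The Knothe map\<close>

definition cube :: "real \<Rightarrow> 'a::euclidean_space set" where
  "cube R = {x. \<forall>b\<in>Basis. \<bar>x \<bullet> b\<bar> \<le> R}"

text \<open>Only the diagonal entries \<open>d b\<close> of the Jacobian of \<open>T\<close> appear. They are derivatives along
  lines, and no regularity of \<open>T\<close> in the remaining directions is needed.\<close>

definition transports ::
  "real \<Rightarrow> ('a::euclidean_space \<Rightarrow> real) \<Rightarrow> ('a \<Rightarrow> real) \<Rightarrow> ('a \<Rightarrow> 'a) \<Rightarrow> ('a \<Rightarrow> 'a \<Rightarrow> real) \<Rightarrow> bool" where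
  "transports R F G T d \<longleftrightarrow>
     T \<in> borel_measurable borel \<and> (\<forall>b\<in>Basis. d b \<in> borel_measurable borel) \<and>
     (\<forall>x. \<forall>b\<in>Basis. \<bar>T x \<bullet> b\<bar> \<le> R \<and> 0 \<le> d b x \<and>
        ((\<lambda>t. T (x + t *\<^sub>R b) \<bullet> b) has_real_derivative d b x) (at 0)) \<and>
     (\<forall>x. F x = G (T x) * (\<Prod>b\<in>Basis. d b x)) \<and>
     (\<forall>h\<in>borel_measurable borel. (\<integral>\<^sup>+x. h (T x) * ennreal (F x) \<partial>lborel) =
        (\<integral>\<^sup>+y. h y * ennreal (G y) * indicator (cube R) y \<partial>lborel))"

definition source :: "('a::euclidean_space \<Rightarrow> real) \<Rightarrow> bool" where
  "source F \<longleftrightarrow> continuous_on UNIV F \<and> (\<forall>x. 0 \<le> F x) \<and>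
     (\<exists>M>0. \<forall>x. (\<exists>b\<in>Basis. M \<le> \<bar>x \<bullet> b\<bar>) \<longrightarrow> F x = 0)"

definition target :: "('a::euclidean_space \<Rightarrow> real) \<Rightarrow> bool" where
  "target G \<longleftrightarrow> continuous_on UNIV G \<and> (\<forall>x. 0 < G x)"

text \<open>A property of a type and not of a number, so that the induction on the dimension can
  pass from \<open>'a\<close> to the product of \<open>'a\<close> with the reals.\<close>

definition knothe :: "'a::euclidean_space itself \<Rightarrow> bool" where
  "knothe _ \<longleftrightarrow> (\<forall>R (F::'a \<Rightarrow> real) G. R > 0 \<longrightarrow> source F \<longrightarrow> target G \<longrightarrow>
     (\<integral>\<^sup>+x. F x \<partial>lborel) = (\<integral>\<^sup>+y. ennreal (G y) * indicator (cube R) y \<partial>lborel) \<longrightarrow>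
     (\<exists>T d. transports R F G T d))"

lemma nn_integral_interval:
  fixes p :: "real \<Rightarrow> real"
  assumes "continuous_on UNIV p" "\<And>x. 0 \<le> p x"
  shows "(\<integral>\<^sup>+r. ennreal (p r) * indicator {a..b} r \<partial>lborel) = ennreal (integral {a..b} p)"
proof -
  have [measurable]: "p \<in> borel_measurable borel"
    using assms by (intro borel_measurable_continuous_onI)
  have "(p has_integral integral {a..b} p) {a..b}"
    by (intro integrable_integral integrable_continuous_interval continuous_on_subset[OF assms(1)]) simp
  from nn_integral_has_integral_lebesgue'[OF _ this] show ?thesis
    using assms(2) by (simp add: mult.commute)
qed

lemma (in one_dim_transport) nn_integral_p: "(\<integral>\<^sup>+r. ennreal (p r) \<partial>lborel) = ennreal P"
proof -
  have "(\<integral>\<^sup>+r. ennreal (p r) \<partial>lborel) = (\<integral>\<^sup>+r. ennreal (p r) * indicator {-M..M} r \<partial>lborel)"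
    by (intro nn_integral_cong) (auto simp: indicator_def p_support)
  then show ?thesis
    using nn_integral_interval[OF p_cont p_nonneg] by (simp add: P_def)
qed

lemma (in one_dim_transport) nn_integral_g:
  "(\<integral>\<^sup>+r. ennreal (g r) * indicator {-R..R} r \<partial>lborel) = ennreal Q"
  using nn_integral_interval[OF g_cont] g_pos by (simp add: Q_def less_imp_le)

lemma (in one_dim_transport) P_eq_0: "P = 0 \<Longrightarrow> p s = 0"
proof (cases "\<bar>s\<bar> \<ge> M")
  case False
  assume "P = 0"
  then have "\<forall>x\<in>{-M..M}. p x = 0"
    unfolding P_def using M_pos p_nonneg
    by (subst (asm) integral_eq_0_iff) (auto intro: continuous_on_subset[OF p_cont])
  moreover have "s \<in> {-M..M}" using False by auto
  ultimately show ?thesis by blast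
qed (simp add: p_support)

lemma (in one_dim_transport) pushforward:
  assumes h[measurable]: "h \<in> borel_measurable borel"
  shows "(\<integral>\<^sup>+s. h (\<tau> s) * ennreal (p s) \<partial>lborel) =
    ennreal (P / Q) * (\<integral>\<^sup>+y. h y * ennreal (g y) * indicator {-R..R} y \<partial>lborel)"
  using \<tau>_pushforward[OF _ h] P_eq_0 P_nonneg by (cases "P = 0") auto

lemma source_real: "source p \<Longrightarrow> target g \<Longrightarrow> R > 0 \<Longrightarrow> \<exists>M. one_dim_transport g R p M"
  by (force simp: source_def target_def one_dim_transport_def one_dim_target_def one_dim_transport_axioms_def)

lemma knothe_real: "knothe TYPE(real)"
  unfolding knothe_def
proof (intro allI impI)
  fix R :: real and F G :: "real \<Rightarrow> real"
  assume R: "R > 0" and F: "source F" and G: "target G"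
    and mass: "(\<integral>\<^sup>+x. F x \<partial>lborel) = (\<integral>\<^sup>+y. ennreal (G y) * indicator (cube R) y \<partial>lborel)"
  obtain M where "one_dim_transport G R F M"
    using source_real[OF F G R] by blast
  then interpret one_dim_transport G R F M .
  have cube: "cube R = {-R..R}" by (auto simp: cube_def)
  have PQ: "P = Q"
    using mass Q_pos P_nonneg unfolding cube nn_integral_p nn_integral_g by simp
  have [measurable]: "F \<in> borel_measurable borel" "G \<in> borel_measurable borel"
    using g_cont p_cont by (auto intro: borel_measurable_continuous_onI)
  have "continuous_on UNIV \<tau>"
    by (intro continuous_at_imp_continuous_on ballI DERIV_isCont[OF \<tau>_deriv])
  then have [measurable]: "\<tau> \<in> borel_measurable borel"
    by (rule borel_measurable_continuous_onI)
  have "transports R F G \<tau> (\<lambda>_ s. Q * F s / (P * G (\<tau> s)))"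
    unfolding transports_def
  proof (intro conjI allI ballI)
    fix x b :: real assume "b \<in> Basis"
    then have b: "b = 1" by simp
    show "((\<lambda>t. \<tau> (x + t *\<^sub>R b) \<bullet> b) has_real_derivative Q * F x / (P * G (\<tau> x))) (at 0)"
      using \<tau>_deriv[of x] DERIV_shift[of \<tau> _ 0 x] by (simp add: b add.commute)
  next
    fix h :: "real \<Rightarrow> ennreal" assume "h \<in> borel_measurable borel"
    from pushforward[OF this]
    show "(\<integral>\<^sup>+x. h (\<tau> x) * ennreal (F x) \<partial>lborel) =
        (\<integral>\<^sup>+y. h y * ennreal (G y) * indicator (cube R) y \<partial>lborel)"
      using Q_pos by (simp add: PQ cube)
  next
    fix x show "F x = G (\<tau> x) * (\<Prod>b\<in>(Basis :: real set). Q * F x / (P * G (\<tau> x)))"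
      using g_pos[of "\<tau> x"] Q_pos by (simp add: PQ)
  qed (use \<tau>_bound \<tau>_deriv_nonneg in auto)
  then show "\<exists>T d. transports R F G T d" by blast
qed

lemma Basis_prod_real:
  "(Basis :: ('a::euclidean_space \<times> real) set) = insert (0, 1) ((\<lambda>u. (u, 0)) ` Basis)"
  by (auto simp: Basis_prod_def)

lemma prod_Basis_prod_real:
  "(\<Prod>b\<in>(Basis :: ('a::euclidean_space \<times> real) set). f b) = (\<Prod>u\<in>Basis. f (u, 0)) * f (0, 1)"
  unfolding Basis_prod_real by (subst prod.insert) (auto simp: prod.reindex inj_on_def ac_simps)

lemma indicator_cube_prod:
  "indicator (cube R) (y :: 'a::euclidean_space, s :: real) = (indicator (cube R) y * indicator {-R..R} s :: ennreal)"
  by (auto simp: cube_def Basis_prod_real indicator_def)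

lemma cube_borel [measurable]: "cube R \<in> sets borel"
  unfolding cube_def by measurable

lemma nn_integral_lborel_pair:
  fixes f :: "'a::euclidean_space \<times> 'b::euclidean_space \<Rightarrow> ennreal"
  assumes [measurable]: "f \<in> borel_measurable borel"
  shows "(\<integral>\<^sup>+z. f z \<partial>lborel) = (\<integral>\<^sup>+x. \<integral>\<^sup>+y. f (x, y) \<partial>lborel \<partial>lborel)"
proof -
  have "f \<in> borel_measurable (lborel \<Otimes>\<^sub>M lborel)"
    by (simp add: lborel_prod)
  from lborel.nn_integral_fst[OF this] show ?thesis by (simp add: lborel_prod)
qed

lemma continuous_on_slice: "continuous_on UNIV F \<Longrightarrow> continuous_on UNIV (\<lambda>r. F (x, r))"
  by (rule continuous_on_compose2[of UNIV F]) (auto intro!: continuous_intros)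

lemma continuous_on_marginal:
  fixes F :: "'a::euclidean_space \<times> real \<Rightarrow> real"
  assumes "continuous_on UNIV F"
  shows "continuous_on UNIV (\<lambda>x. integral {a..b} (\<lambda>r. F (x, r)))"
  using integral_continuous_on_param[of UNIV a b "\<lambda>x r. F (x, r)"] continuous_on_subset[OF assms]
  by (simp add: case_prod_beta')

text \<open>The new component transports the conditional densities. Where the marginal \<open>F1\<close> vanishes it is
  constant and has derivative \<open>0\<close>, because division by zero yields zero.\<close>

lemma knothe_step:
  assumes "knothe TYPE('a::euclidean_space)"
  shows "knothe TYPE('a \<times> real)"
  unfolding knothe_def
proof (intro allI impI)
  fix R :: real and F G :: "'a \<times> real \<Rightarrow> real"
  assume R: "R > 0" and F: "source F" and G: "target G"
    and mass: "(\<integral>\<^sup>+x. F x \<partial>lborel) = (\<integral>\<^sup>+y. ennreal (G y) * indicator (cube R) y \<partial>lborel)"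
  have F_cont: "continuous_on UNIV F" and F_nonneg: "0 \<le> F x" for x
    using F unfolding source_def by blast+
  have G_cont: "continuous_on UNIV G" and G_pos: "0 < G x" for x
    using G unfolding target_def by blast+
  obtain M where M: "M > 0" and F_supp: "\<And>x. (\<exists>b\<in>Basis. M \<le> \<bar>x \<bullet> b\<bar>) \<Longrightarrow> F x = 0"
    using F unfolding source_def by blast
  have F_supp1: "M \<le> \<bar>r\<bar> \<Longrightarrow> F (x, r) = 0" for x r
    by (intro F_supp bexI[of _ "(0, 1)"]) (auto simp: Basis_prod_real)
  have F_supp2: "F (x, r) = 0" if ex: "\<exists>b\<in>Basis. M \<le> \<bar>x \<bullet> b\<bar>" for x r
  proof -
    obtain b where "b \<in> Basis" "M \<le> \<bar>x \<bullet> b\<bar>" using ex by blast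
    then show ?thesis
      by (intro F_supp bexI[of _ "(b, 0)"]) (auto simp: Basis_prod_real)
  qed
  have [measurable]: "F \<in> borel_measurable borel" "G \<in> borel_measurable borel"
    using F_cont G_cont by (auto intro: borel_measurable_continuous_onI)
  \<comment> \<open>Marginals of the source and of the target restricted in the last coordinate.
    They have equal mass on the smaller space, so the induction hypothesis applies to them.\<close>
  define F1 where "F1 x = integral {-M..M} (\<lambda>r. F (x, r))" for x
  define G1 where "G1 y = integral {-R..R} (\<lambda>r. G (y, r))" for y
  \<comment> \<open>The slice of \<open>F\<close> over \<open>x\<close> and the slice of
    \<open>G\<close> over \<open>y\<close> are paired for arbitrary \<open>x\<close> and
    \<open>y\<close>; the map will use \<open>y = S x\<close>.\<close>
  have tr: "one_dim_transport (\<lambda>r. G (y, r)) R (\<lambda>r. F (x, r)) M" for x y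
    by unfold_locales (use F_cont G_cont R M F_nonneg G_pos F_supp1 in \<open>auto intro: continuous_on_slice\<close>)
  have P: "one_dim_transport.P (\<lambda>r. F (x, r)) M = F1 x" for x y
    unfolding one_dim_transport.P_def[OF tr] F1_def by simp
  have Q: "one_dim_transport.Q (\<lambda>r. G (y, r)) R = G1 y" for x y
    unfolding one_dim_transport.Q_def[OF tr] G1_def by simp
  note PQ = P Q
  have G1_pos: "G1 y > 0" for y
    using one_dim_transport.Q_pos[OF tr] by (simp add: Q)
  have F1_nonneg: "F1 x \<ge> 0" for x
    using one_dim_transport.P_nonneg[OF tr] by (simp add: P)
  have F1_nn: "ennreal (F1 x) = (\<integral>\<^sup>+r. F (x, r) \<partial>lborel)" for x
    using one_dim_transport.nn_integral_p[OF tr] by (simp add: P)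
  have G1_nn: "ennreal (G1 y) = (\<integral>\<^sup>+r. ennreal (G (y, r)) * indicator {-R..R} r \<partial>lborel)" for y
    using one_dim_transport.nn_integral_g[OF tr] by (simp add: Q)
  have cont1: "continuous_on UNIV F1" "continuous_on UNIV G1"
    unfolding F1_def[abs_def] G1_def[abs_def] by (intro continuous_on_marginal F_cont G_cont)+
  then have [measurable]: "F1 \<in> borel_measurable borel" "G1 \<in> borel_measurable borel"
    by (auto intro: borel_measurable_continuous_onI)
  have "source F1"
    unfolding source_def
  proof (intro conjI cont1 allI F1_nonneg exI[of _ M] M impI)
    fix x :: 'a assume "\<exists>b\<in>Basis. M \<le> \<bar>x \<bullet> b\<bar>"
    then show "F1 x = 0" unfolding F1_def using F_supp2 by simp
  qed
  moreover have "target G1"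
    unfolding target_def using cont1 G1_pos by blast
  moreover have "(\<integral>\<^sup>+x. F1 x \<partial>lborel) = (\<integral>\<^sup>+y. ennreal (G1 y) * indicator (cube R) y \<partial>lborel)"
  proof -
    have "(\<integral>\<^sup>+x. F1 x \<partial>lborel) = (\<integral>\<^sup>+x. F x \<partial>lborel)"
      by (subst nn_integral_lborel_pair) (auto simp: F1_nn)
    also note mass
    also have "(\<integral>\<^sup>+y. ennreal (G y) * indicator (cube R) y \<partial>lborel) =
        (\<integral>\<^sup>+y. ennreal (G1 y) * indicator (cube R) y \<partial>lborel)"
      by (subst nn_integral_lborel_pair)
        (simp_all add: G1_nn indicator_cube_prod nn_integral_cmult ac_simps)
    finally show ?thesis .
  qed
  ultimately obtain S e where Se: "transports R F1 G1 S e"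
    using assms R unfolding knothe_def by blast
  have [measurable]: "S \<in> borel_measurable borel"
    and e_meas: "\<And>b. b \<in> Basis \<Longrightarrow> e b \<in> borel_measurable borel"
    and S_bound: "\<And>x b. b \<in> Basis \<Longrightarrow> \<bar>S x \<bullet> b\<bar> \<le> R"
    and e_nonneg: "\<And>x b. b \<in> Basis \<Longrightarrow> 0 \<le> e b x"
    and S_deriv: "\<And>x b. b \<in> Basis \<Longrightarrow> ((\<lambda>t. S (x + t *\<^sub>R b) \<bullet> b) has_real_derivative e b x) (at 0)"
    and F1_eq: "\<And>x. F1 x = G1 (S x) * (\<Prod>b\<in>Basis. e b x)"
    and push: "\<And>h. h \<in> borel_measurable borel \<Longrightarrow> (\<integral>\<^sup>+x. h (S x) * ennreal (F1 x) \<partial>lborel) =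
        (\<integral>\<^sup>+y. h y * ennreal (G1 y) * indicator (cube R) y \<partial>lborel)"
    using Se by (auto simp: transports_def)
  \<comment> \<open>Spelled out as a quantile, since joint measurability in \<open>x\<close> and
    \<open>s\<close> comes from \<open>quantile_measurable\<close> and is not visible slice by
    slice.\<close>
  define \<tau> where "\<tau> x = (\<lambda>s. quantile R (\<lambda>r. G (S x, r)) (G1 (S x) / F1 x * cdf (-M) (\<lambda>r. F (x, r)) s))" for x
  have \<tau>: "one_dim_transport.\<tau> (\<lambda>r. G (S x, r)) R (\<lambda>r. F (x, r)) M = \<tau> x" for x
    unfolding one_dim_transport.\<tau>_def[OF tr, abs_def] \<tau>_def PQ ..
  define T where "T z = (S (fst z), \<tau> (fst z) (snd z))" for z
  \<comment> \<open>Triangular structure: the components from \<open>S\<close> depend on the first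
    coordinates only, so their diagonal entries are those of \<open>S\<close>; the last entry is the
    derivative of the conditional transport.\<close>
  define d where "d b z = (if b = (0, 1) then G1 (S (fst z)) * F z / (F1 (fst z) * G (T z)) else e (fst b) (fst z))" for b z :: "'a \<times> real"
  have [measurable]: "F \<in> borel_measurable (borel \<Otimes>\<^sub>M borel)" "G \<in> borel_measurable (borel \<Otimes>\<^sub>M borel)"
    by (simp_all add: borel_prod)
  have \<tau>_meas[measurable]: "(\<lambda>z. \<tau> (fst z) (snd z)) \<in> borel_measurable (borel :: ('a \<times> real) measure)"
    unfolding \<tau>_def borel_prod[symmetric]
    apply (rule quantile_measurable)
     apply (unfold case_prod_beta', measurable)[1]
    apply (intro borel_measurable_times borel_measurable_divide cdf_measurable)
       apply (unfold case_prod_beta', measurable)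
    done
  have T_meas[measurable]: "T \<in> borel_measurable borel"
  proof -
    have "(\<lambda>z. S (fst z)) \<in> borel_measurable ((borel :: 'a measure) \<Otimes>\<^sub>M (borel :: real measure))"
      by measurable
    moreover have "(\<lambda>z. \<tau> (fst z) (snd z)) \<in> borel_measurable ((borel :: 'a measure) \<Otimes>\<^sub>M (borel :: real measure))"
      by (simp add: borel_prod)
    ultimately have "T \<in> (borel :: 'a measure) \<Otimes>\<^sub>M (borel :: real measure) \<rightarrow>\<^sub>M borel \<Otimes>\<^sub>M borel"
      unfolding T_def by (rule measurable_Pair)
    then show ?thesis by (simp add: borel_prod)
  qed
  have "transports R F G T d"
    unfolding transports_def
  proof (intro conjI allI ballI T_meas)
    fix b :: "'a \<times> real" assume b: "b \<in> Basis"
    then have fb: "fst b \<in> Basis" if "b \<noteq> (0, 1)"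
      using that by (auto simp: Basis_prod_real)
    show "d b \<in> borel_measurable borel"
    proof (cases "b = (0, 1)")
      case False
      then have [measurable]: "e (fst b) \<in> borel_measurable borel"
        using fb e_meas by blast
      have "(\<lambda>z. e (fst b) (fst z)) \<in> borel_measurable ((borel :: 'a measure) \<Otimes>\<^sub>M (borel :: real measure))"
        by measurable
      then show ?thesis using False unfolding d_def[abs_def] by (simp add: borel_prod)
    next
      case True
      have [measurable]: "T \<in> borel_measurable ((borel :: 'a measure) \<Otimes>\<^sub>M (borel :: real measure))"
        "G \<in> borel_measurable borel"
        using G_cont by (auto simp: borel_prod intro: borel_measurable_continuous_onI)
      have "(\<lambda>z. G1 (S (fst z)) * F z / (F1 (fst z) * G (T z)))
          \<in> borel_measurable ((borel :: 'a measure) \<Otimes>\<^sub>M (borel :: real measure))"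
        by measurable
      then show ?thesis using True unfolding d_def[abs_def] by (simp add: borel_prod)
    qed
    fix z :: "'a \<times> real"
    have zeq: "z = (fst z, snd z)" by simp
    have "0 \<le> d b z \<and> \<bar>T z \<bullet> b\<bar> \<le> R \<and> ((\<lambda>t. T (z + t *\<^sub>R b) \<bullet> b) has_real_derivative d b z) (at 0)"
    proof (cases "b = (0, 1)")
      case True
      have "(\<tau> (fst z) has_real_derivative d b z) (at (snd z))"
        using one_dim_transport.\<tau>_deriv[OF tr[of "S (fst z)" "fst z"], of "snd z"]
        unfolding PQ \<tau> by (simp add: d_def True T_def)
      then have "((\<lambda>t. \<tau> (fst z) (snd z + t)) has_real_derivative d b z) (at 0)"
        using DERIV_shift[of "\<tau> (fst z)" _ 0 "snd z"] by (simp add: add.commute)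
      moreover have "\<bar>\<tau> (fst z) (snd z)\<bar> \<le> R"
        using one_dim_transport.\<tau>_bound[OF tr[of "S (fst z)" "fst z"], of "snd z"] unfolding \<tau> .
      moreover have "0 \<le> d b z"
        using F_nonneg[of z] G1_pos[of "S (fst z)"] F1_nonneg[of "fst z"] G_pos[of "T z"]
        by (simp add: d_def True less_imp_le)
      ultimately show ?thesis
        by (simp add: True T_def)
    next
      case False
      then obtain u where u: "u \<in> Basis" "b = (u, 0)"
        using b by (auto simp: Basis_prod_real)
      show ?thesis
        using S_deriv[OF u(1), of "fst z"] S_bound[OF u(1), of "fst z"] e_nonneg[OF u(1), of "fst z"]
        by (simp add: T_def d_def u)
    qed
    then show "0 \<le> d b z" "\<bar>T z \<bullet> b\<bar> \<le> R"
      "((\<lambda>t. T (z + t *\<^sub>R b) \<bullet> b) has_real_derivative d b z) (at 0)" by blast+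
  next
    fix z :: "'a \<times> real"
    show "F z = G (T z) * (\<Prod>b\<in>Basis. d b z)"
    proof (cases "F1 (fst z) = 0")
      case True
      \<comment> \<open>On a slice of zero mass both sides vanish: the last diagonal entry has the
        factor \<open>F z\<close>.\<close>
      then have "F z = 0"
        using one_dim_transport.P_eq_0[OF tr[where x = "fst z"], where s = "snd z"] by (simp add: P)
      then show ?thesis
        unfolding prod_Basis_prod_real by (simp add: d_def)
    next
      case False
      have "(\<Prod>u\<in>Basis. d (u, 0) z) = (\<Prod>u\<in>Basis. e u (fst z))"
        by (simp add: d_def)
      moreover have "d (0, 1) z = G1 (S (fst z)) * F z / (F1 (fst z) * G (T z))"
        by (simp add: d_def)
      moreover have "(\<Prod>u\<in>Basis. e u (fst z)) = F1 (fst z) / G1 (S (fst z))"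
        using F1_eq[of "fst z"] G1_pos[of "S (fst z)"] by (simp add: field_simps)
      ultimately show ?thesis
        unfolding prod_Basis_prod_real using False G_pos[of "T z"] G1_pos[of "S (fst z)"]
        by (simp add: less_imp_neq[THEN not_sym])
    qed
  next
    fix h :: "'a \<times> real \<Rightarrow> ennreal" assume h[measurable]: "h \<in> borel_measurable borel"
    \<comment> \<open>The conditional expectation of \<open>h\<close> over the slice at
      \<open>y\<close> with respect to the normalised density \<open>G / G1\<close>. The
      one-dimensional push-forward reduces \<open>h\<close> to \<open>k\<close>, and the
      push-forward under \<open>S\<close> is then applied to \<open>k\<close>.\<close>
    define k where "k y = ennreal (1 / G1 y) * (\<integral>\<^sup>+s. h (y, s) * ennreal (G (y, s)) * indicator {-R..R} s \<partial>lborel)" for y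
    have [measurable]: "k \<in> borel_measurable borel"
      unfolding k_def[abs_def] by measurable
    have hT: "(\<lambda>z. h (T z) * ennreal (F z)) \<in> borel_measurable borel"
      using \<open>F \<in> borel_measurable borel\<close> by measurable
    have "(\<integral>\<^sup>+z. h (T z) * ennreal (F z) \<partial>lborel) =
        (\<integral>\<^sup>+x. \<integral>\<^sup>+s. h (S x, \<tau> x s) * ennreal (F (x, s)) \<partial>lborel \<partial>lborel)"
      by (subst nn_integral_lborel_pair[OF hT]) (simp add: T_def)
    also have "\<dots> = (\<integral>\<^sup>+x. k (S x) * ennreal (F1 x) \<partial>lborel)"
    proof (rule nn_integral_cong)
      fix x
      have "(\<lambda>s. h (S x, s)) \<in> borel_measurable borel" by measurable
      from one_dim_transport.pushforward[OF tr[of "S x" x] this]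
      have "(\<integral>\<^sup>+s. h (S x, \<tau> x s) * ennreal (F (x, s)) \<partial>lborel) = ennreal (F1 x / G1 (S x)) *
          (\<integral>\<^sup>+s. h (S x, s) * ennreal (G (S x, s)) * indicator {-R..R} s \<partial>lborel)"
        unfolding PQ \<tau> .
      also have "ennreal (F1 x / G1 (S x)) = ennreal (1 / G1 (S x)) * ennreal (F1 x)"
        using F1_nonneg[of x] G1_pos[of "S x"] by (subst ennreal_mult''[symmetric]) auto
      finally show "(\<integral>\<^sup>+s. h (S x, \<tau> x s) * ennreal (F (x, s)) \<partial>lborel) = k (S x) * ennreal (F1 x)"
        by (simp add: k_def ac_simps)
    qed
    also have "\<dots> = (\<integral>\<^sup>+y. k y * ennreal (G1 y) * indicator (cube R) y \<partial>lborel)"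
      by (rule push) measurable
    also have "\<dots> = (\<integral>\<^sup>+y. \<integral>\<^sup>+s. h (y, s) * ennreal (G (y, s)) * indicator (cube R) (y, s) \<partial>lborel \<partial>lborel)"
    proof (rule nn_integral_cong)
      fix y
      have 1: "ennreal (1 / G1 y) * ennreal (G1 y) = 1"
        using G1_pos[of y] by (subst ennreal_mult''[symmetric]) auto
      have "k y * ennreal (G1 y) * indicator (cube R) y =
         (ennreal (1 / G1 y) * ennreal (G1 y)) * ((\<integral>\<^sup>+s. h (y, s) * ennreal (G (y, s)) * indicator {-R..R} s \<partial>lborel) * indicator (cube R) y)"
        unfolding k_def by (simp only: ac_simps)
      also have "\<dots> = (\<integral>\<^sup>+s. h (y, s) * ennreal (G (y, s)) * indicator {-R..R} s * indicator (cube R) y \<partial>lborel)"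
        unfolding 1 by (simp add: nn_integral_multc)
      finally show "k y * ennreal (G1 y) * indicator (cube R) y =
          (\<integral>\<^sup>+s. h (y, s) * ennreal (G (y, s)) * indicator (cube R) (y, s) \<partial>lborel)"
        by (simp add: indicator_cube_prod ac_simps)
    qed
    also have "\<dots> = (\<integral>\<^sup>+y. h y * ennreal (G y) * indicator (cube R) y \<partial>lborel)"
      by (subst nn_integral_lborel_pair[of "\<lambda>y. h y * ennreal (G y) * indicator (cube R) y"]) simp_all
    finally show "(\<integral>\<^sup>+z. h (T z) * ennreal (F z) \<partial>lborel) =
        (\<integral>\<^sup>+y. h y * ennreal (G y) * indicator (cube R) y \<partial>lborel)" .
  qed
  then show "\<exists>T d. transports R F G T d" by blast
qed

lemma knothe_dim4: "knothe TYPE(((real \<times> real) \<times> real) \<times> real)"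
  by (intro knothe_step knothe_real)

section \<open>Integration by parts along lines\<close>

lemma nn_integral_lborel_translate:
  fixes c :: "'a::euclidean_space"
  assumes [measurable]: "f \<in> borel_measurable borel"
  shows "(\<integral>\<^sup>+x. f (x + c) \<partial>lborel) = (\<integral>\<^sup>+x. f x \<partial>lborel)"
proof -
  have "(\<integral>\<^sup>+x. f x \<partial>lborel) = (\<integral>\<^sup>+x. f x \<partial>distr lborel borel ((+) c))"
    by (simp add: lborel_distr_plus)
  also have "\<dots> = (\<integral>\<^sup>+x. f (c + x) \<partial>lborel)"
    by (rule nn_integral_distr) auto
  finally show ?thesis by (simp add: add.commute)
qed

lemma
  fixes c :: "'a::euclidean_space" and f :: "'a \<Rightarrow> 'b::{banach, second_countable_topology}"
  assumes f: "integrable lborel f"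
  shows integrable_lborel_translate: "integrable lborel (\<lambda>x. f (x + c))"
    and integral_lborel_translate: "(\<integral>x. f (x + c) \<partial>lborel) = (\<integral>x. f x \<partial>lborel)"
proof -
  have "integrable (distr lborel borel ((+) c)) f"
    using f by (simp add: lborel_distr_plus)
  then show "integrable lborel (\<lambda>x. f (x + c))"
    by (subst (asm) integrable_distr_eq) (use f in \<open>auto simp: add.commute\<close>)
  have "(\<integral>x. f x \<partial>distr lborel borel ((+) c)) = (\<integral>x. f (c + x) \<partial>lborel)"
    using f by (intro integral_distr) auto
  then show "(\<integral>x. f (x + c) \<partial>lborel) = (\<integral>x. f x \<partial>lborel)"
    by (simp add: lborel_distr_plus add.commute)
qed

text \<open>Fubini's theorem: all translates of \<open>g\<close> have the same integral, and the
  parameter interval has length one.\<close>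

lemma
  fixes b :: "'a::euclidean_space" and g :: "'a \<Rightarrow> 'b::{banach, second_countable_topology}"
  assumes g: "integrable lborel g"
  shows integrable_line_average: "integrable lborel (\<lambda>x. \<integral>s. indicator {0..1::real} s *\<^sub>R g (x + s *\<^sub>R b) \<partial>lborel)"
    and integral_line_average:
      "(\<integral>x. (\<integral>s. indicator {0..1::real} s *\<^sub>R g (x + s *\<^sub>R b) \<partial>lborel) \<partial>lborel) = (\<integral>x. g x \<partial>lborel)"
proof -
  have [measurable]: "g \<in> borel_measurable borel" using g by auto
  let ?f = "\<lambda>x s. indicator {0..1::real} s *\<^sub>R g (x + s *\<^sub>R b)"
  have meas: "case_prod ?f \<in> borel_measurable (lborel \<Otimes>\<^sub>M lborel)"
    by measurable
  have "(\<integral>\<^sup>+z. norm (case_prod ?f z) \<partial>(lborel \<Otimes>\<^sub>M lborel)) = (\<integral>\<^sup>+s. \<integral>\<^sup>+x. norm (?f x s) \<partial>lborel \<partial>lborel)"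
    using meas by (subst lborel_pair.nn_integral_snd[symmetric]) auto
  also have "\<dots> = (\<integral>\<^sup>+s. indicator {0..1::real} s * (\<integral>\<^sup>+x. norm (g x) \<partial>lborel) \<partial>lborel)"
    by (intro nn_integral_cong)
      (simp add: nn_integral_lborel_translate[of "\<lambda>x. ennreal (norm (g x))"] nn_integral_cmult indicator_def)
  also have "\<dots> = (\<integral>\<^sup>+x. norm (g x) \<partial>lborel)"
    by (simp add: nn_integral_multc)
  also have "\<dots> < \<infinity>" using g by (simp add: integrable_iff_bounded)
  finally have int: "integrable (lborel \<Otimes>\<^sub>M lborel) (case_prod ?f)"
    using meas by (simp add: integrable_iff_bounded)
  show "integrable lborel (\<lambda>x. \<integral>s. ?f x s \<partial>lborel)"
    using lborel_pair.integrable_fst'[OF int] by simp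
  have "(\<integral>x. (\<integral>s. ?f x s \<partial>lborel) \<partial>lborel) = (\<integral>s. (\<integral>x. ?f x s \<partial>lborel) \<partial>lborel)"
    by (rule lborel_pair.Fubini_integral[OF int, symmetric])
  also have "\<dots> = (\<integral>s. indicator {0..1::real} s *\<^sub>R (\<integral>x. g x \<partial>lborel) \<partial>lborel)"
    by (simp add: integral_lborel_translate[OF g])
  also have "\<dots> = (\<integral>x. g x \<partial>lborel)"
    by simp
  finally show "(\<integral>x. (\<integral>s. ?f x s \<partial>lborel) \<partial>lborel) = (\<integral>x. g x \<partial>lborel)" .
qed

lemma has_vector_derivative_along_line:
  fixes u g :: "'a::real_normed_vector \<Rightarrow> 'b::real_normed_vector"
  assumes "\<And>x. ((\<lambda>t. u (x + t *\<^sub>R b)) has_vector_derivative g x) (at 0)"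
  shows "((\<lambda>t. u (x + t *\<^sub>R b)) has_vector_derivative g (x + s *\<^sub>R b)) (at s)"
proof -
  have "((\<lambda>t. u (x + s *\<^sub>R b + t *\<^sub>R b)) has_vector_derivative g (x + s *\<^sub>R b)) (at (s - s))"
    using assms[of "x + s *\<^sub>R b"] by simp
  moreover have "((\<lambda>t. t - s) has_vector_derivative 1) (at s)"
    by (auto intro!: derivative_eq_intros simp: has_vector_derivative_def)
  ultimately have "((\<lambda>t. u (x + s *\<^sub>R b + t *\<^sub>R b)) \<circ> (\<lambda>t. t - s) has_vector_derivative 1 *\<^sub>R g (x + s *\<^sub>R b)) (at s)"
    by (intro vector_diff_chain_at)
  moreover have "x + s *\<^sub>R b + (t - s) *\<^sub>R b = x + t *\<^sub>R b" for t
    by (simp add: scaleR_left_diff_distrib)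
  ultimately show ?thesis by (simp add: comp_def)
qed

text \<open>Averaging \<open>g\<close> along a unit segment turns it into the difference of two translates of \<open>u\<close>; this
  replaces Fubini's theorem in the direction of \<open>b\<close>.\<close>

lemma integral_directional_derivative:
  fixes u g :: "'a::euclidean_space \<Rightarrow> 'b::euclidean_space"
  assumes u: "integrable lborel u" and g: "integrable lborel g" and cont: "continuous_on UNIV g"
    and deriv: "\<And>x. ((\<lambda>t. u (x + t *\<^sub>R b)) has_vector_derivative g x) (at 0)"
  shows "(\<integral>x. g x \<partial>lborel) = 0"
proof -
  have "(\<integral>s. indicator {0..1} s *\<^sub>R g (x + s *\<^sub>R b) \<partial>lborel) = u (x + 1 *\<^sub>R b) - u (x + 0 *\<^sub>R b)" for x
  proof (rule integral_FTC_Icc)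
    show "((\<lambda>s. u (x + s *\<^sub>R b)) has_vector_derivative g (x + s *\<^sub>R b)) (at s within {0..1})" for s
      using has_vector_derivative_along_line[OF deriv] by (rule has_vector_derivative_at_within)
    show "continuous_on {0..1} (\<lambda>s. g (x + s *\<^sub>R b))"
      by (rule continuous_on_compose2[OF cont]) (auto intro!: continuous_intros)
  qed simp
  with integral_line_average[OF g, of b]
  have "(\<integral>x. g x \<partial>lborel) = (\<integral>x. u (x + b) - u x \<partial>lborel)" by simp
  also have "\<dots> = 0"
    by (simp add: integral_lborel_translate[OF u] integrable_lborel_translate[OF u] u)
  finally show ?thesis .
qed

text \<open>Integration by parts when one part of the derivative is known only to be nonnegative and
  measurable, as with a diagonal entry of the Knothe Jacobian. The fundamental theorem for
  nonnegative functions works on each segment, and Tonelli's theorem yields the finiteness of the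
  integral of \<open>g\<close> along with its value.\<close>

lemma nn_integral_directional_derivative:
  fixes u g h :: "'a::euclidean_space \<Rightarrow> real"
  assumes u: "integrable lborel u" and h: "integrable lborel h"
    and g[measurable]: "g \<in> borel_measurable borel" and g_nonneg: "\<And>x. 0 \<le> g x"
    and cont: "\<And>x. continuous_on UNIV (\<lambda>t. h (x + t *\<^sub>R b))"
    and deriv: "\<And>x. ((\<lambda>t. u (x + t *\<^sub>R b)) has_real_derivative g x + h x) (at 0)"
  shows "(\<integral>\<^sup>+x. g x \<partial>lborel) = ennreal (- (\<integral>x. h x \<partial>lborel))" "(\<integral>x. h x \<partial>lborel) \<le> 0"
proof -
  have [measurable]: "h \<in> borel_measurable borel" using h by auto
  \<comment> \<open>This will be the integral of \<open>g\<close> over the segment from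
    \<open>x\<close> to \<open>x + b\<close>: the increment of \<open>u\<close> minus the
    contribution of \<open>h\<close>.\<close>
  define k where "k x = u (x + b) - u x - (\<integral>s. indicator {0..1::real} s *\<^sub>R h (x + s *\<^sub>R b) \<partial>lborel)" for x
  have k_int: "integrable lborel k"
    unfolding k_def[abs_def]
    by (intro Bochner_Integration.integrable_diff integrable_line_average integrable_lborel_translate u h)
  have line: "(\<integral>\<^sup>+s. ennreal (g (x + s *\<^sub>R b)) * indicator {0..1} s \<partial>lborel) = ennreal (k x) \<and> 0 \<le> k x" for x
  proof -
    let ?h = "\<lambda>s. h (x + s *\<^sub>R b)"
    \<comment> \<open>Subtracting an antiderivative of \<open>h\<close> leaves a function with
      derivative \<open>g\<close>. The base point -1 makes the antiderivative differentiable at 0 as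
      well.\<close>
    let ?U = "\<lambda>s. u (x + s *\<^sub>R b) - cdf (-1) ?h s"
    have d: "(?U has_real_derivative g (x + s *\<^sub>R b)) (at s)" if "s \<in> {0..1}" for s
    proof -
      have "((\<lambda>s. u (x + s *\<^sub>R b)) has_real_derivative g (x + s *\<^sub>R b) + h (x + s *\<^sub>R b)) (at s)"
        using has_vector_derivative_along_line[of u b "\<lambda>x. g x + h x"] deriv
        by (simp add: has_real_derivative_iff_has_vector_derivative)
      moreover have "(cdf (-1) ?h has_real_derivative ?h s) (at s)"
        using that by (intro cdf_has_derivative cont) auto
      ultimately have "(?U has_real_derivative (g (x + s *\<^sub>R b) + h (x + s *\<^sub>R b)) - ?h s) (at s)"
        by (rule DERIV_diff)
      then show ?thesis by simp
    qed
    have eq: "?U 1 - ?U 0 = k x"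
    proof -
      have "cdf (-1) ?h 1 - cdf (-1) ?h 0 = integral {0..1} ?h"
        by (rule cdf_diff[OF cont]) auto
      also have "\<dots> = (\<integral>s. indicator {0..1::real} s *\<^sub>R ?h s \<partial>lborel)"
        using cdf_eq_integral[OF cont, of 0 x 1] by (simp add: cdf_def)
      finally show ?thesis by (simp add: k_def)
    qed
    have "(\<integral>\<^sup>+s. ennreal (g (x + s *\<^sub>R b)) * indicator {0..1} s \<partial>lborel) = ennreal (?U 1 - ?U 0)"
      by (rule nn_integral_FTC_Icc) (use d g_nonneg in auto)
    moreover have "?U 0 \<le> ?U 1"
      using d g_nonneg by (intro DERIV_nonneg_imp_nondecreasing[of 0 1 ?U]) (auto intro!: exI)
    ultimately show ?thesis unfolding eq[symmetric] by simp
  qed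
  have "(\<integral>\<^sup>+x. g x \<partial>lborel) = (\<integral>\<^sup>+s. (\<integral>\<^sup>+x. ennreal (g x) \<partial>lborel) * indicator {0..1::real} s \<partial>lborel)"
    by (simp add: nn_integral_cmult)
  also have "\<dots> = (\<integral>\<^sup>+s. (\<integral>\<^sup>+x. ennreal (g (x + s *\<^sub>R b)) * indicator {0..1::real} s \<partial>lborel) \<partial>lborel)"
    by (simp add: nn_integral_multc nn_integral_lborel_translate[of "\<lambda>x. ennreal (g x)"])
  also have "\<dots> = (\<integral>\<^sup>+x. (\<integral>\<^sup>+s. ennreal (g (x + s *\<^sub>R b)) * indicator {0..1::real} s \<partial>lborel) \<partial>lborel)"
    by (rule lborel_pair.Fubini') measurable
  also have "\<dots> = (\<integral>\<^sup>+x. ennreal (k x) \<partial>lborel)"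
    using line by simp
  also have "\<dots> = ennreal (\<integral>x. k x \<partial>lborel)"
    using line k_int by (intro nn_integral_eq_integral) auto
  also have eq: "(\<integral>x. k x \<partial>lborel) = - (\<integral>x. h x \<partial>lborel)"
    unfolding k_def
    by (simp add: integrable_line_average[OF h, simplified] integral_line_average[OF h, simplified]
        integral_lborel_translate[OF u] integrable_lborel_translate[OF u] u)
  finally show "(\<integral>\<^sup>+x. g x \<partial>lborel) = ennreal (- (\<integral>x. h x \<partial>lborel))" .
  have "0 \<le> (\<integral>x. k x \<partial>lborel)"
    using line by (intro integral_nonneg_AE) auto
  then show "(\<integral>x. h x \<partial>lborel) \<le> 0" unfolding eq by simp
qed

section \<open>The sharp Sobolev inequality by transport\<close>

text \<open>The two-term inequality, applied to two pairs and then to the two means.\<close>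

lemma prod_le_arith_mean_power4:
  fixes d :: "'a \<Rightarrow> real"
  assumes "card S = 4" "\<And>b. b \<in> S \<Longrightarrow> 0 \<le> d b"
  shows "(\<Prod>b\<in>S. d b) \<le> ((\<Sum>b\<in>S. d b) / 4) ^ 4"
proof -
  have two: "x * y \<le> ((x + y) / 2)\<^sup>2" for x y :: real
  proof -
    have "0 \<le> (x - y)\<^sup>2" by simp
    then show ?thesis by (simp add: power2_eq_square algebra_simps)
  qed
  have "finite S" using assms(1) by (intro card_ge_0_finite) simp
  then obtain xs where xs: "set xs = S" "distinct xs" using finite_distinct_list by blast
  then have "length xs = 4" using distinct_card[of xs] assms(1) by simp
  then obtain p q r s where "xs = [p, q, r, s]"
    by (auto simp: numeral_eq_Suc length_Suc_conv)
  with xs have S: "S = {p, q, r, s}" and "distinct [p, q, r, s]" by auto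
  then have eq: "(\<Prod>b\<in>S. d b) = (d p * d q) * (d r * d s)" "(\<Sum>b\<in>S. d b) = (d p + d q) + (d r + d s)"
    by auto
  have "(d p * d q) * (d r * d s) \<le> ((d p + d q) / 2)\<^sup>2 * ((d r + d s) / 2)\<^sup>2"
    using assms(2) by (intro mult_mono two) (auto simp: S)
  also have "\<dots> = ((d p + d q) / 2 * ((d r + d s) / 2))\<^sup>2"
    by (simp only: power_mult_distrib)
  also have "\<dots> \<le> ((((d p + d q) / 2 + (d r + d s) / 2) / 2)\<^sup>2)\<^sup>2"
    using assms(2) by (intro power_mono two) (auto simp: S)
  also have "\<dots> = (((d p + d q) + (d r + d s)) / 4) ^ 4"
    by (simp add: power2_eq_square power4_eq_xxxx field_simps)
  finally show ?thesis unfolding eq .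
qed

lemma cauchy_schwarz_integral:
  fixes f g :: "'a \<Rightarrow> real"
  assumes [measurable]: "f \<in> borel_measurable M" "g \<in> borel_measurable M"
    and f: "integrable M (\<lambda>x. f x ^ 2)" and g: "integrable M (\<lambda>x. g x ^ 2)"
  shows "integrable M (\<lambda>x. f x * g x)"
    and "(\<integral>x. \<bar>f x * g x\<bar> \<partial>M)\<^sup>2 \<le> (\<integral>x. f x ^ 2 \<partial>M) * (\<integral>x. g x ^ 2 \<partial>M)"
proof -
  show int: "integrable M (\<lambda>x. f x * g x)"
  proof (rule Bochner_Integration.integrable_bound)
    show "integrable M (\<lambda>x. f x ^ 2 + g x ^ 2)" using f g by auto
    have "\<bar>f x * g x\<bar> \<le> f x ^ 2 + g x ^ 2" for x
    proof -
      have "2 * \<bar>f x * g x\<bar> \<le> f x ^ 2 + g x ^ 2"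
        using sum_squares_bound[of "\<bar>f x\<bar>" "\<bar>g x\<bar>"] by (simp add: abs_mult)
      moreover have "0 \<le> \<bar>f x * g x\<bar>" by simp
      ultimately show ?thesis by linarith
    qed
    then show "AE x in M. norm (f x * g x) \<le> norm (f x ^ 2 + g x ^ 2)" by auto
  qed measurable
  have sq: "ennreal \<bar>h x\<bar> ^ 2 = ennreal (h x ^ 2)" for h :: "'a \<Rightarrow> real" and x
    by (simp add: ennreal_power)
  have "ennreal ((\<integral>x. \<bar>f x * g x\<bar> \<partial>M)\<^sup>2) = (\<integral>\<^sup>+x. ennreal \<bar>f x\<bar> * ennreal \<bar>g x\<bar> \<partial>M)\<^sup>2"
  proof -
    have "(\<integral>\<^sup>+x. ennreal \<bar>f x\<bar> * ennreal \<bar>g x\<bar> \<partial>M) = (\<integral>\<^sup>+x. ennreal \<bar>f x * g x\<bar> \<partial>M)"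
      by (simp add: abs_mult ennreal_mult)
    also have "\<dots> = ennreal (\<integral>x. \<bar>f x * g x\<bar> \<partial>M)"
      using int by (intro nn_integral_eq_integral) auto
    finally show ?thesis by (simp add: ennreal_power)
  qed
  also have "\<dots> \<le> (\<integral>\<^sup>+x. ennreal \<bar>f x\<bar> ^ 2 \<partial>M) * (\<integral>\<^sup>+x. ennreal \<bar>g x\<bar> ^ 2 \<partial>M)"
    by (rule Cauchy_Schwarz_nn_integral) measurable
  also have "\<dots> = ennreal ((\<integral>x. f x ^ 2 \<partial>M) * (\<integral>x. g x ^ 2 \<partial>M))"
    unfolding sq using f g by (simp add: nn_integral_eq_integral ennreal_mult)
  finally show "(\<integral>x. \<bar>f x * g x\<bar> \<partial>M)\<^sup>2 \<le> (\<integral>x. f x ^ 2 \<partial>M) * (\<integral>x. g x ^ 2 \<partial>M)"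
    by (subst (asm) ennreal_le_iff) auto
qed

lemma cube_eq_cbox: "cube R = cbox (- R *\<^sub>R One) (R *\<^sub>R One :: 'a::euclidean_space)"
  by (force simp: cube_def mem_box)

lemma integrable_compact_support:
  fixes f :: "'a::euclidean_space \<Rightarrow> 'b::{banach, second_countable_topology}"
  assumes f: "continuous_on UNIV f" and supp: "\<And>x. x \<notin> cube R \<Longrightarrow> f x = 0"
  shows "integrable lborel f"
proof -
  have "integrable lborel (\<lambda>x. indicator (cube R) x *\<^sub>R f x)"
    by (rule borel_integrable_compact) (auto simp: cube_eq_cbox intro: continuous_on_subset[OF f])
  moreover have "(\<lambda>x. indicator (cube R) x *\<^sub>R f x) = f"
    using supp by (auto simp: indicator_def)
  ultimately show ?thesis by simp
qed

definition bubble :: "'a::euclidean_space \<Rightarrow> real" where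
  "bubble x = inverse (1 + norm x ^ 2 / 8)"

lemma bubble_pos: "bubble x > 0"
  unfolding bubble_def by (intro positive_imp_inverse_positive add_pos_nonneg) auto

lemma bubble_nonneg: "0 \<le> bubble x"
  by (rule less_imp_le[OF bubble_pos])

lemma bubble_nonzero: "bubble x \<noteq> 0"
  using bubble_pos[of x] by simp

lemma continuous_on_bubble: "continuous_on S bubble"
proof -
  have "1 + norm x ^ 2 / 8 \<noteq> 0" for x :: 'a
    using bubble_pos[of x] unfolding bubble_def by auto
  then show ?thesis unfolding bubble_def[abs_def] by (intro continuous_intros) auto
qed

lemma bubble_measurable [measurable]: "bubble \<in> borel_measurable borel"
  by (intro borel_measurable_continuous_onI continuous_on_bubble)

text \<open>The Jacobian equation \<open>f^4 = \<kappa>^4 bubble(T)^4 det DT\<close> and the mean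
  inequality give \<open>f \<le> \<kappa> bubble(T) (div T) / 4\<close>. Multiplied by
  \<open>f^3 / bubble(T)\<close> and integrated, the left side becomes \<open>\<kappa>^4\<close>
  times the integral of \<open>bubble^3\<close>, while integration by parts turns the right side
  into \<open>- 3 f^2 Df . T\<close>. Cauchy-Schwarz separates \<open>Df\<close> from
  \<open>f^2 T\<close>, whose square is again computed by push-forward. Fourth powers keep roots out
  of the statement, and 81/256 is \<open>(3/4)^4\<close>.\<close>

lemma sobolev_on_cube:
  fixes f :: "'a::euclidean_space \<Rightarrow> real" and Df :: "'a \<Rightarrow> 'a"
  assumes knothe: "knothe TYPE('a)" and dim: "DIM('a) = 4" and R: "R > 0"
    and f_cont: "continuous_on UNIV f" and Df_cont: "continuous_on UNIV Df" and f_nonneg: "\<And>x. 0 \<le> f x"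
    and M: "M > 0" and f_supp: "\<And>x b. b \<in> Basis \<Longrightarrow> M \<le> \<bar>x \<bullet> b\<bar> \<Longrightarrow> f x = 0"
    and Df_supp: "\<And>x. x \<notin> cube M \<Longrightarrow> Df x = 0"
    and deriv: "\<And>x b. b \<in> Basis \<Longrightarrow> ((\<lambda>t. f (x + t *\<^sub>R b)) has_real_derivative Df x \<bullet> b) (at 0)"
  shows "(\<integral>x. f x ^ 4 \<partial>lborel) * (\<integral>y. indicator (cube R) (y::'a) * bubble y ^ 3 \<partial>lborel) ^ 4 \<le>
    (\<integral>y. indicator (cube R) (y::'a) * bubble y ^ 4 \<partial>lborel) * (81 / 256 * (\<integral>x. norm (Df x) ^ 2 \<partial>lborel)\<^sup>2 *
      (\<integral>y. indicator (cube R) (y::'a) * (norm y ^ 2 * bubble y ^ 4) \<partial>lborel)\<^sup>2)"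
proof -
  define B where "B = (\<integral>x. f x ^ 4 \<partial>lborel)"
  define A where "A = (\<integral>x. norm (Df x) ^ 2 \<partial>lborel)"
  define I where "I = (\<integral>y. indicator (cube R) (y::'a) * bubble y ^ 4 \<partial>lborel)"
  define J3 where "J3 = (\<integral>y. indicator (cube R) (y::'a) * bubble y ^ 3 \<partial>lborel)"
  define J where "J = (\<integral>y. indicator (cube R) (y::'a) * (norm y ^ 2 * bubble y ^ 4) \<partial>lborel)"
  have [measurable]: "f \<in> borel_measurable borel" "Df \<in> borel_measurable borel"
    using f_cont Df_cont by (auto intro: borel_measurable_continuous_onI)
  have f0: "f x = 0" if "x \<notin> cube M" for x
    using that f_supp[of _ x] by (auto simp: cube_def not_le intro: less_imp_le)
  have cube_int: "integrable lborel (\<lambda>y. indicator (cube R) (y::'a) * g y)"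
    and cube_nn: "(\<And>y. 0 \<le> g y) \<Longrightarrow> (\<integral>\<^sup>+y. ennreal (g y) * indicator (cube R) y \<partial>lborel) =
      ennreal (\<integral>y. indicator (cube R) (y::'a) * g y \<partial>lborel)"
    if "continuous_on UNIV g" for g :: "'a \<Rightarrow> real"
  proof -
    show i: "integrable lborel (\<lambda>y. indicator (cube R) (y::'a) * g y)"
      using borel_integrable_compact[of "cube R" g] continuous_on_subset[OF that]
      by (auto simp: cube_eq_cbox)
    assume nn: "\<And>y. 0 \<le> g y"
    have "(\<integral>\<^sup>+y. ennreal (g y) * indicator (cube R) y \<partial>lborel) = (\<integral>\<^sup>+y. ennreal (indicator (cube R) y * g y) \<partial>lborel)"
      by (intro nn_integral_cong) (auto simp: indicator_def)
    also have "\<dots> = ennreal (\<integral>y. indicator (cube R) (y::'a) * g y \<partial>lborel)"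
      using nn by (intro nn_integral_eq_integral i) (auto simp: indicator_def)
    finally show "(\<integral>\<^sup>+y. ennreal (g y) * indicator (cube R) y \<partial>lborel) =
      ennreal (\<integral>y. indicator (cube R) (y::'a) * g y \<partial>lborel)" .
  qed
  have cube_nn': "(\<integral>\<^sup>+y. ennreal (c * g y) * indicator (cube R) y \<partial>lborel) =
      ennreal (c * (\<integral>y. indicator (cube R) (y::'a) * g y \<partial>lborel))"
    if "continuous_on UNIV g" "\<And>y. 0 \<le> g y" "0 \<le> c" for g :: "'a \<Rightarrow> real" and c
    using that by (subst cube_nn) (auto intro!: continuous_intros simp: mult.left_commute[of _ c])
  have int_f: "integrable lborel (\<lambda>x. f x ^ n)" if "n > 0" for n
    by (rule integrable_compact_support[of _ M]) (use that f0 f_cont in \<open>auto intro!: continuous_intros\<close>)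
  have int_Df: "integrable lborel (\<lambda>x. norm (Df x) ^ 2)"
    by (rule integrable_compact_support[of _ M]) (use Df_supp Df_cont in \<open>auto intro!: continuous_intros\<close>)
  have nonneg: "0 \<le> B" "0 \<le> A" "0 \<le> J3" "0 \<le> J"
    unfolding B_def A_def J3_def J_def
    by (auto intro!: integral_nonneg_AE simp: bubble_pos less_imp_le)
  have I_pos: "I > 0"
  proof -
    have "emeasure lborel (cube R :: 'a set) \<noteq> 0"
    proof -
      have "(R *\<^sub>R One - - R *\<^sub>R One) \<bullet> b = 2 * R" if "b \<in> Basis" for b :: 'a
        using that by (simp add: inner_simps)
      then show ?thesis
        using R unfolding cube_eq_cbox emeasure_lborel_cbox_eq by (simp add: inner_simps)
    qed
    moreover have "I = 0 \<longleftrightarrow> (AE y in lborel. indicator (cube R) (y::'a) * bubble y ^ 4 = 0)"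
      unfolding I_def by (intro integral_nonneg_eq_0_iff_AE cube_int continuous_intros continuous_on_bubble) auto
    moreover have "(AE y in lborel. indicator (cube R) (y::'a) * bubble y ^ 4 = 0) \<longleftrightarrow> emeasure lborel (cube R :: 'a set) = 0"
      by (subst AE_iff_measurable[OF _ refl]) (auto simp: indicator_def bubble_nonzero intro!: arg_cong[where f = "\<lambda>S. emeasure lborel S = 0"])
    moreover have "I \<ge> 0" unfolding I_def by (intro integral_nonneg_AE) auto
    ultimately show ?thesis by (simp add: less_le)
  qed
  have "B * J3 ^ 4 \<le> I * (81 / 256 * A\<^sup>2 * J\<^sup>2)"
  proof (cases "B = 0")
    case True
    then show ?thesis using I_pos nonneg by simp
  next
    case False
    \<comment> \<open>Chosen so that \<open>\<kappa>^4 bubble^4\<close> has the mass of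
      \<open>f^4\<close> on the cube.\<close>
    define \<kappa> where "\<kappa> = root 4 (B / I)"
    have \<kappa>4: "\<kappa> ^ 4 = B / I" and \<kappa>: "\<kappa> > 0"
      unfolding \<kappa>_def using False nonneg I_pos by (auto intro!: real_root_pow_pos2)
    define F where "F x = f x ^ 4" for x
    define G where "G y = \<kappa> ^ 4 * bubble y ^ 4" for y :: 'a
    have "source F"
      unfolding source_def F_def using f_cont f_supp f_nonneg M
      by (auto intro!: continuous_intros)
    moreover have "target G"
      unfolding target_def G_def using bubble_pos \<kappa> by (auto intro!: continuous_intros continuous_on_bubble mult_pos_pos zero_less_power)
    moreover have "(\<integral>\<^sup>+x. F x \<partial>lborel) = (\<integral>\<^sup>+y. ennreal (G y) * indicator (cube R) y \<partial>lborel)"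
    proof -
      have "(\<integral>\<^sup>+x. F x \<partial>lborel) = ennreal B"
        unfolding F_def B_def using int_f[of 4] by (intro nn_integral_eq_integral) auto
      moreover have "(\<integral>\<^sup>+y. ennreal (G y) * indicator (cube R) y \<partial>lborel) = ennreal (\<kappa> ^ 4 * I)"
        unfolding G_def I_def using \<kappa> by (intro cube_nn') (auto intro!: continuous_intros continuous_on_bubble)
      ultimately show ?thesis using I_pos by (simp add: \<kappa>4)
    qed
    ultimately obtain T d where "transports R F G T d"
      using knothe R unfolding knothe_def by blast
    then have [measurable]: "T \<in> borel_measurable borel"
      and d_meas: "\<And>b. b \<in> Basis \<Longrightarrow> d b \<in> borel_measurable borel"
      and T_bound: "\<And>x b. b \<in> Basis \<Longrightarrow> \<bar>T x \<bullet> b\<bar> \<le> R"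
      and d_nonneg: "\<And>x b. b \<in> Basis \<Longrightarrow> 0 \<le> d b x"
      and T_deriv: "\<And>x b. b \<in> Basis \<Longrightarrow> ((\<lambda>t. T (x + t *\<^sub>R b) \<bullet> b) has_real_derivative d b x) (at 0)"
      and F_eq: "\<And>x. F x = G (T x) * (\<Prod>b\<in>Basis. d b x)"
      and push: "\<And>h. h \<in> borel_measurable borel \<Longrightarrow> (\<integral>\<^sup>+x. h (T x) * ennreal (F x) \<partial>lborel) =
          (\<integral>\<^sup>+y. h y * ennreal (G y) * indicator (cube R) y \<partial>lborel)"
      by (auto simp: transports_def)
    \<comment> \<open>The part of the derivative of \<open>f^3 (T . b)\<close> that falls on
      \<open>f^3\<close>; the other part is \<open>f^3 d b\<close>, of known sign.\<close>
    define h where "h b x = 3 * f x ^ 2 * (Df x \<bullet> b) * (T x \<bullet> b)" for b x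
    have h_int: "integrable lborel (h b)" if b: "b \<in> Basis" for b
    proof (rule Bochner_Integration.integrable_bound)
      show "integrable lborel (\<lambda>x. R * (3 * f x ^ 2 * (Df x \<bullet> b)))"
        by (rule integrable_compact_support[of _ M]) (use f0 f_cont Df_cont in \<open>auto intro!: continuous_intros\<close>)
      have "norm (h b x) = 3 * f x ^ 2 * \<bar>Df x \<bullet> b\<bar> * \<bar>T x \<bullet> b\<bar>" for x
        by (simp add: h_def abs_mult)
      also have "3 * f x ^ 2 * \<bar>Df x \<bullet> b\<bar> * \<bar>T x \<bullet> b\<bar> \<le> 3 * f x ^ 2 * \<bar>Df x \<bullet> b\<bar> * R" for x
        using T_bound[OF b] by (intro mult_left_mono) auto
      also have "3 * f x ^ 2 * \<bar>Df x \<bullet> b\<bar> * R = norm (R * (3 * f x ^ 2 * (Df x \<bullet> b)))" for x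
        using R by (simp add: abs_mult)
      finally show "AE x in lborel. norm (h b x) \<le> norm (R * (3 * f x ^ 2 * (Df x \<bullet> b)))" by auto
    qed (simp add: h_def[abs_def])
    have u_int: "integrable lborel (\<lambda>x. f x ^ 3 * (T x \<bullet> b))" if b: "b \<in> Basis" for b
    proof (rule Bochner_Integration.integrable_bound)
      show "integrable lborel (\<lambda>x. R * f x ^ 3)"
        using int_f[of 3] by simp
      show "AE x in lborel. norm (f x ^ 3 * (T x \<bullet> b)) \<le> norm (R * f x ^ 3)"
        using T_bound[OF b] R f_nonneg by (auto simp: abs_mult mult.commute[of R] intro!: mult_left_mono)
    qed simp
    have ibp: "(\<integral>\<^sup>+x. ennreal (f x ^ 3 * d b x) \<partial>lborel) = ennreal (- (\<integral>x. h b x \<partial>lborel)) \<and> (\<integral>x. h b x \<partial>lborel) \<le> 0"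
      if b: "b \<in> Basis" for b
    proof -
      have line: "((\<lambda>t. v (x + t *\<^sub>R b)) has_real_derivative v' (x + s *\<^sub>R b)) (at s)"
        if "\<And>x. ((\<lambda>t. v (x + t *\<^sub>R b)) has_real_derivative v' x) (at 0)" for v v' x s
        using has_vector_derivative_along_line[of v b v'] that
        by (simp add: has_real_derivative_iff_has_vector_derivative)
      have 1: "(\<lambda>x. f x ^ 3 * d b x) \<in> borel_measurable borel"
        using d_meas[OF b] by simp
      have 2: "0 \<le> f x ^ 3 * d b x" for x using f_nonneg d_nonneg[OF b] by simp
      have 3: "continuous_on UNIV (\<lambda>t. h b (x + t *\<^sub>R b))" for x
      proof -
        have c1: "continuous_on UNIV (\<lambda>t. T (x + t *\<^sub>R b) \<bullet> b)"
          by (intro continuous_at_imp_continuous_on ballI DERIV_isCont[OF line[of "\<lambda>x. T x \<bullet> b", OF T_deriv[OF b]]])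
        have c2: "continuous_on UNIV (\<lambda>t. f (x + t *\<^sub>R b))" "continuous_on UNIV (\<lambda>t. Df (x + t *\<^sub>R b))"
          by (auto intro!: continuous_on_compose2[OF f_cont] continuous_on_compose2[OF Df_cont] continuous_intros)
        show ?thesis unfolding h_def by (intro continuous_on_mult[OF _ c1] continuous_intros c2)
      qed
      have 4: "((\<lambda>t. f (x + t *\<^sub>R b) ^ 3 * (T (x + t *\<^sub>R b) \<bullet> b)) has_real_derivative f x ^ 3 * d b x + h b x) (at 0)" for x
        by (rule derivative_eq_intros deriv[OF b] T_deriv[OF b] refl)+ (simp add: h_def algebra_simps)
      from nn_integral_directional_derivative[OF u_int[OF b] h_int[OF b] 1 2 3 4]
      show ?thesis by blast
    qed
    \<comment> \<open>After integration by parts this is the integral of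
      \<open>f^3 div T\<close>.\<close>
    define X where "X = (\<Sum>b\<in>Basis. - (\<integral>x. h b x \<partial>lborel))"
    have X_nonneg: "X \<ge> 0" unfolding X_def using ibp by (intro sum_nonneg) auto
    have J3_le: "\<kappa> ^ 4 * J3 \<le> \<kappa> / 4 * X"
    proof -
      have "ennreal (\<kappa> ^ 4 * J3) = (\<integral>\<^sup>+y. ennreal (\<kappa> ^ 4 * bubble (y::'a) ^ 3) * indicator (cube R) y \<partial>lborel)"
        unfolding J3_def using \<kappa>
        by (intro cube_nn'[symmetric]) (auto simp: bubble_nonneg intro!: continuous_intros continuous_on_bubble)
      \<comment> \<open>With \<open>1 / bubble\<close> as test function in the push-forward, the
        target density \<open>bubble^4\<close> becomes \<open>bubble^3\<close>.\<close>
      also have "\<dots> = (\<integral>\<^sup>+y. ennreal (1 / bubble (y::'a)) * ennreal (G y) * indicator (cube R) y \<partial>lborel)"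
      proof (intro nn_integral_cong arg_cong2[where f = "(*)"] refl)
        fix y :: 'a
        show "ennreal (\<kappa> ^ 4 * bubble y ^ 3) = ennreal (1 / bubble y) * ennreal (G y)"
          using bubble_pos[of y] \<kappa> by (subst ennreal_mult'[symmetric]) (auto simp: G_def power_eq_if)
      qed
      also have "\<dots> = (\<integral>\<^sup>+x. ennreal (1 / bubble (T x)) * ennreal (F x) \<partial>lborel)"
        by (rule push[symmetric]) simp
      also have "\<dots> \<le> (\<integral>\<^sup>+x. (\<Sum>b\<in>Basis. ennreal (\<kappa> / 4) * ennreal (f x ^ 3 * d b x)) \<partial>lborel)"
      proof (rule nn_integral_mono)
        fix x
        let ?s = "\<Sum>b\<in>Basis. d b x"
        have s: "?s \<ge> 0" using d_nonneg by (intro sum_nonneg) auto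
        have "f x ^ 4 = (\<kappa> * bubble (T x)) ^ 4 * (\<Prod>b\<in>Basis. d b x)"
          using F_eq[of x] by (simp add: F_def G_def power_mult_distrib)
        also have "\<dots> \<le> (\<kappa> * bubble (T x)) ^ 4 * (?s / 4) ^ 4"
          using prod_le_arith_mean_power4[OF dim, of "\<lambda>b. d b x"] d_nonneg by (intro mult_left_mono) auto
        also have "\<dots> = (\<kappa> * bubble (T x) * (?s / 4)) ^ 4"
          by (simp only: power_mult_distrib)
        finally have "f x \<le> \<kappa> * bubble (T x) * (?s / 4)"
          using f_nonneg[of x] \<kappa> bubble_pos[of "T x"] s
          by (subst (asm) power_mono_iff) (auto intro!: mult_nonneg_nonneg less_imp_le)
        \<comment> \<open>The factor is chosen so that the left side is the integrand of the
          push-forward and \<open>bubble (T x)\<close> disappears from the right side.\<close>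
        then have "f x ^ 3 / bubble (T x) * f x \<le> f x ^ 3 / bubble (T x) * (\<kappa> * bubble (T x) * (?s / 4))"
          using f_nonneg[of x] bubble_pos[of "T x"] by (intro mult_left_mono) auto
        also have "f x ^ 3 / bubble (T x) * (\<kappa> * bubble (T x) * (?s / 4)) = \<kappa> / 4 * (f x ^ 3 * ?s)"
          using bubble_nonzero[of "T x"] by simp
        also have "f x ^ 3 / bubble (T x) * f x = 1 / bubble (T x) * F x"
          by (simp add: F_def power_eq_if)
        finally have le: "1 / bubble (T x) * F x \<le> (\<Sum>b\<in>Basis. \<kappa> / 4 * (f x ^ 3 * d b x))"
          by (simp only: sum_distrib_left)
        have "ennreal (1 / bubble (T x)) * ennreal (F x) = ennreal (1 / bubble (T x) * F x)"
          using bubble_pos[of "T x"] f_nonneg[of x] by (subst ennreal_mult') (auto simp: F_def)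
        also have "\<dots> \<le> ennreal (\<Sum>b\<in>Basis. \<kappa> / 4 * (f x ^ 3 * d b x))"
          using le by (rule ennreal_leI)
        also have "\<dots> = (\<Sum>b\<in>Basis. ennreal (\<kappa> / 4) * ennreal (f x ^ 3 * d b x))"
        proof -
          have "(\<Sum>b\<in>Basis. ennreal (\<kappa> / 4) * ennreal (f x ^ 3 * d b x)) = (\<Sum>b\<in>Basis. ennreal (\<kappa> / 4 * (f x ^ 3 * d b x)))"
            using \<kappa> by (intro sum.cong refl ennreal_mult'[symmetric]) auto
          also have "\<dots> = ennreal (\<Sum>b\<in>Basis. \<kappa> / 4 * (f x ^ 3 * d b x))"
            using \<kappa> f_nonneg[of x] d_nonneg by (intro sum_ennreal mult_nonneg_nonneg) auto
          finally show ?thesis ..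
        qed
        finally show "ennreal (1 / bubble (T x)) * ennreal (F x) \<le> (\<Sum>b\<in>Basis. ennreal (\<kappa> / 4) * ennreal (f x ^ 3 * d b x))" .
      qed
      also have "\<dots> = (\<Sum>b\<in>Basis. ennreal (\<kappa> / 4) * ennreal (- (\<integral>x. h b x \<partial>lborel)))"
        using d_meas ibp by (subst nn_integral_sum) (auto simp: nn_integral_cmult intro!: sum.cong)
      also have "\<dots> = ennreal (\<kappa> / 4 * X)"
      proof -
        have "(\<Sum>b\<in>Basis. ennreal (\<kappa> / 4) * ennreal (- (\<integral>x. h b x \<partial>lborel))) =
            (\<Sum>b\<in>Basis. ennreal (\<kappa> / 4 * - (\<integral>x. h b x \<partial>lborel)))"
          using \<kappa> by (intro sum.cong refl ennreal_mult'[symmetric]) auto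
        also have "\<dots> = ennreal (\<Sum>b\<in>Basis. \<kappa> / 4 * - (\<integral>x. h b x \<partial>lborel))"
          using \<kappa> ibp by (intro sum_ennreal mult_nonneg_nonneg) auto
        finally show ?thesis by (simp only: X_def sum_distrib_left)
      qed
      finally show ?thesis
        using \<kappa> X_nonneg by (subst (asm) ennreal_le_iff) auto
    qed
    have N: "integrable lborel (\<lambda>x. (f x ^ 2 * norm (T x)) ^ 2)" "(\<integral>x. (f x ^ 2 * norm (T x)) ^ 2 \<partial>lborel) = \<kappa> ^ 4 * J"
    proof -
      have "(\<integral>\<^sup>+x. ennreal ((f x ^ 2 * norm (T x)) ^ 2) \<partial>lborel) = (\<integral>\<^sup>+x. ennreal (norm (T x) ^ 2) * ennreal (F x) \<partial>lborel)"
        by (intro nn_integral_cong, subst ennreal_mult'[symmetric]) (auto simp: F_def power_mult_distrib mult.commute)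
      also have "\<dots> = (\<integral>\<^sup>+y. ennreal (norm (y::'a) ^ 2) * ennreal (G y) * indicator (cube R) y \<partial>lborel)"
        by (rule push) simp
      also have "\<dots> = (\<integral>\<^sup>+y. ennreal (\<kappa> ^ 4 * (norm (y::'a) ^ 2 * bubble y ^ 4)) * indicator (cube R) y \<partial>lborel)"
        by (intro nn_integral_cong, subst ennreal_mult'[symmetric]) (auto simp: G_def ac_simps)
      also have "\<dots> = ennreal (\<kappa> ^ 4 * J)"
        unfolding J_def using \<kappa> by (intro cube_nn') (auto intro!: continuous_intros continuous_on_bubble)
      finally have eq: "(\<integral>\<^sup>+x. ennreal ((f x ^ 2 * norm (T x)) ^ 2) \<partial>lborel) = ennreal (\<kappa> ^ 4 * J)" .
      then show "integrable lborel (\<lambda>x. (f x ^ 2 * norm (T x)) ^ 2)"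
        by (intro integrableI_nonneg) auto
      show "(\<integral>x. (f x ^ 2 * norm (T x)) ^ 2 \<partial>lborel) = \<kappa> ^ 4 * J"
        using \<kappa> nonneg by (intro integral_eq_nn_integral[THEN trans]) (auto simp: eq)
    qed
    have "X\<^sup>2 \<le> 9 * (A * (\<kappa> ^ 4 * J))"
    proof -
      have cs: "(\<integral>x. \<bar>norm (Df x) * (f x ^ 2 * norm (T x))\<bar> \<partial>lborel)\<^sup>2 \<le> A * (\<kappa> ^ 4 * J)"
        unfolding A_def N(2)[symmetric] by (intro cauchy_schwarz_integral int_Df N) auto
      have i: "integrable lborel (\<lambda>x. norm (Df x) * (f x ^ 2 * norm (T x)))"
        by (intro cauchy_schwarz_integral int_Df N) auto
      have "X = (\<integral>x. (\<Sum>b\<in>Basis. - h b x) \<partial>lborel)"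
        unfolding X_def using h_int by (subst Bochner_Integration.integral_sum) auto
      also have "\<dots> \<le> (\<integral>x. 3 * \<bar>norm (Df x) * (f x ^ 2 * norm (T x))\<bar> \<partial>lborel)"
      proof (rule integral_mono)
        fix x
        have "(\<Sum>b\<in>Basis. - h b x) = - (3 * f x ^ 2 * (Df x \<bullet> T x))"
          unfolding h_def by (subst euclidean_inner[of "Df x"]) (simp add: sum_negf sum_distrib_left mult.assoc)
        also have "\<dots> \<le> 3 * f x ^ 2 * \<bar>Df x \<bullet> T x\<bar>"
          using mult_left_mono[of "- (Df x \<bullet> T x)" "\<bar>Df x \<bullet> T x\<bar>" "3 * f x ^ 2"] by simp
        also have "\<dots> \<le> 3 * f x ^ 2 * (norm (Df x) * norm (T x))"
          by (intro mult_left_mono Cauchy_Schwarz_ineq2) auto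
        finally show "(\<Sum>b\<in>Basis. - h b x) \<le> 3 * \<bar>norm (Df x) * (f x ^ 2 * norm (T x))\<bar>"
          by (simp add: ac_simps)
      qed (use h_int i in auto)
      also have "\<dots> = 3 * (\<integral>x. \<bar>norm (Df x) * (f x ^ 2 * norm (T x))\<bar> \<partial>lborel)" by simp
      finally have "X\<^sup>2 \<le> (3 * (\<integral>x. \<bar>norm (Df x) * (f x ^ 2 * norm (T x))\<bar> \<partial>lborel))\<^sup>2"
        using X_nonneg by (intro power_mono) auto
      also have "\<dots> \<le> 9 * (A * (\<kappa> ^ 4 * J))"
        using cs by (simp add: power_mult_distrib)
      finally show ?thesis .
    qed
    then have "(X\<^sup>2)\<^sup>2 \<le> (9 * (A * (\<kappa> ^ 4 * J)))\<^sup>2"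
      by (intro power_mono) auto
    then have X4: "X ^ 4 \<le> 81 * A\<^sup>2 * (\<kappa> ^ 4)\<^sup>2 * J\<^sup>2"
      by (simp add: power_mult_distrib power_mult[symmetric] ac_simps)
    have "(\<kappa> ^ 4 * J3) ^ 4 \<le> (\<kappa> / 4 * X) ^ 4"
      using J3_le nonneg \<kappa> by (intro power_mono) auto
    \<comment> \<open>The right side will carry \<open>(\<kappa>^4)^3\<close>. After cancellation
      one factor \<open>\<kappa>^4 = B / I\<close> is left, and this is how the integral of
      \<open>f^4\<close> enters the estimate.\<close>
    then have "(\<kappa> ^ 4)^3 * (\<kappa> ^ 4 * J3 ^ 4) \<le> \<kappa> ^ 4 / 256 * X ^ 4"
      by (simp add: power_mult_distrib power_divide power_mult[symmetric] power_add[symmetric] mult.assoc[symmetric])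
    also have "\<dots> \<le> \<kappa> ^ 4 / 256 * (81 * A\<^sup>2 * (\<kappa> ^ 4)\<^sup>2 * J\<^sup>2)"
      using X4 \<kappa> by (intro mult_left_mono) auto
    also have "\<dots> = (\<kappa> ^ 4) ^ 3 * (81 / 256 * A\<^sup>2 * J\<^sup>2)"
      by (simp add: power_eq_if[of _ 3] power2_eq_square[of "\<kappa> ^ 4"])
    finally have "\<kappa> ^ 4 * J3 ^ 4 \<le> 81 / 256 * A\<^sup>2 * J\<^sup>2"
      using \<kappa> by (subst (asm) mult_le_cancel_left_pos) auto
    then have "I * (\<kappa> ^ 4 * J3 ^ 4) \<le> I * (81 / 256 * A\<^sup>2 * J\<^sup>2)"
      using I_pos by (intro mult_left_mono) auto
    then show ?thesis using I_pos by (simp add: \<kappa>4)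
  qed
  then show ?thesis unfolding A_def B_def I_def J_def J3_def .
qed

section \<open>Transfer to \<open>\<real>\<^sup>4\<close>\<close>

text \<open>Coordinate boxes go to coordinate boxes with the same side lengths, and Lebesgue measure
  is determined by its values on boxes.\<close>

lemma lborel_isometry:
  fixes L :: "'a::euclidean_space \<Rightarrow> 'b::euclidean_space"
  assumes L: "linear L" and iso: "\<And>x y. L x \<bullet> L y = x \<bullet> y" and B: "L ` Basis = Basis" and L': "\<And>y. L (L' y) = y"
  shows "distr lborel borel L = lborel"
proof (rule lborel_eqI[symmetric])
  have [measurable]: "L \<in> borel_measurable borel"
    by (intro borel_measurable_continuous_onI linear_continuous_on linear_conv_bounded_linear[THEN iffD1] L)
  have inj: "inj_on L Basis"
    using linear_injective_0[OF L] iso by (metis inj_on_subset inner_eq_zero_iff inner_zero_left top_greatest)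
  fix l u :: 'b assume lu: "\<And>b. b \<in> Basis \<Longrightarrow> l \<bullet> b \<le> u \<bullet> b"
  have inner: "y \<bullet> L b = L' y \<bullet> b" for y b using iso[of "L' y" b] by (simp add: L')
  have inner2: "L' (L x) \<bullet> b = x \<bullet> b" for x b using inner[of "L x" b] iso by simp
  have vim: "L -` box l u = box (L' l) (L' u)"
    unfolding box_def B[symmetric] by (auto simp: inner inner2)
  have "emeasure (distr lborel borel L) (box l u) = emeasure lborel (box (L' l) (L' u))"
    by (subst emeasure_distr) (auto simp: vim)
  also have "\<dots> = (\<Prod>b\<in>Basis. (L' u - L' l) \<bullet> b)"
  proof (rule emeasure_lborel_box)
    fix b :: 'a assume "b \<in> Basis"
    then show "L' l \<bullet> b \<le> L' u \<bullet> b" using lu[of "L b"] B by (auto simp: inner)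
  qed
  also have "(\<Prod>b\<in>Basis. (L' u - L' l) \<bullet> b) = (\<Prod>b\<in>Basis. (u - l) \<bullet> b)"
    unfolding B[symmetric] by (subst prod.reindex[OF inj]) (simp add: inner[symmetric] inner_diff_left)
  finally show "emeasure (distr lborel borel L) (box l u) = (\<Prod>b\<in>Basis. (u - l) \<bullet> b)" .
qed simp

text \<open>The induction produces a nested product of real lines. Cubes, diagonal entries and
  Lebesgue measure are all expressed by the standard basis, so an isometry that matches the bases
  carries the whole construction over.\<close>

lemma knothe_isometry:
  fixes L :: "'a::euclidean_space \<Rightarrow> 'b::euclidean_space"
  assumes L: "linear L" and iso: "\<And>x y. L x \<bullet> L y = x \<bullet> y" and B: "L ` Basis = Basis"
    and L': "\<And>y. L (L' y) = y" "\<And>x. L' (L x) = x" and L'_lin: "linear L'"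
    and knothe: "knothe TYPE('a)"
  shows "knothe TYPE('b)"
  unfolding knothe_def
proof (intro allI impI)
  fix R :: real and F G :: "'b \<Rightarrow> real"
  assume R: "R > 0" and F: "source F" and G: "target G"
    and mass: "(\<integral>\<^sup>+x. F x \<partial>lborel) = (\<integral>\<^sup>+y. ennreal (G y) * indicator (cube R) y \<partial>lborel)"
  have L_cont: "continuous_on S L" for S
    by (intro linear_continuous_on linear_conv_bounded_linear[THEN iffD1] L)
  have L'_cont: "continuous_on S L'" for S
    by (intro linear_continuous_on linear_conv_bounded_linear[THEN iffD1] L'_lin)
  have [measurable]: "L \<in> borel_measurable borel" "L' \<in> borel_measurable borel"
    using L_cont L'_cont by (auto intro: borel_measurable_continuous_onI)
  have inner: "y \<bullet> L b = L' y \<bullet> b" for y b using iso[of "L' y" b] by (simp add: L')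
  have inj: "inj_on L Basis" using L'(2) by (rule inj_on_inverseI)
  have FG_cont: "continuous_on UNIV F" "continuous_on UNIV G"
    using F G by (auto simp: source_def target_def)
  then have [measurable]: "F \<in> borel_measurable borel" "G \<in> borel_measurable borel"
    by (auto intro: borel_measurable_continuous_onI)
  have nn: "(\<integral>\<^sup>+y. f y \<partial>lborel) = (\<integral>\<^sup>+x. f (L x) \<partial>lborel)" if "f \<in> borel_measurable borel" for f
  proof -
    have "(\<integral>\<^sup>+y. f y \<partial>lborel) = (\<integral>\<^sup>+y. f y \<partial>distr lborel borel L)"
      by (simp add: lborel_isometry[OF L iso B L'(1)])
    then show ?thesis using that by (simp add: nn_integral_distr)
  qed
  have cube: "L x \<in> cube R \<longleftrightarrow> x \<in> cube R" for x
    unfolding cube_def B[symmetric] by (auto simp: iso)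
  have FG_L: "continuous_on UNIV (\<lambda>x. F (L x))" "continuous_on UNIV (\<lambda>x. G (L x))"
    by (auto intro!: continuous_on_compose2[OF FG_cont(1)] continuous_on_compose2[OF FG_cont(2)] L_cont)
  have "source (\<lambda>x. F (L x))"
  proof -
    obtain M where M: "M > 0" "\<And>x b. b \<in> Basis \<Longrightarrow> M \<le> \<bar>x \<bullet> b\<bar> \<Longrightarrow> F x = 0"
      using F unfolding source_def by blast
    have "F (L x) = 0" if "b \<in> Basis" "M \<le> \<bar>x \<bullet> b\<bar>" for x b
      using that M(2)[of "L b" "L x"] B by (auto simp: iso)
    then show ?thesis using F M(1) FG_L unfolding source_def by blast
  qed
  moreover have "target (\<lambda>x. G (L x))"
    using G FG_L by (auto simp: target_def)
  moreover have "(\<integral>\<^sup>+x. F (L x) \<partial>lborel) = (\<integral>\<^sup>+y. ennreal (G (L y)) * indicator (cube R) y \<partial>lborel)"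
  proof -
    have "(\<integral>\<^sup>+y. ennreal (G y) * indicator (cube R) y \<partial>lborel) = (\<integral>\<^sup>+y. ennreal (G (L y)) * indicator (cube R) y \<partial>lborel)"
      by (subst nn) (auto simp: cube indicator_def)
    moreover have "(\<integral>\<^sup>+x. F x \<partial>lborel) = (\<integral>\<^sup>+x. F (L x) \<partial>lborel)"
      by (subst nn) auto
    ultimately show ?thesis using mass by simp
  qed
  ultimately obtain T d where Td: "transports R (\<lambda>x. F (L x)) (\<lambda>x. G (L x)) T d"
    using knothe R unfolding knothe_def by blast
  note t = Td[unfolded transports_def]
  from t have [measurable]: "T \<in> borel_measurable borel" by blast
  have push: "\<And>h. h \<in> borel_measurable borel \<Longrightarrow> (\<integral>\<^sup>+x. h (T x) * ennreal (F (L x)) \<partial>lborel) =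
      (\<integral>\<^sup>+y. h y * ennreal (G (L y)) * indicator (cube R) y \<partial>lborel)"
    using t by blast
  have L'B: "L' b \<in> Basis" if "b \<in> Basis" for b
    using that B L'(2) by (metis imageE)
  have lin: "L' (y + s *\<^sub>R b) = L' y + s *\<^sub>R L' b" for y s b
    by (simp add: linear_add[OF L'_lin] linear_scale[OF L'_lin])
  have inner': "L x \<bullet> b = x \<bullet> L' b" for x b using iso[of x "L' b"] by (simp add: L')
  have "transports R F G (\<lambda>y. L (T (L' y))) (\<lambda>b y. d (L' b) (L' y))"
    unfolding transports_def
  proof (intro conjI allI ballI)
    show "(\<lambda>y. L (T (L' y))) \<in> borel_measurable borel" by measurable
  next
    fix b :: 'b assume b: "b \<in> Basis"
    have [measurable]: "d (L' b) \<in> borel_measurable borel" using t L'B[OF b] by blast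
    show "(\<lambda>y. d (L' b) (L' y)) \<in> borel_measurable borel" by measurable
    fix y
    from t L'B[OF b] have "\<bar>T (L' y) \<bullet> L' b\<bar> \<le> R \<and> 0 \<le> d (L' b) (L' y) \<and>
        ((\<lambda>s. T (L' y + s *\<^sub>R L' b) \<bullet> L' b) has_real_derivative d (L' b) (L' y)) (at 0)" by blast
    then show "\<bar>L (T (L' y)) \<bullet> b\<bar> \<le> R" "0 \<le> d (L' b) (L' y)"
      "((\<lambda>s. L (T (L' (y + s *\<^sub>R b))) \<bullet> b) has_real_derivative d (L' b) (L' y)) (at 0)"
      by (simp_all add: inner' lin)
  next
    fix y
    have "F (L (L' y)) = G (L (T (L' y))) * (\<Prod>b\<in>Basis. d b (L' y))" using t by blast
    then show "F y = G (L (T (L' y))) * (\<Prod>b\<in>Basis. d (L' b) (L' y))"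
      unfolding B[symmetric] by (subst prod.reindex[OF inj]) (simp add: L')
  next
    fix h :: "'b \<Rightarrow> ennreal" assume [measurable]: "h \<in> borel_measurable borel"
    have "(\<integral>\<^sup>+y. h (L (T (L' y))) * ennreal (F y) \<partial>lborel) = (\<integral>\<^sup>+x. h (L (T x)) * ennreal (F (L x)) \<partial>lborel)"
      by (subst nn) (auto simp: L')
    also have "\<dots> = (\<integral>\<^sup>+y. h (L y) * ennreal (G (L y)) * indicator (cube R) y \<partial>lborel)"
      by (rule push) measurable
    also have "\<dots> = (\<integral>\<^sup>+y. h y * ennreal (G y) * indicator (cube R) y \<partial>lborel)"
      by (subst nn[of "\<lambda>y. h y * ennreal (G y) * indicator (cube R) y"]) (auto simp: cube indicator_def)
    finally show "(\<integral>\<^sup>+y. h (L (T (L' y))) * ennreal (F y) \<partial>lborel) =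
        (\<integral>\<^sup>+y. h y * ennreal (G y) * indicator (cube R) y \<partial>lborel)" .
  qed
  then show "\<exists>T d. transports R F G T d" by blast
qed

lemma knothe_R4: "knothe TYPE(real^4)"
proof -
  define L :: "((real \<times> real) \<times> real) \<times> real \<Rightarrow> real^4" where
    "L p = (\<chi> i. if i = 1 then fst (fst (fst p)) else if i = 2 then snd (fst (fst p))
              else if i = 3 then snd (fst p) else snd p)" for p
  define L' :: "real^4 \<Rightarrow> ((real \<times> real) \<times> real) \<times> real" where
    "L' y = (((y $ 1, y $ 2), y $ 3), y $ 4)" for y
  have exh: "i = 1 \<or> i = 2 \<or> i = 3 \<or> i = 4" for i :: 4
    using UNIV_4 by auto
  show ?thesis
  proof (rule knothe_isometry[where L = L and L' = L'])
    show "linear L"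
      by (rule linearI) (auto simp: L_def vec_eq_iff)
    show "linear L'"
      by (rule linearI) (auto simp: L'_def)
    show "L x \<bullet> L y = x \<bullet> y" for x y
      by (cases x, cases y) (auto simp: L_def inner_vec_def sum_4 inner_prod_def)
    show "L (L' y) = y" for y
      using exh by (auto simp: L_def L'_def vec_eq_iff)
    show "L' (L x) = x" for x
      by (cases x) (auto simp: L_def L'_def)
    have "Basis = {axis 1 1, axis 2 1, axis 3 1, axis 4 (1::real) :: real^4}"
      using exh by (auto simp: Basis_vec_def axis_eq_axis) (metis)
    moreover have "L (((1,0),0),0) = axis 1 1" "L (((0,1),0),0) = axis 2 1" "L (((0,0),1),0) = axis 3 1" "L (((0,0),0),1) = axis 4 1"
      using exh by (auto simp: L_def axis_def vec_eq_iff)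
    ultimately show "L ` Basis = Basis"
      by (auto simp: Basis_prod_def zero_prod_def)
    show "knothe TYPE(((real \<times> real) \<times> real) \<times> real)" by (rule knothe_dim4)
  qed
qed

section \<open>Integrals of the bubble\<close>

text \<open>The exponent is what each coordinate receives when \<open>bubble^(5/2)\<close> is
  distributed over four coordinates: decay of order -2 to the power 5/8.\<close>

lemma nn_integral_inverse_power_finite:
  "(\<integral>\<^sup>+t. ennreal ((1 + \<bar>t\<bar>) powr (-5/4)) \<partial>lborel) < \<infinity>"
proof -
  have half: "(\<integral>\<^sup>+t. ennreal ((1 + \<bar>t\<bar>) powr (-5/4)) * indicator {0..} t \<partial>lborel) = ennreal 4"
  proof -
    have "(\<integral>\<^sup>+t. ennreal ((1 + \<bar>t\<bar>) powr (-5/4)) * indicator {0..} t \<partial>lborel) = ennreal (0 - (-4) * (1 + 0) powr (-1/4))"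
    proof (rule nn_integral_FTC_atLeast)
      show "((\<lambda>t. -4 * (1 + t) powr (-1/4)) has_real_derivative (1 + \<bar>t\<bar>) powr (-5/4)) (at t)" if "0 \<le> t" for t
        using that by (auto intro!: derivative_eq_intros)
      have "((\<lambda>t::real. (1 + t) powr (-1/4)) \<longlongrightarrow> 0) at_top"
        by (rule tendsto_neg_powr[OF _ filterlim_tendsto_add_at_top[OF tendsto_const filterlim_ident]]) simp
      from tendsto_mult[OF tendsto_const[of "-4"] this]
      show "((\<lambda>t::real. -4 * (1 + t) powr (-1/4)) \<longlongrightarrow> 0) at_top" by simp
    qed auto
    then show ?thesis by simp
  qed
  have "(\<integral>\<^sup>+t. ennreal ((1 + \<bar>t\<bar>) powr (-5/4)) \<partial>lborel) \<le>
     (\<integral>\<^sup>+t. ennreal ((1 + \<bar>t\<bar>) powr (-5/4)) * indicator {0..} t + ennreal ((1 + \<bar>- t\<bar>) powr (-5/4)) * indicator {0..} (- t) \<partial>lborel)"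
    by (intro nn_integral_mono) (auto simp: indicator_def)
  also have "\<dots> = (\<integral>\<^sup>+t. ennreal ((1 + \<bar>t\<bar>) powr (-5/4)) * indicator {0..} t \<partial>lborel)
      + (\<integral>\<^sup>+t. ennreal ((1 + \<bar>- t\<bar>) powr (-5/4)) * indicator {0..} (- t) \<partial>lborel)"
    by (rule nn_integral_add) auto
  also have "(\<integral>\<^sup>+t. ennreal ((1 + \<bar>- t\<bar>) powr (-5/4)) * indicator {0..} (- t) \<partial>lborel) =
     (\<integral>\<^sup>+t. ennreal ((1 + \<bar>t\<bar>) powr (-5/4)) * indicator {0..} t \<partial>lborel)"
    by (subst nn_integral_real_affine[of "\<lambda>t. ennreal ((1 + \<bar>t\<bar>) powr (-5/4)) * indicator {0..} t" "-1" 0]) auto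
  finally show ?thesis unfolding half
    by (rule le_less_trans) (simp add: ennreal_plus[symmetric] del: ennreal_plus)
qed

text \<open>Replaces radial decay by decay in a single coordinate; a product of such bounds is
  integrated coordinate by coordinate, without polar coordinates.\<close>

lemma bubble_le: "b \<in> Basis \<Longrightarrow> bubble x \<le> 16 * (1 + \<bar>x \<bullet> b\<bar>) powr -2"
proof -
  assume b: "b \<in> Basis"
  have "(1 + \<bar>x \<bullet> b\<bar>)\<^sup>2 \<le> 2 + 2 * \<bar>x \<bullet> b\<bar>\<^sup>2"
    using sum_squares_bound[of 1 "\<bar>x \<bullet> b\<bar>"] by (simp add: power2_eq_square algebra_simps)
  also have "\<bar>x \<bullet> b\<bar>\<^sup>2 \<le> (norm x)\<^sup>2"
    using b by (intro power_mono Basis_le_norm) auto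
  finally have "(1 + \<bar>x \<bullet> b\<bar>)\<^sup>2 / 16 \<le> 1 + (norm x)\<^sup>2 / 8" by simp
  moreover have "0 < (1 + \<bar>x \<bullet> b\<bar>)\<^sup>2 / 16" by (intro divide_pos_pos zero_less_power add_pos_nonneg) auto
  ultimately have "bubble x \<le> inverse ((1 + \<bar>x \<bullet> b\<bar>)\<^sup>2 / 16)"
    unfolding bubble_def by (rule le_imp_inverse_le)
  also have "(1 + \<bar>x \<bullet> b\<bar>)\<^sup>2 = (1 + \<bar>x \<bullet> b\<bar>) powr 2"
    by (subst powr_realpow[symmetric]) auto
  finally show ?thesis
    by (simp add: powr_minus divide_simps)
qed

lemma bubble_le_1: "bubble x \<le> 1"
  unfolding bubble_def by (rule inverse_le_1_iff[THEN iffD2]) simp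

lemma norm_sq_bubble: "norm x ^ 2 * bubble x = 8 * (1 - bubble x)"
proof -
  have "1 + norm x ^ 2 / 8 \<noteq> 0" using bubble_nonzero[of x] unfolding bubble_def by auto
  then show ?thesis unfolding bubble_def by (simp add: field_simps)
qed

lemma norm_sq_bubble_power4: "norm x ^ 2 * bubble x ^ 4 = 8 * (bubble x ^ 3 - bubble x ^ 4)"
proof -
  have "norm x ^ 2 * bubble x ^ 4 = (norm x ^ 2 * bubble x) * bubble x ^ 3"
    by (simp add: power4_eq_xxxx power3_eq_cube)
  also have "\<dots> = 8 * (bubble x ^ 3 - bubble x ^ 4)"
    unfolding norm_sq_bubble by (simp add: power4_eq_xxxx power3_eq_cube algebra_simps)
  finally show ?thesis .
qed

lemma norm_sq_bubble_le: "norm x ^ 2 * bubble x \<le> 8"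
  unfolding norm_sq_bubble using bubble_pos[of x] by simp

lemma norm_add_squared: "norm (x + y) ^ 2 = norm x ^ 2 + 2 * (x \<bullet> y) + norm (y::'b::real_inner) ^ 2"
  by (simp add: power2_norm_eq_inner inner_add inner_commute)

context
  assumes dim: "DIM('a::euclidean_space) = 4"
begin

text \<open>Powers of the bubble are integrable in dimension four beyond exponent 2. The value 5/2
  lies below the exponent 3 needed for the integrals, and the gap of 1/2 pays for a factor of linear
  growth.\<close>

lemma integrable_bubble_powr: "integrable lborel (\<lambda>x::'a. bubble x powr (5/2))"
proof (rule integrableI_bounded)
  define c :: real where "c = 16 powr (5/8)"
  have "bubble x powr (5/2) \<le> (\<Prod>b\<in>Basis. c * (1 + \<bar>x \<bullet> b\<bar>) powr (-5/4))" for x :: 'a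
  proof -
    have "bubble x powr (5/2) = (\<Prod>b\<in>(Basis::'a set). bubble x powr (5/8))"
      using bubble_pos[of x] by (simp add: dim powr_powr powr_realpow[symmetric])
    also have "\<dots> \<le> (\<Prod>b\<in>Basis. c * (1 + \<bar>x \<bullet> b\<bar>) powr (-5/4))"
    proof (rule prod_mono, safe)
      fix b :: 'a assume "b \<in> Basis"
      then have "bubble x powr (5/8) \<le> (16 * (1 + \<bar>x \<bullet> b\<bar>) powr -2) powr (5/8)"
        by (intro powr_mono2 bubble_le bubble_nonneg) auto
      also have "\<dots> = c * (1 + \<bar>x \<bullet> b\<bar>) powr (-5/4)"
        by (simp add: c_def powr_mult powr_powr)
      finally show "bubble x powr (5/8) \<le> c * (1 + \<bar>x \<bullet> b\<bar>) powr (-5/4)" .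
    qed simp
    finally show ?thesis .
  qed
  then have "(\<integral>\<^sup>+x. ennreal (norm (bubble (x::'a) powr (5/2))) \<partial>lborel) \<le>
      (\<integral>\<^sup>+x. (\<Prod>b\<in>Basis. ennreal (c * (1 + \<bar>(x::'a) \<bullet> b\<bar>) powr (-5/4))) \<partial>lborel)"
    by (intro nn_integral_mono) (auto simp: prod_ennreal c_def intro!: ennreal_leI)
  also have "\<dots> = (\<Prod>b\<in>(Basis::'a set). (\<integral>\<^sup>+t. ennreal (c * (1 + \<bar>t\<bar>) powr (-5/4)) \<partial>lborel))"
    by (rule nn_integral_lborel_prod) auto
  also have "\<dots> < \<infinity>"
    using nn_integral_inverse_power_finite
    by (simp add: c_def ennreal_mult nn_integral_cmult power_less_top_ennreal ennreal_mult_less_top)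
  finally show "(\<integral>\<^sup>+x. ennreal (norm (bubble (x::'a) powr (5/2))) \<partial>lborel) < \<infinity>" .
qed measurable

lemma integrable_bubble_power: "n \<ge> 3 \<Longrightarrow> integrable lborel (\<lambda>x::'a. bubble x ^ n)"
proof (rule Bochner_Integration.integrable_bound[OF integrable_bubble_powr])
  assume n: "n \<ge> 3"
  have "bubble x ^ n \<le> bubble x powr (5/2)" for x :: 'a
  proof -
    have "bubble x ^ n = bubble x powr real n" using bubble_pos[of x] by (simp add: powr_realpow)
    also have "\<dots> \<le> bubble x powr (5/2)"
      using n bubble_le_1 by (intro powr_mono') (auto simp: bubble_nonneg)
    finally show ?thesis .
  qed
  then show "AE x in lborel. norm (bubble (x::'a) ^ n) \<le> norm (bubble x powr (5/2))"
    by (auto simp: bubble_nonneg)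
qed measurable

lemma integrable_norm_sq_bubble: "integrable lborel (\<lambda>x::'a. norm x ^ 2 * bubble x ^ 4)"
proof -
  have "norm x ^ 2 * bubble x ^ 4 = 8 * (bubble x ^ 3 - bubble x ^ 4)" for x :: 'a
    by (rule norm_sq_bubble_power4)
  then show ?thesis using integrable_bubble_power[of 3] integrable_bubble_power[of 4] by simp
qed

text \<open>The factor \<open>bubble^(1/2)\<close> compensates the linear growth, since
  \<open>norm x ^ 2 * bubble x\<close> is bounded by 8; what remains is the integrable power
  5/2.\<close>

lemma integrable_inner_bubble:
  assumes b: "b \<in> Basis" shows "integrable lborel (\<lambda>x::'a. (x \<bullet> b) * bubble x ^ 3)"
proof (rule Bochner_Integration.integrable_bound)
  show "integrable lborel (\<lambda>x::'a. sqrt 8 * bubble x powr (5/2))"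
    using integrable_bubble_powr by simp
  have "\<bar>x \<bullet> b\<bar> * bubble x ^ 3 \<le> sqrt 8 * bubble x powr (5/2)" for x :: 'a
  proof -
    have "norm x * bubble x powr (1/2) = sqrt (norm x ^ 2 * bubble x)"
      using bubble_nonneg[of x] by (simp add: real_sqrt_mult powr_half_sqrt)
    also have "\<dots> \<le> sqrt 8" using norm_sq_bubble_le by (rule real_sqrt_le_mono)
    finally have le: "norm x * bubble x powr (1/2) \<le> sqrt 8" .
    have "bubble x ^ 3 = bubble x powr (1/2) * bubble x powr (5/2)"
    proof -
      have "bubble x powr (1/2) * bubble x powr (5/2) = bubble x powr 3"
        by (simp flip: powr_add)
      then show ?thesis using bubble_pos[of x] by simp
    qed
    then have "\<bar>x \<bullet> b\<bar> * bubble x ^ 3 = (\<bar>x \<bullet> b\<bar> * bubble x powr (1/2)) * bubble x powr (5/2)" by simp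
    also have "\<dots> \<le> (norm x * bubble x powr (1/2)) * bubble x powr (5/2)"
      using b by (intro mult_right_mono Basis_le_norm) auto
    also have "\<dots> \<le> sqrt 8 * bubble x powr (5/2)"
      using le by (intro mult_right_mono) auto
    finally show ?thesis .
  qed
  then show "AE x in lborel. norm ((x \<bullet> b) * bubble (x::'a) ^ 3) \<le> norm (sqrt 8 * bubble x powr (5/2))"
    by (auto simp: abs_mult bubble_nonneg)
qed measurable

lemma bubble_directional_derivative:
  fixes x :: 'a
  assumes b: "b \<in> Basis"
  shows "((\<lambda>t. bubble (x + t *\<^sub>R b)) has_real_derivative - (x \<bullet> b) / 4 * bubble x ^ 2) (at 0)"
proof -
  have norm_add: "norm (x + t *\<^sub>R b) ^ 2 = norm x ^ 2 + 2 * t * (x \<bullet> b) + t ^ 2" for t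
    using b power2_norm_eq_inner[of b]
    by (simp add: norm_add_squared power_mult_distrib)
  have nz: "1 + (norm x ^ 2 + 2 * 0 * (x \<bullet> b) + 0 ^ 2) / 8 \<noteq> 0"
    using bubble_nonzero[of x] unfolding bubble_def by auto
  have "((\<lambda>t. 1 + (norm x ^ 2 + 2 * t * (x \<bullet> b) + t ^ 2) / 8) has_real_derivative (x \<bullet> b) / 4) (at 0)"
    by (auto intro!: derivative_eq_intros)
  from DERIV_inverse_fun[OF this nz]
  have "((\<lambda>t. bubble (x + t *\<^sub>R b)) has_real_derivative
      - ((x \<bullet> b) / 4 * inverse ((1 + (norm x ^ 2 + 2 * 0 * (x \<bullet> b) + 0 ^ 2) / 8) ^ Suc (Suc 0)))) (at 0)"
    unfolding bubble_def norm_add .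
  then show ?thesis
    by (rule DERIV_cong) (simp add: bubble_def power2_eq_square)
qed

text \<open>Divergence theorem for the field \<open>(x . b) bubble^3 b\<close>, whose divergence is
  \<open>bubble^3 - 3/4 (x . b)^2 bubble^4\<close>. Both terms are integrable on the whole space, so
  no boundary term arises.\<close>

lemma integral_bubble_divergence:
  assumes b: "b \<in> Basis"
  shows "integrable lborel (\<lambda>x::'a. (x \<bullet> b)\<^sup>2 * bubble x ^ 4)"
    and "(\<integral>x. bubble (x::'a) ^ 3 \<partial>lborel) = 3/4 * (\<integral>x. (x \<bullet> b)\<^sup>2 * bubble (x::'a) ^ 4 \<partial>lborel)"
proof -
  show int: "integrable lborel (\<lambda>x::'a. (x \<bullet> b)\<^sup>2 * bubble x ^ 4)"
  proof (rule Bochner_Integration.integrable_bound[OF integrable_norm_sq_bubble])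
    have "(x \<bullet> b)\<^sup>2 \<le> (norm x)\<^sup>2" for x
      using b Basis_le_norm[of b x] by (simp add: abs_le_square_iff[symmetric])
    then show "AE x in lborel. norm ((x \<bullet> b)\<^sup>2 * bubble (x::'a) ^ 4) \<le> norm ((norm x)\<^sup>2 * bubble x ^ 4)"
      by (auto intro!: mult_right_mono)
  qed measurable
  have "(\<integral>x. bubble (x::'a) ^ 3 - 3/4 * ((x \<bullet> b)\<^sup>2 * bubble x ^ 4) \<partial>lborel) = 0"
  proof (rule integral_directional_derivative)
    show "integrable lborel (\<lambda>x::'a. (x \<bullet> b) * bubble x ^ 3)"
      by (rule integrable_inner_bubble[OF b])
    show "continuous_on UNIV (\<lambda>x::'a. bubble x ^ 3 - 3/4 * ((x \<bullet> b)\<^sup>2 * bubble x ^ 4))"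
      by (intro continuous_intros continuous_on_bubble)
    fix x :: 'a
    have "((\<lambda>t. (x + t *\<^sub>R b) \<bullet> b) has_real_derivative 1) (at 0)"
      unfolding inner_add_left inner_scaleR_left using b by (auto intro!: derivative_eq_intros)
    from DERIV_mult[OF this DERIV_power[OF bubble_directional_derivative[OF b], where n = 3]]
    have "((\<lambda>t. ((x + t *\<^sub>R b) \<bullet> b) * bubble (x + t *\<^sub>R b) ^ 3) has_real_derivative
        bubble x ^ 3 - 3/4 * ((x \<bullet> b)\<^sup>2 * bubble x ^ 4)) (at 0)"
      by (rule DERIV_cong) (simp add: power2_eq_square power4_eq_xxxx power3_eq_cube)
    then show "((\<lambda>t. ((x + t *\<^sub>R b) \<bullet> b) * bubble (x + t *\<^sub>R b) ^ 3) has_vector_derivative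
        bubble x ^ 3 - 3/4 * ((x \<bullet> b)\<^sup>2 * bubble x ^ 4)) (at 0)"
      by (simp add: has_real_derivative_iff_has_vector_derivative)
  qed (use int integrable_bubble_power[of 3] in simp)
  then show "(\<integral>x. bubble (x::'a) ^ 3 \<partial>lborel) = 3/4 * (\<integral>x. (x \<bullet> b)\<^sup>2 * bubble (x::'a) ^ 4 \<partial>lborel)"
    using int integrable_bubble_power[of 3] by simp
qed

text \<open>Two linear relations fix the ratios without evaluating any integral: summing the
  divergence identity over the four coordinates gives \<open>J = 16/3 J3\<close>, and
  \<open>|x|^2 bubble = 8 (1 - bubble)\<close> gives \<open>J = 8 (J3 - S)\<close>.\<close>

lemma bubble_integrals:
  defines "S \<equiv> (\<integral>x. bubble (x::'a) ^ 4 \<partial>lborel)"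
  shows "(\<integral>x. bubble (x::'a) ^ 3 \<partial>lborel) = 3 * S"
    and "(\<integral>x. norm (x::'a) ^ 2 * bubble x ^ 4 \<partial>lborel) = 16 * S"
    and "S > 0"
proof -
  define J3 where "J3 = (\<integral>x. bubble (x::'a) ^ 3 \<partial>lborel)"
  define J where "J = (\<integral>x. norm (x::'a) ^ 2 * bubble x ^ 4 \<partial>lborel)"
  have "J = (\<integral>x. (\<Sum>b\<in>Basis. (x \<bullet> b)\<^sup>2 * bubble (x::'a) ^ 4) \<partial>lborel)"
    unfolding J_def power2_norm_eq_inner
    by (subst euclidean_inner) (simp add: sum_distrib_right power2_eq_square)
  also have "\<dots> = (\<Sum>b\<in>Basis. (\<integral>x. (x \<bullet> b)\<^sup>2 * bubble (x::'a) ^ 4 \<partial>lborel))"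
    by (rule Bochner_Integration.integral_sum) (rule integral_bubble_divergence)
  also have "\<dots> = (\<Sum>b\<in>(Basis::'a set). 4/3 * J3)"
    by (intro sum.cong refl) (simp add: J3_def integral_bubble_divergence(2))
  finally have J: "J = 16/3 * J3" by (simp add: dim)
  have "norm x ^ 2 * bubble x ^ 4 = 8 * (bubble x ^ 3 - bubble x ^ 4)" for x :: 'a
    by (rule norm_sq_bubble_power4)
  then have "J = 8 * (J3 - S)"
    unfolding J_def J3_def S_def using integrable_bubble_power[of 3] integrable_bubble_power[of 4] by simp
  with J have "J3 = 3 * S" by simp
  with J have "J = 16 * S" by simp
  note \<open>J3 = 3 * S\<close> this
  then show "(\<integral>x. bubble (x::'a) ^ 3 \<partial>lborel) = 3 * S"
    "(\<integral>x. norm (x::'a) ^ 2 * bubble x ^ 4 \<partial>lborel) = 16 * S"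
    by (simp_all add: J3_def J_def)
  have "S \<noteq> 0"
  proof
    assume "S = 0"
    then have "AE x in lborel. bubble (x::'a) ^ 4 = 0"
      unfolding S_def using integrable_bubble_power[of 4]
      by (subst (asm) integral_nonneg_eq_0_iff_AE) auto
    then have "AE x in (lborel :: 'a measure). False"
      by eventually_elim (simp add: bubble_nonzero)
    then show False by (simp add: AE_iff_measurable[OF _ refl] emeasure_lborel_UNIV)
  qed
  moreover have "S \<ge> 0" unfolding S_def by (intro integral_nonneg_AE) auto
  ultimately show "S > 0" by simp
qed

text \<open>The cube is exhausted to the whole space. With the values 3 S and 16 S of the bubble
  integrals, both sides of the limit inequality carry the factor \<open>81 S^3\<close>, and its
  cancellation leaves the sharp constant.\<close>

lemma sobolev_C1:
  fixes f :: "'a \<Rightarrow> real" and Df :: "'a \<Rightarrow> 'a"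
  assumes knothe: "knothe TYPE('a)"
    and f_cont: "continuous_on UNIV f" and Df_cont: "continuous_on UNIV Df" and f_nonneg: "\<And>x. 0 \<le> f x"
    and supp: "\<And>x. x \<notin> cube M \<Longrightarrow> f x = 0 \<and> Df x = 0"
    and deriv: "\<And>x b. b \<in> Basis \<Longrightarrow> ((\<lambda>t. f (x + t *\<^sub>R b)) has_real_derivative Df x \<bullet> b) (at 0)"
  shows "(\<integral>x. f x ^ 4 \<partial>lborel) * (\<integral>x. bubble (x::'a) ^ 4 \<partial>lborel) \<le> (\<integral>x. norm (Df x) ^ 2 \<partial>lborel)\<^sup>2"
proof -
  define S where "S = (\<integral>x. bubble (x::'a) ^ 4 \<partial>lborel)"
  define A where "A = (\<integral>x. norm (Df x) ^ 2 \<partial>lborel)"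
  define B where "B = (\<integral>x. f x ^ 4 \<partial>lborel)"
  note bi = bubble_integrals[folded S_def]
  have cube_lim: "(\<lambda>n. \<integral>y. indicator (cube (real (Suc n))) y * g y \<partial>lborel) \<longlonglongrightarrow> (\<integral>y. g y \<partial>lborel)"
    if g: "integrable lborel g" for g :: "'a \<Rightarrow> real"
  proof (rule integral_dominated_convergence[where w = "\<lambda>y. norm (g y)"])
    show "AE y in lborel. (\<lambda>n. indicator (cube (real (Suc n))) y * g y) \<longlonglongrightarrow> g y"
    proof (rule AE_I2, rule tendsto_eventually)
      fix y :: 'a
      show "\<forall>\<^sub>F n in sequentially. indicator (cube (real (Suc n))) y * g y = g y"
      proof (rule eventually_sequentiallyI[of "nat \<lceil>norm y\<rceil>"])
        fix n assume "nat \<lceil>norm y\<rceil> \<le> n"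
        then have "norm y \<le> real (Suc n)" by linarith
        then have "y \<in> cube (real (Suc n))"
          unfolding cube_def using Basis_le_norm[of _ y] by (auto intro: order_trans)
        then show "indicator (cube (real (Suc n))) y * g y = g y" by simp
      qed
    qed
  qed (use g in \<open>auto simp: indicator_def\<close>)
  \<comment> \<open>The enlarged radius is positive and makes \<open>f\<close> vanish on the faces
    of the cube too, as \<open>sobolev_on_cube\<close> demands.\<close>
  have M': "f x = 0" if "b \<in> Basis" "\<bar>M\<bar> + 1 \<le> \<bar>x \<bullet> b\<bar>" for x b
    using that supp[of x] by (force simp: cube_def)
  have M'': "Df x = 0" if "x \<notin> cube (\<bar>M\<bar> + 1)" for x
    using that supp[of x] by (force simp: cube_def)
  have "B * (\<integral>y. indicator (cube (real (Suc n))) (y::'a) * bubble y ^ 3 \<partial>lborel) ^ 4 \<le>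
    (\<integral>y. indicator (cube (real (Suc n))) (y::'a) * bubble y ^ 4 \<partial>lborel) * (81 / 256 * A\<^sup>2 *
      (\<integral>y. indicator (cube (real (Suc n))) (y::'a) * (norm y ^ 2 * bubble y ^ 4) \<partial>lborel)\<^sup>2)" for n
    unfolding A_def B_def
    by (rule sobolev_on_cube[OF knothe dim _ f_cont Df_cont f_nonneg _ M' M'' deriv]) auto
  then have "B * (3 * S) ^ 4 \<le> S * (81 / 256 * A\<^sup>2 * (16 * S)\<^sup>2)"
    unfolding bi(1,2)[symmetric]
    by (intro LIMSEQ_le[OF tendsto_mult[OF tendsto_const tendsto_power[OF cube_lim]]
          tendsto_mult[OF cube_lim[of "\<lambda>y. bubble y ^ 4", folded S_def] tendsto_mult[OF tendsto_const tendsto_power[OF cube_lim]]]])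
      (auto intro: integrable_bubble_power integrable_norm_sq_bubble)
  then have "(81 * S ^ 3) * (B * S) \<le> (81 * S ^ 3) * A\<^sup>2"
    by (simp add: power_mult_distrib power4_eq_xxxx power3_eq_cube power2_eq_square[of S] mult.assoc mult.left_commute mult.commute)
  then have "B * S \<le> A\<^sup>2"
    using bi(3) by (subst (asm) mult_le_cancel_left_pos) auto
  then show ?thesis unfolding A_def B_def S_def .
qed

end

section \<open>Mollification\<close>

definition flat :: "nat \<Rightarrow> real \<Rightarrow> real" where
  "flat k s = (if s > 0 then inverse s ^ k * exp (- inverse s) else 0)"

lemma flat_tendsto_0: "(flat k \<longlongrightarrow> 0) (at 0)"
proof (rule filterlim_split_at)
  have "(flat k \<longlongrightarrow> 0) (at_left 0) \<longleftrightarrow> ((\<lambda>_. 0::real) \<longlongrightarrow> 0) (at_left (0::real))"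
    by (rule tendsto_cong) (auto simp: eventually_at_filter flat_def)
  then show "(flat k \<longlongrightarrow> 0) (at_left 0)" by simp
  have "((\<lambda>s::real. inverse s ^ k / exp (inverse s)) \<longlongrightarrow> 0) (at_right 0)"
    by (rule filterlim_compose[OF tendsto_power_div_exp_0 filterlim_inverse_at_top_right])
  moreover have "(flat k \<longlongrightarrow> 0) (at_right 0) \<longleftrightarrow> ((\<lambda>s::real. inverse s ^ k / exp (inverse s)) \<longlongrightarrow> 0) (at_right 0)"
    by (rule tendsto_cong) (auto simp: eventually_at_filter flat_def exp_minus field_simps)
  ultimately show "(flat k \<longlongrightarrow> 0) (at_right 0)" by simp
qed

text \<open>The powers of \<open>1 / s\<close> are there to make the family stable under
  differentiation up to linear combinations, the starting point being the classical function
  \<open>exp (- 1 / s)\<close> for positive \<open>s\<close>.\<close>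

lemma flat_has_derivative:
  "(flat k has_real_derivative flat (k + 2) s - real k * flat (k + 1) s) (at s)"
proof (cases s "0::real" rule: linorder_cases)
  case greater
  have "((\<lambda>s. inverse s ^ k * exp (- inverse s)) has_real_derivative flat (k + 2) s - real k * flat (k + 1) s) (at s)"
    using greater
    by (auto intro!: derivative_eq_intros simp: flat_def power2_eq_square divide_simps)
      (cases k; simp add: field_simps power_add)+
  then show ?thesis
    by (rule has_field_derivative_transform_within_open[of _ _ _ "{0<..}"])
      (use greater in \<open>auto simp: flat_def\<close>)
next
  case less
  have "((\<lambda>_. 0::real) has_real_derivative 0) (at s)" by simp
  then have "(flat k has_real_derivative 0) (at s)"
    by (rule has_field_derivative_transform_within_open[of _ _ _ "{..<0}"])
      (use less in \<open>auto simp: flat_def\<close>)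
  then show ?thesis using less by (simp add: flat_def)
next
  case equal
  \<comment> \<open>At the origin the difference quotient of \<open>flat k\<close> is
    \<open>flat (k + 1)\<close>, which tends to 0.\<close>
  have "((\<lambda>h. (flat k h - flat k 0) / (h - 0)) \<longlongrightarrow> 0) (at 0)"
  proof -
    have "(flat k h - flat k 0) / (h - 0) = flat (k + 1) h" for h
      by (auto simp: flat_def field_simps)
    then show ?thesis using flat_tendsto_0[of "k+1"] by (simp del: add_Suc_right)
  qed
  then show ?thesis
    using equal by (simp add: has_field_derivative_iff flat_def)
qed

text \<open>Smoothness refers to all iterated partial derivatives, so it is proved for a class that
  contains the bump and is stable under every \<open>partial i\<close>: the algebra generated by the
  constants, the coordinates and the functions \<open>flat k (\<rho> - |x - c|^2)\<close>.\<close>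

inductive bump_algebra :: "real^4 \<Rightarrow> real \<Rightarrow> (real^4 \<Rightarrow> real) \<Rightarrow> bool" for c \<rho> where
  const: "bump_algebra c \<rho> (\<lambda>x. k)"
| coord: "bump_algebra c \<rho> (\<lambda>x. x $ i)"
| flat: "bump_algebra c \<rho> (\<lambda>x. flat k (\<rho> - norm (x - c) ^ 2))"
| add: "bump_algebra c \<rho> f \<Longrightarrow> bump_algebra c \<rho> g \<Longrightarrow> bump_algebra c \<rho> (\<lambda>x. f x + g x)"
| mult: "bump_algebra c \<rho> f \<Longrightarrow> bump_algebra c \<rho> g \<Longrightarrow> bump_algebra c \<rho> (\<lambda>x. f x * g x)"

lemma partial_eq:
  assumes "\<And>x. (f has_derivative f' x) (at x)"
  shows "partial i f = (\<lambda>x. f' x (axis i 1))"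
  unfolding partial_def frechet_derivative_at[OF assms, symmetric] ..

lemma flat_norm_has_derivative:
  "((\<lambda>x::real^4. flat k (\<rho> - norm (x - c) ^ 2)) has_derivative
    (\<lambda>h. (flat (k + 2) (\<rho> - norm (x - c) ^ 2) - real k * flat (k + 1) (\<rho> - norm (x - c) ^ 2)) * (- 2 * ((x - c) \<bullet> h)))) (at x)"
proof -
  have "((\<lambda>x. \<rho> - norm (x - c) ^ 2) has_derivative (\<lambda>h. - 2 * ((x - c) \<bullet> h))) (at x)"
    unfolding power2_norm_eq_inner
    by (auto intro!: derivative_eq_intros simp: inner_commute)
  from DERIV_compose_FDERIV[OF flat_has_derivative this] show ?thesis
    by (simp add: mult.commute)
qed

lemma bump_algebra_partial:
  "bump_algebra c \<rho> f \<Longrightarrow> (\<forall>x. f differentiable (at x)) \<and> (\<forall>i. bump_algebra c \<rho> (partial i f))"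
proof (induction rule: bump_algebra.induct)
  case (const k)
  have "partial i (\<lambda>x. k) = (\<lambda>x. 0)" for i by (rule partial_eq) auto
  then show ?case by (auto intro: bump_algebra.const)
next
  case (coord j)
  have d: "((\<lambda>x. x $ j) has_derivative (\<lambda>h. h $ j)) (at x)" for x :: "real^4"
    by (rule bounded_linear_imp_has_derivative[OF bounded_linear_vec_nth])
  show ?case using partial_eq[OF d] d by (auto intro: bump_algebra.const simp: differentiable_def)
next
  case (flat k)
  have "(\<lambda>x. flat k (\<rho> - norm (x - c) ^ 2)) differentiable at x" for x
    using flat_norm_has_derivative unfolding differentiable_def by blast
  moreover have "partial i (\<lambda>x. flat k (\<rho> - norm (x - c) ^ 2)) =
     (\<lambda>x. (flat (k + 2) (\<rho> - norm (x - c) ^ 2) + (- real k) * flat (k + 1) (\<rho> - norm (x - c) ^ 2)) * (- 2 * (x $ i + - (c $ i))))" for i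
    using partial_eq[OF flat_norm_has_derivative] by (simp add: inner_axis fun_eq_iff algebra_simps)
  moreover have "bump_algebra c \<rho>
     (\<lambda>x. (flat (k + 2) (\<rho> - norm (x - c) ^ 2) + (- real k) * flat (k + 1) (\<rho> - norm (x - c) ^ 2)) * (- 2 * (x $ i + - (c $ i))))" for i
    by (intro bump_algebra.intros)
  ultimately show ?case by simp
next
  case (add f g)
  have d: "((\<lambda>x. f x + g x) has_derivative (\<lambda>h. frechet_derivative f (at x) h + frechet_derivative g (at x) h)) (at x)" for x
    using add by (intro has_derivative_add frechet_derivative_works[THEN iffD1]) auto
  show ?case
    using partial_eq[OF d] add d by (auto simp: partial_def[symmetric] intro!: bump_algebra.add simp: differentiable_def)
next
  case (mult f g)
  have d: "((\<lambda>x. f x * g x) has_derivative (\<lambda>h. f x * frechet_derivative g (at x) h + frechet_derivative f (at x) h * g x)) (at x)" for x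
    using mult by (intro has_derivative_mult frechet_derivative_works[THEN iffD1]) auto
  show ?case
    using partial_eq[OF d] mult d
    by (auto simp: partial_def[symmetric] differentiable_def intro!: bump_algebra.add bump_algebra.mult)
qed

lemma bump_algebra_smooth:
  assumes "bump_algebra c \<rho> f" shows "smooth f"
proof -
  have "bump_algebra c \<rho> (foldr partial is f)" for "is"
    using assms by (induction "is") (auto dest: bump_algebra_partial)
  then show ?thesis
    unfolding smooth_def differentiable_on_def
    using bump_algebra_partial by (blast intro: differentiable_at_withinI)
qed

definition bump_mass :: "real \<Rightarrow> real" where
  "bump_mass r = (\<integral>x. flat 0 (r\<^sup>2 - norm (x :: real^4) ^ 2) \<partial>lborel)"

definition mollifier :: "real \<Rightarrow> real^4 \<Rightarrow> real" where
  "mollifier r x = flat 0 (r\<^sup>2 - norm x ^ 2) / bump_mass r"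

lemma flat_nonneg: "0 \<le> flat k s"
  by (simp add: flat_def)

lemma continuous_on_flat: "continuous_on S (flat k)"
  using flat_has_derivative by (intro continuous_at_imp_continuous_on ballI DERIV_isCont)

lemma continuous_on_flat_norm: "continuous_on S (\<lambda>x::real^4. flat k (\<rho> - norm (x - c) ^ 2))"
  by (rule continuous_on_compose2[OF continuous_on_flat[of UNIV]]) (auto intro!: continuous_intros)

lemma flat_eq_0_iff: "flat 0 s = 0 \<longleftrightarrow> s \<le> 0"
  by (auto simp: flat_def)

lemma bump_mass_pos: "r > 0 \<Longrightarrow> integrable lborel (\<lambda>x::real^4. flat 0 (r\<^sup>2 - norm x ^ 2)) \<and> bump_mass r > 0"
proof
  assume r: "r > 0"
  have *: "norm x < r" if "x \<notin> cube r \<or> flat 0 (r\<^sup>2 - norm x ^ 2) \<noteq> 0" "x \<in> cube r" for x :: "real^4"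
    using that r by (auto simp: flat_eq_0_iff power2_le_iff_abs_le abs_le_square_iff[symmetric])
  show int: "integrable lborel (\<lambda>x::real^4. flat 0 (r\<^sup>2 - norm x ^ 2))"
  proof (rule integrable_compact_support[where R = r])
    show "continuous_on UNIV (\<lambda>x::real^4. flat 0 (r\<^sup>2 - norm x ^ 2))"
      using continuous_on_flat_norm[of UNIV 0 "r\<^sup>2" 0] by simp
    fix x :: "real^4" assume "x \<notin> cube r"
    then obtain b :: "real^4" where "b \<in> Basis" "r < \<bar>x \<bullet> b\<bar>" by (auto simp: cube_def not_le)
    then have "r < norm x" using Basis_le_norm[of b x] by simp
    then have "r\<^sup>2 \<le> norm x ^ 2" using r by (intro power_mono) auto
    then show "flat 0 (r\<^sup>2 - norm x ^ 2) = 0" by (simp add: flat_eq_0_iff)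
  qed
  have "bump_mass r \<noteq> 0"
  proof
    assume "bump_mass r = 0"
    then have "AE x in (lborel :: (real^4) measure). flat 0 (r\<^sup>2 - norm x ^ 2) = 0"
      unfolding bump_mass_def using int by (subst (asm) integral_nonneg_eq_0_iff_AE) (auto simp: flat_nonneg)
    then have "AE x in (lborel :: (real^4) measure). x \<notin> ball 0 r"
      by eventually_elim (use r in \<open>auto simp: flat_eq_0_iff abs_le_square_iff[symmetric]\<close>)
    then have "emeasure lborel (ball (0::real^4) r) = 0"
      by (subst (asm) AE_iff_measurable[OF _ refl]) (auto simp: ball_def)
    moreover have "emeasure lborel (ball (0::real^4) r) \<noteq> 0"
      using content_ball_pos[OF r, of "0::real^4"] by (auto simp: measure_def)
    ultimately show False by simp
  qed
  moreover have "bump_mass r \<ge> 0"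
    unfolding bump_mass_def by (intro integral_nonneg_AE) (auto simp: flat_nonneg)
  ultimately show "bump_mass r > 0" by simp
qed

lemma test_function_mollifier:
  assumes r: "r > 0"
  shows "test_function (\<lambda>y. mollifier r (x - y))"
proof -
  have eq: "(\<lambda>y. mollifier r (x - y)) = (\<lambda>y. inverse (bump_mass r) * flat 0 (r\<^sup>2 - norm (y - x) ^ 2))"
    by (simp add: mollifier_def fun_eq_iff norm_minus_commute divide_inverse)
  have "smooth (\<lambda>y. mollifier r (x - y))"
    unfolding eq by (rule bump_algebra_smooth[where c = x and \<rho> = "r\<^sup>2"]) (intro bump_algebra.intros)
  moreover have "closure {y. mollifier r (x - y) \<noteq> 0} \<subseteq> cball x r"
  proof (rule closure_minimal)
    show "{y. mollifier r (x - y) \<noteq> 0} \<subseteq> cball x r"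
      using r by (auto simp: mollifier_def flat_eq_0_iff dist_norm abs_le_square_iff[symmetric] not_le intro: less_imp_le)
  qed simp
  then have "compact (closure {y. mollifier r (x - y) \<noteq> 0})"
    by (meson bounded_subset bounded_cball closed_closure compact_eq_bounded_closed)
  ultimately show ?thesis by (simp add: test_function_def)
qed

lemma mollifier_nonneg: "r > 0 \<Longrightarrow> 0 \<le> mollifier r x"
  using bump_mass_pos[of r] by (simp add: mollifier_def flat_nonneg)

lemma mollifier_eq_0: "r > 0 \<Longrightarrow> r \<le> norm x \<Longrightarrow> mollifier r x = 0"
  by (simp add: mollifier_def flat_eq_0_iff abs_le_square_iff[symmetric])

lemma mollifier_minus: "mollifier r (x - y) = mollifier r (y - x)"
  by (simp add: mollifier_def norm_minus_commute)

lemma continuous_on_mollifier: "continuous_on S (mollifier r)"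
  using continuous_on_flat_norm[of S 0 "r\<^sup>2" 0] unfolding mollifier_def[abs_def] divide_inverse
  by (intro continuous_intros) simp

lemma mollifier_measurable [measurable]: "mollifier r \<in> borel_measurable borel"
  by (intro borel_measurable_continuous_onI continuous_on_mollifier)

lemma nn_integral_mollifier:
  assumes r: "r > 0"
  shows "(\<integral>\<^sup>+y. ennreal (mollifier r (x - y)) \<partial>lborel) = 1"
proof -
  have "(\<integral>\<^sup>+y. ennreal (mollifier r (x - y)) \<partial>lborel) = (\<integral>\<^sup>+y. ennreal (mollifier r (y - x)) \<partial>lborel)"
    by (simp add: mollifier_minus)
  also have "\<dots> = (\<integral>\<^sup>+y. ennreal (mollifier r y) \<partial>lborel)"
    using nn_integral_lborel_translate[of "\<lambda>y. ennreal (mollifier r y)" "- x"] by simp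
  also have "\<dots> = ennreal (\<integral>y. mollifier r y \<partial>lborel)"
    using r bump_mass_pos[OF r] by (intro nn_integral_eq_integral) (auto simp: mollifier_def[abs_def] mollifier_nonneg flat_nonneg)
  also have "(\<integral>y. mollifier r y \<partial>lborel) = 1"
    using bump_mass_pos[OF r] by (simp add: mollifier_def bump_mass_def[symmetric])
  finally show ?thesis by simp
qed

lemma mollifier_bounded: "\<exists>C\<ge>0. \<forall>z. \<bar>mollifier r z\<bar> \<le> C"
proof -
  have "flat 0 s \<le> 1" for s by (simp add: flat_def)
  then have "\<bar>mollifier r z\<bar> \<le> 1 / \<bar>bump_mass r\<bar>" for z
    by (auto simp: mollifier_def flat_nonneg intro!: divide_right_mono)
  then show ?thesis by (intro exI[of _ "1 / \<bar>bump_mass r\<bar>"]) auto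
qed

section \<open>Convolution with a mollifier\<close>

definition loc_int :: "(real^4 \<Rightarrow> 'b::{banach, second_countable_topology}) \<Rightarrow> bool" where
  "loc_int f \<longleftrightarrow> f \<in> borel_measurable borel \<and> (\<forall>R. integrable lborel (\<lambda>x. indicator (cball 0 R) x *\<^sub>R f x))"

lemma integrable_imp_loc_int: "integrable lborel f \<Longrightarrow> loc_int f"
  unfolding loc_int_def by (auto intro!: integrable_mult_indicator)

definition conv :: "real \<Rightarrow> (real^4 \<Rightarrow> 'b::{banach, second_countable_topology}) \<Rightarrow> real^4 \<Rightarrow> 'b" where
  "conv r f x = (\<integral>y. mollifier r (x - y) *\<^sub>R f y \<partial>lborel)"

text \<open>Dominated convergence for kernels that are bounded by one constant and vanish outside
  one ball, with \<open>C |f|\<close> on that ball as majorant. It gives continuity and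
  differentiability of convolutions for functions that are only locally integrable.\<close>

lemma integral_kernel:
  fixes f :: "real^4 \<Rightarrow> 'b::{banach, second_countable_topology}"
  assumes f: "loc_int f" and k[measurable]: "\<And>n. k n \<in> borel_measurable borel"
    and bound: "\<And>n y. \<bar>k n y\<bar> \<le> C * indicator (cball 0 R) y"
    and lim: "\<And>y. (\<lambda>n. k n y) \<longlonglongrightarrow> k' y"
  shows "integrable lborel (\<lambda>y. k n y *\<^sub>R f y)"
    and "(\<lambda>n. \<integral>y. k n y *\<^sub>R f y \<partial>lborel) \<longlonglongrightarrow> (\<integral>y. k' y *\<^sub>R f y \<partial>lborel)"
proof -
  have [measurable]: "f \<in> borel_measurable borel" using f by (simp add: loc_int_def)
  have [measurable]: "k' \<in> borel_measurable borel"
    using k lim by (rule borel_measurable_LIMSEQ_real[rotated])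
  have w: "integrable lborel (\<lambda>y. C * norm (indicator (cball 0 R) y *\<^sub>R f y))"
    using f unfolding loc_int_def by (intro integrable_mult_right integrable_norm) blast
  have b: "norm (k n y *\<^sub>R f y) \<le> C * norm (indicator (cball 0 R) y *\<^sub>R f y)" for n y
    using mult_right_mono[OF bound[of n y], of "norm (f y)"] by (simp add: mult.assoc)
  have lim': "(\<lambda>n. k n y *\<^sub>R f y) \<longlonglongrightarrow> k' y *\<^sub>R f y" for y
    by (intro tendsto_intros lim)
  show "integrable lborel (\<lambda>y. k n y *\<^sub>R f y)"
    by (rule Bochner_Integration.integrable_bound[OF w])
      (use b[of n] in \<open>auto intro!: AE_I2 order_trans[OF _ abs_ge_self] simp del: norm_scaleR\<close>)
  show "(\<lambda>n. \<integral>y. k n y *\<^sub>R f y \<partial>lborel) \<longlonglongrightarrow> (\<integral>y. k' y *\<^sub>R f y \<partial>lborel)"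
    by (rule integral_dominated_convergence[OF _ _ w]) (use b lim' in auto)
qed

lemma integrable_conv_kernel:
  assumes f: "loc_int f" and r: "r > 0"
  shows "integrable lborel (\<lambda>y. mollifier r (x - y) *\<^sub>R f y)"
proof -
  obtain C where C: "C \<ge> 0" "\<And>z. \<bar>mollifier r z\<bar> \<le> C" using mollifier_bounded by blast
  have "\<bar>mollifier r (x - y)\<bar> \<le> C * indicator (cball 0 (norm x + r)) y" for y
  proof (cases "norm y \<le> norm x + r")
    case False
    then have "r \<le> norm (x - y)" using norm_triangle_ineq2[of y x] by (simp add: norm_minus_commute)
    then show ?thesis using C r by (simp add: mollifier_eq_0)
  qed (use C in auto)
  then show ?thesis
    by (intro integral_kernel(1)[OF f, where k = "\<lambda>_. \<lambda>y. mollifier r (x - y)" and k' = "\<lambda>y. mollifier r (x - y)"]) auto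
qed

lemma continuous_on_conv:
  assumes f: "loc_int f" and r: "r > 0"
  shows "continuous_on UNIV (conv r f)"
proof (intro continuous_at_imp_continuous_on ballI)
  fix x
  show "isCont (conv r f) x"
    unfolding continuous_at_sequentially comp_def
  proof (intro allI impI)
    fix X assume X: "X \<longlonglongrightarrow> x"
    then obtain B where B: "\<And>n. norm (X n) \<le> B"
      using convergent_imp_Bseq[of X] unfolding convergent_def Bseq_def by blast
    obtain C where C: "C \<ge> 0" "\<And>z. \<bar>mollifier r z\<bar> \<le> C" using mollifier_bounded by blast
    show "(\<lambda>n. conv r f (X n)) \<longlonglongrightarrow> conv r f x"
      unfolding conv_def
    proof (rule integral_kernel(2)[OF f])
      fix n y
      show "\<bar>mollifier r (X n - y)\<bar> \<le> C * indicator (cball 0 (B + r)) y"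
      proof (cases "norm y \<le> B + r")
        case False
        then have "r \<le> norm (X n - y)" using norm_triangle_ineq2[of y "X n"] B[of n] by (simp add: norm_minus_commute)
        then show ?thesis using C r by (simp add: mollifier_eq_0)
      qed (use C in auto)
    next
      fix y
      have "isCont (mollifier r) (x - y)"
        using continuous_on_mollifier[of UNIV r] by (simp add: continuous_on_eq_continuous_at)
      then show "(\<lambda>n. mollifier r (X n - y)) \<longlonglongrightarrow> mollifier r (x - y)"
        by (rule isCont_tendsto_compose) (intro tendsto_intros X)
    qed measurable
  qed
qed

lemma conv_measurable [measurable]:
  fixes f :: "real^4 \<Rightarrow> 'b::{banach, second_countable_topology}"
  assumes [measurable]: "f \<in> borel_measurable borel"
  shows "conv r f \<in> borel_measurable borel"
proof -
  have "(\<lambda>z. mollifier r (fst z - snd z) *\<^sub>R f (snd z)) \<in> borel_measurable (borel \<Otimes>\<^sub>M lborel)"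
    by measurable
  then show ?thesis unfolding conv_def[abs_def] by measurable
qed

text \<open>The differential of the mollifier at \<open>z\<close> applied to \<open>b\<close>; the
  index 2 appears because the derivative of \<open>flat 0\<close> is \<open>flat 2\<close>.\<close>

definition mollifier_deriv :: "real \<Rightarrow> real^4 \<Rightarrow> real^4 \<Rightarrow> real" where
  "mollifier_deriv r b z = flat 2 (r\<^sup>2 - norm z ^ 2) * (- 2 * (z \<bullet> b)) / bump_mass r"

lemma mollifier_has_derivative:
  "(mollifier r has_derivative (\<lambda>b. mollifier_deriv r b z)) (at z)"
proof -
  have "((\<lambda>x. inverse (bump_mass r) * flat 0 (r\<^sup>2 - norm (x - 0) ^ 2)) has_derivative
      (\<lambda>h. inverse (bump_mass r) * ((flat (0 + 2) (r\<^sup>2 - norm (z - 0) ^ 2) - real 0 * flat (0 + 1) (r\<^sup>2 - norm (z - 0) ^ 2)) * (- 2 * ((z - 0) \<bullet> h))))) (at z)"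
    by (rule has_derivative_mult_right[OF flat_norm_has_derivative])
  moreover have "mollifier r = (\<lambda>x. inverse (bump_mass r) * flat 0 (r\<^sup>2 - norm (x - 0) ^ 2))"
    by (simp add: mollifier_def fun_eq_iff divide_inverse)
  moreover have "(\<lambda>h. mollifier_deriv r h z) = (\<lambda>h. inverse (bump_mass r) * ((flat (0 + 2) (r\<^sup>2 - norm (z - 0) ^ 2) - real 0 * flat (0 + 1) (r\<^sup>2 - norm (z - 0) ^ 2)) * (- 2 * ((z - 0) \<bullet> h))))"
    by (simp add: mollifier_deriv_def fun_eq_iff divide_inverse numeral_2_eq_2)
  ultimately show ?thesis by simp
qed

lemma mollifier_line_deriv:
  "((\<lambda>t. mollifier r (z + t *\<^sub>R b)) has_real_derivative mollifier_deriv r b (z + t *\<^sub>R b)) (at t)"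
proof -
  have "((\<lambda>t. z + t *\<^sub>R b) has_derivative (\<lambda>h. h *\<^sub>R b)) (at t)"
    by (auto intro!: derivative_eq_intros)
  from has_derivative_compose[OF this mollifier_has_derivative]
  have "((\<lambda>t. mollifier r (z + t *\<^sub>R b)) has_derivative (\<lambda>h. mollifier_deriv r (h *\<^sub>R b) (z + t *\<^sub>R b))) (at t)" .
  moreover have "(\<lambda>h. mollifier_deriv r (h *\<^sub>R b) (z + t *\<^sub>R b)) = (*) (mollifier_deriv r b (z + t *\<^sub>R b))"
    by (simp add: fun_eq_iff mollifier_deriv_def)
  ultimately show ?thesis by (simp add: has_field_derivative_def)
qed

lemma partial_mollifier:
  "partial i (\<lambda>y. mollifier r (x - y)) = (\<lambda>y. - mollifier_deriv r (axis i 1) (x - y))"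
proof -
  have "((\<lambda>y. mollifier r (x - y)) has_derivative (\<lambda>h. mollifier_deriv r (- h) (x - y))) (at y)" for y
    by (rule has_derivative_compose[OF _ mollifier_has_derivative]) (auto intro!: derivative_eq_intros)
  from partial_eq[OF this] show ?thesis by (simp add: mollifier_deriv_def)
qed

lemma mollifier_deriv_bounded:
  assumes r: "r > 0"
  shows "\<exists>C\<ge>0. \<forall>z. \<bar>mollifier_deriv r b z\<bar> \<le> C"
proof -
  have fl: "flat 2 s \<le> 2" for s
  proof (cases "s > 0")
    case True
    have "0 < inverse s" using True by simp
    then have "(inverse s)\<^sup>2 \<le> 2 * exp (inverse s)"
      using exp_lower_Taylor_quadratic[of "inverse s"] by linarith
    then show ?thesis using True by (simp add: flat_def exp_minus field_simps)
  qed (simp add: flat_def)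
  let ?C = "2 * (2 * (r * norm b)) / bump_mass r"
  have "\<bar>mollifier_deriv r b z\<bar> \<le> ?C" for z
  proof (cases "norm z \<le> r")
    case True
    have "\<bar>z \<bullet> b\<bar> \<le> r * norm b"
      using Cauchy_Schwarz_ineq2[of z b] mult_right_mono[OF True, of "norm b"] by simp
    then have "\<bar>flat 2 (r\<^sup>2 - norm z ^ 2) * (- 2 * (z \<bullet> b))\<bar> \<le> 2 * (2 * (r * norm b))"
      unfolding abs_mult by (intro mult_mono) (use fl r in \<open>auto simp: flat_nonneg\<close>)
    then show ?thesis
      unfolding mollifier_deriv_def using bump_mass_pos[OF r] by (simp add: abs_divide divide_right_mono)
  next
    case False
    then have "r\<^sup>2 - norm z ^ 2 \<le> 0" using r by (auto intro!: power_mono)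
    then have "flat 2 (r\<^sup>2 - norm z ^ 2) = 0" unfolding flat_def by (meson not_less)
    then show ?thesis using bump_mass_pos[OF r] r by (simp add: mollifier_deriv_def)
  qed
  then show ?thesis using bump_mass_pos[OF r] r by (intro exI[of _ ?C]) auto
qed

text \<open>The difference quotients of the mollifier are bounded by its Lipschitz constant in
  direction \<open>b\<close>, and for bounded increments they live in a common ball. Hence
  \<open>integral_kernel\<close> applies along every null sequence of increments.\<close>

lemma conv_line_deriv:
  assumes f: "loc_int f" and r: "r > 0"
  shows "((\<lambda>t. conv r f (x + t *\<^sub>R b)) has_vector_derivative
    (\<integral>y. mollifier_deriv r b (x - y) *\<^sub>R f y \<partial>lborel)) (at 0)"
proof -
  let ?D = "\<integral>y. mollifier_deriv r b (x - y) *\<^sub>R f y \<partial>lborel"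
  obtain C where C: "C \<ge> 0" "\<And>z. \<bar>mollifier_deriv r b z\<bar> \<le> C" using mollifier_deriv_bounded[OF r] by blast
  have lip: "\<bar>mollifier r (z + s *\<^sub>R b) - mollifier r z\<bar> \<le> C * \<bar>s\<bar>" for z s
    using field_differentiable_bound[of UNIV "\<lambda>t. mollifier r (z + t *\<^sub>R b)" "\<lambda>t. mollifier_deriv r b (z + t *\<^sub>R b)" C s 0]
      mollifier_line_deriv C by auto
  have "(\<lambda>h. (1 / h) *\<^sub>R (conv r f (x + h *\<^sub>R b) - conv r f x)) \<midarrow>0\<rightarrow> ?D"
    unfolding LIMSEQ_SEQ_conv[symmetric]
  proof (intro allI impI, elim conjE)
    fix S :: "nat \<Rightarrow> real" assume S0: "\<forall>n. S n \<noteq> 0" and S: "S \<longlonglongrightarrow> 0"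
    then obtain B where B: "B > 0" "\<And>n. \<bar>S n\<bar> \<le> B"
      using convergent_imp_Bseq[of S] unfolding convergent_def Bseq_def by auto
    define k where "k n y = (mollifier r (x + S n *\<^sub>R b - y) - mollifier r (x - y)) / S n" for n y
    have "(1 / S n) *\<^sub>R (conv r f (x + S n *\<^sub>R b) - conv r f x) = (\<integral>y. k n y *\<^sub>R f y \<partial>lborel)" for n
      unfolding conv_def
      by (subst Bochner_Integration.integral_diff[symmetric])
        (auto intro!: integrable_conv_kernel f r simp: k_def scaleR_diff_left[symmetric] simp flip: integral_scaleR_right)
    moreover have "(\<lambda>n. \<integral>y. k n y *\<^sub>R f y \<partial>lborel) \<longlonglongrightarrow> ?D"
    proof (rule integral_kernel(2)[OF f])
      show "k n \<in> borel_measurable borel" for n unfolding k_def by measurable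
      fix n y
      let ?R = "norm x + B * norm b + r"
      show "\<bar>k n y\<bar> \<le> C * indicator (cball 0 ?R) y"
      proof (cases "norm y \<le> ?R")
        case True
        have "\<bar>k n y\<bar> \<le> C"
          using lip[of "x - y" "S n"] S0 by (simp add: k_def abs_divide divide_le_eq add.commute diff_add_eq)
        then show ?thesis using True by simp
      next
        case False
        have Sb: "\<bar>S n\<bar> * norm b \<le> B * norm b" using B by (intro mult_right_mono) auto
        have "norm y \<le> norm (x - y) + norm x"
          using norm_triangle_ineq[of "y - x" x] by (simp add: norm_minus_commute)
        moreover have "norm y \<le> norm (x + S n *\<^sub>R b - y) + norm x + \<bar>S n\<bar> * norm b"
          using norm_triangle_ineq[of "y - (x + S n *\<^sub>R b)" "x + S n *\<^sub>R b"] norm_triangle_ineq[of x "S n *\<^sub>R b"]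
          by (simp add: norm_minus_commute)
        moreover have "0 \<le> B * norm b" using B by simp
        ultimately have "r \<le> norm (x - y)" "r \<le> norm (x + S n *\<^sub>R b - y)" using False Sb by linarith+
        then show ?thesis using C r by (simp add: k_def mollifier_eq_0)
      qed
    next
      fix y
      have "(\<lambda>h. (mollifier r ((x - y) + (0 + h) *\<^sub>R b) - mollifier r ((x - y) + 0 *\<^sub>R b)) / h) \<midarrow>0\<rightarrow> mollifier_deriv r b ((x - y) + 0 *\<^sub>R b)"
        using mollifier_line_deriv[of r "x - y" b 0] unfolding DERIV_def .
      then have "(\<lambda>n. (mollifier r ((x - y) + (0 + S n) *\<^sub>R b) - mollifier r ((x - y) + 0 *\<^sub>R b)) / S n) \<longlonglongrightarrow> mollifier_deriv r b ((x - y) + 0 *\<^sub>R b)"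
        unfolding LIMSEQ_SEQ_conv[symmetric] using S S0 by blast
      then show "(\<lambda>n. k n y) \<longlonglongrightarrow> mollifier_deriv r b (x - y)"
        by (simp add: k_def diff_add_eq)
    qed
    ultimately show "(\<lambda>n. (1 / S n) *\<^sub>R (conv r f (x + S n *\<^sub>R b) - conv r f x)) \<longlonglongrightarrow> ?D" by simp
  qed
  then have "(\<lambda>h. norm ((1 / h) *\<^sub>R (conv r f (x + h *\<^sub>R b) - conv r f x) - ?D)) \<midarrow>0\<rightarrow> 0"
    by (intro tendsto_norm_zero) (simp add: LIM_zero)
  moreover have "norm (conv r f (x + (0 + h) *\<^sub>R b) - conv r f (x + 0 *\<^sub>R b) - h *\<^sub>R ?D) / norm h =
      norm ((1 / h) *\<^sub>R (conv r f (x + h *\<^sub>R b) - conv r f x) - ?D)" if "h \<noteq> 0" for h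
  proof -
    have "(1 / h) *\<^sub>R (conv r f (x + h *\<^sub>R b) - conv r f x) - ?D =
      (1 / h) *\<^sub>R (conv r f (x + h *\<^sub>R b) - conv r f x - h *\<^sub>R ?D)"
      using that by (simp add: scaleR_diff_right)
    then show ?thesis by (simp add: divide_inverse mult.commute)
  qed
  ultimately have "(\<lambda>h. norm (conv r f (x + (0 + h) *\<^sub>R b) - conv r f (x + 0 *\<^sub>R b) - h *\<^sub>R ?D) / norm h) \<midarrow>0\<rightarrow> 0"
    by (subst tendsto_cong) (auto simp: eventually_at_filter)
  then show ?thesis
    unfolding has_vector_derivative_def has_derivative_at by (auto intro!: bounded_linear_scaleR_left)
qed

lemma norm_conv_le:
  "ennreal (norm (conv r f x)) \<le> (\<integral>\<^sup>+y. ennreal \<bar>mollifier r (x - y)\<bar> * ennreal (norm (f y)) \<partial>lborel)"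
proof (cases "integrable lborel (\<lambda>y. mollifier r (x - y) *\<^sub>R f y)")
  case True
  from integral_norm_bound_ennreal[OF this] show ?thesis
    by (simp add: conv_def ennreal_mult)
next
  case False
  \<comment> \<open>Without integrability the Bochner integral is 0 by convention, and the bound is
    trivial.\<close>
  then show ?thesis by (simp add: conv_def not_integrable_integral_eq)
qed

lemma nn_integral_conv:
  fixes f :: "real^4 \<Rightarrow> 'b::{banach, second_countable_topology}" and g :: "real^4 \<Rightarrow> ennreal"
  assumes r: "r > 0" and [measurable]: "g \<in> borel_measurable borel"
  shows "(\<integral>\<^sup>+x. (\<integral>\<^sup>+y. ennreal (mollifier r (x - y)) * g y \<partial>lborel) \<partial>lborel) = (\<integral>\<^sup>+y. g y \<partial>lborel)"
proof -
  have "(\<integral>\<^sup>+x. (\<integral>\<^sup>+y. ennreal (mollifier r (x - y)) * g y \<partial>lborel) \<partial>lborel) =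
     (\<integral>\<^sup>+y. (\<integral>\<^sup>+x. ennreal (mollifier r (x - y)) * g y \<partial>lborel) \<partial>lborel)"
    by (rule lborel_pair.Fubini') measurable
  also have "\<dots> = (\<integral>\<^sup>+y. (\<integral>\<^sup>+x. ennreal (mollifier r (y - x)) \<partial>lborel) * g y \<partial>lborel)"
    by (simp add: nn_integral_multc mollifier_minus)
  finally show ?thesis using nn_integral_mollifier[OF r] by simp
qed

lemma conv_L1_contraction:
  fixes f :: "real^4 \<Rightarrow> 'b::{banach, second_countable_topology}"
  assumes r: "r > 0" and [measurable]: "f \<in> borel_measurable borel"
  shows "(\<integral>\<^sup>+x. ennreal (norm (conv r f x)) \<partial>lborel) \<le> (\<integral>\<^sup>+x. ennreal (norm (f x)) \<partial>lborel)"
proof -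
  have "(\<integral>\<^sup>+x. ennreal (norm (conv r f x)) \<partial>lborel) \<le>
    (\<integral>\<^sup>+x. (\<integral>\<^sup>+y. ennreal (mollifier r (x - y)) * ennreal (norm (f y)) \<partial>lborel) \<partial>lborel)"
    using norm_conv_le[of r f] mollifier_nonneg[OF r] by (intro nn_integral_mono) simp
  also have "\<dots> = (\<integral>\<^sup>+x. ennreal (norm (f x)) \<partial>lborel)"
    by (rule nn_integral_conv[OF r]) measurable
  finally show ?thesis .
qed

text \<open>Jensen's inequality for the probability density \<open>mollifier r (x - y)\<close>:
  Cauchy-Schwarz with the density split into two square roots, one of which integrates to 1.
  Tonelli's theorem does the rest.\<close>

lemma conv_L2_contraction:
  fixes f :: "real^4 \<Rightarrow> 'b::{banach, second_countable_topology}"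
  assumes r: "r > 0" and [measurable]: "f \<in> borel_measurable borel"
  shows "(\<integral>\<^sup>+x. ennreal (norm (conv r f x) ^ 2) \<partial>lborel) \<le> (\<integral>\<^sup>+x. ennreal (norm (f x) ^ 2) \<partial>lborel)"
proof -
  have "ennreal (norm (conv r f x) ^ 2) \<le> (\<integral>\<^sup>+y. ennreal (mollifier r (x - y)) * ennreal (norm (f y) ^ 2) \<partial>lborel)" for x
  proof -
    have sq: "ennreal (sqrt (mollifier r (x - y))) ^ 2 = ennreal (mollifier r (x - y))" for y
      using mollifier_nonneg[OF r] by (simp add: ennreal_power)
    have "ennreal (norm (conv r f x) ^ 2) = ennreal (norm (conv r f x)) ^ 2"
      by (simp add: ennreal_power)
    also have "\<dots> \<le> (\<integral>\<^sup>+y. ennreal (mollifier r (x - y)) * ennreal (norm (f y)) \<partial>lborel) ^ 2"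
      using norm_conv_le[of r f x] mollifier_nonneg[OF r] by (intro power_mono) auto
    also have "(\<integral>\<^sup>+y. ennreal (mollifier r (x - y)) * ennreal (norm (f y)) \<partial>lborel) =
        (\<integral>\<^sup>+y. ennreal (sqrt (mollifier r (x - y))) * (ennreal (sqrt (mollifier r (x - y))) * ennreal (norm (f y))) \<partial>lborel)"
      by (simp add: mult.assoc[symmetric] sq[unfolded power2_eq_square])
    also have "\<dots>\<^sup>2 \<le> (\<integral>\<^sup>+y. ennreal (sqrt (mollifier r (x - y))) ^ 2 \<partial>lborel) *
        (\<integral>\<^sup>+y. (ennreal (sqrt (mollifier r (x - y))) * ennreal (norm (f y))) ^ 2 \<partial>lborel)"
      by (rule Cauchy_Schwarz_nn_integral) measurable
    also have "\<dots> = (\<integral>\<^sup>+y. ennreal (mollifier r (x - y)) * ennreal (norm (f y) ^ 2) \<partial>lborel)"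
      by (simp add: power_mult_distrib sq nn_integral_mollifier[OF r] ennreal_power)
    finally show ?thesis .
  qed
  then have "(\<integral>\<^sup>+x. ennreal (norm (conv r f x) ^ 2) \<partial>lborel) \<le>
    (\<integral>\<^sup>+x. (\<integral>\<^sup>+y. ennreal (mollifier r (x - y)) * ennreal (norm (f y) ^ 2) \<partial>lborel) \<partial>lborel)"
    by (intro nn_integral_mono)
  also have "\<dots> = (\<integral>\<^sup>+x. ennreal (norm (f x) ^ 2) \<partial>lborel)"
    by (rule nn_integral_conv[OF r]) measurable
  finally show ?thesis .
qed

lemma conv_add:
  assumes "loc_int f" "loc_int g" "r > 0"
  shows "conv r (\<lambda>x. f x + g x) x = conv r f x + conv r g x"
  unfolding conv_def using integrable_conv_kernel[OF assms(1,3)] integrable_conv_kernel[OF assms(2,3)]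
  by (subst Bochner_Integration.integral_add[symmetric]) (auto simp: scaleR_add_right)

section \<open>Mollifications converge in mean\<close>

definition radius :: "nat \<Rightarrow> real" where "radius n = inverse (real (Suc n))"

lemma radius_pos: "radius n > 0" by (simp add: radius_def)

lemma radius_tendsto: "radius \<longlonglongrightarrow> 0"
  unfolding radius_def[abs_def] by (rule LIMSEQ_inverse_real_of_nat)

definition conv_error :: "nat \<Rightarrow> (real^4 \<Rightarrow> 'b::{banach, second_countable_topology}) \<Rightarrow> ennreal" where
  "conv_error n u = (\<integral>\<^sup>+x. ennreal (norm (conv (radius n) u x - u x)) \<partial>lborel)"

definition conv_approx :: "(real^4 \<Rightarrow> 'b::{banach, second_countable_topology}) \<Rightarrow> bool" where
  "conv_approx u \<longleftrightarrow> (\<forall>e>0. \<forall>\<^sub>F n in sequentially. conv_error n u \<le> ennreal e)"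

lemma conv_error_add:
  assumes u: "integrable lborel u" and v: "integrable lborel v"
  shows "conv_error n (\<lambda>x. u x + v x) \<le> conv_error n u + conv_error n v"
proof -
  have [measurable]: "u \<in> borel_measurable borel" "v \<in> borel_measurable borel" using u v by auto
  have "conv_error n (\<lambda>x. u x + v x) \<le> (\<integral>\<^sup>+x. ennreal (norm (conv (radius n) u x - u x)) + ennreal (norm (conv (radius n) v x - v x)) \<partial>lborel)"
    unfolding conv_error_def
    by (intro nn_integral_mono)
      (auto simp: conv_add[OF integrable_imp_loc_int[OF u] integrable_imp_loc_int[OF v] radius_pos]
         ennreal_plus[symmetric] add_diff_add simp del: ennreal_plus intro!: ennreal_leI norm_triangle_ineq)
  also have "\<dots> = conv_error n u + conv_error n v"
    unfolding conv_error_def by (rule nn_integral_add) measurable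
  finally show ?thesis .
qed

lemma conv_error_le:
  assumes u: "integrable lborel u"
  shows "conv_error n u \<le> 2 * (\<integral>\<^sup>+x. ennreal (norm (u x)) \<partial>lborel)"
proof -
  have [measurable]: "u \<in> borel_measurable borel" using u by auto
  have "conv_error n u \<le> (\<integral>\<^sup>+x. ennreal (norm (conv (radius n) u x)) + ennreal (norm (u x)) \<partial>lborel)"
    unfolding conv_error_def
    by (intro nn_integral_mono) (auto simp: ennreal_plus[symmetric] simp del: ennreal_plus intro!: ennreal_leI norm_triangle_ineq4)
  also have "\<dots> = (\<integral>\<^sup>+x. ennreal (norm (conv (radius n) u x)) \<partial>lborel) + (\<integral>\<^sup>+x. ennreal (norm (u x)) \<partial>lborel)"
    by (rule nn_integral_add) measurable
  also have "\<dots> \<le> (\<integral>\<^sup>+x. ennreal (norm (u x)) \<partial>lborel) + (\<integral>\<^sup>+x. ennreal (norm (u x)) \<partial>lborel)"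
    by (intro add_right_mono conv_L1_contraction radius_pos) measurable
  finally show ?thesis by (simp add: mult_2)
qed

lemma conv_approx_add:
  assumes "integrable lborel u" "integrable lborel v" "conv_approx u" "conv_approx v"
  shows "conv_approx (\<lambda>x. u x + v x)"
  unfolding conv_approx_def
proof (intro allI impI)
  fix e :: real assume "e > 0"
  then have "\<forall>\<^sub>F n in sequentially. conv_error n u \<le> ennreal (e/2)" "\<forall>\<^sub>F n in sequentially. conv_error n v \<le> ennreal (e/2)"
    using assms(3,4) by (auto simp: conv_approx_def)
  then show "\<forall>\<^sub>F n in sequentially. conv_error n (\<lambda>x. u x + v x) \<le> ennreal e"
  proof eventually_elim
    case (elim n)
    have "conv_error n (\<lambda>x. u x + v x) \<le> conv_error n u + conv_error n v"
      by (rule conv_error_add[OF assms(1,2)])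
    also have "\<dots> \<le> ennreal (e/2) + ennreal (e/2)" using elim by (intro add_mono)
    also have "\<dots> = ennreal e" using \<open>e > 0\<close> by (simp add: ennreal_plus[symmetric] del: ennreal_plus)
    finally show ?case .
  qed
qed

text \<open>Convolution contracts the norm of \<open>L^1\<close>, so replacing \<open>u\<close> by
  an approximation \<open>v\<close> costs at most twice their distance, uniformly in the
  radius.\<close>

lemma conv_approx_closure:
  assumes u: "integrable lborel u"
    and v: "\<And>e. e > 0 \<Longrightarrow> \<exists>v. integrable lborel v \<and> conv_approx v \<and> (\<integral>\<^sup>+x. ennreal (norm (u x - v x)) \<partial>lborel) \<le> ennreal e"
  shows "conv_approx u"
  unfolding conv_approx_def
proof (intro allI impI)
  fix e :: real assume e: "e > 0"
  then obtain v where v: "integrable lborel v" "conv_approx v"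
    and le: "(\<integral>\<^sup>+x. ennreal (norm (u x - v x)) \<partial>lborel) \<le> ennreal (e/4)"
    using v[of "e/4"] by auto
  have "\<forall>\<^sub>F n in sequentially. conv_error n v \<le> ennreal (e/2)"
    using e v(2) by (auto simp: conv_approx_def)
  then show "\<forall>\<^sub>F n in sequentially. conv_error n u \<le> ennreal e"
  proof eventually_elim
    case (elim n)
    have uv: "integrable lborel (\<lambda>x. u x - v x)" using u v by simp
    have "conv_error n u \<le> conv_error n v + conv_error n (\<lambda>x. u x - v x)"
      using conv_error_add[OF v(1) uv] by simp
    also have "\<dots> \<le> ennreal (e/2) + 2 * ennreal (e/4)"
      by (intro add_mono elim order_trans[OF conv_error_le[OF uv]] mult_left_mono le) auto
    also have "2 * ennreal (e/4) = ennreal (e/2)"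
      using ennreal_mult'[of 2 "e/4"] by simp
    also have "ennreal (e/2) + ennreal (e/2) = ennreal e" using e by (simp add: ennreal_plus[symmetric] del: ennreal_plus)
    finally show ?case .
  qed
qed

lemma integral_mollifier: "r > 0 \<Longrightarrow> (\<integral>y. mollifier r (x - y) \<partial>lborel) = 1"
  using nn_integral_mollifier[of r x] mollifier_nonneg[of r]
  by (subst integral_eq_nn_integral) auto

text \<open>At a point of \<open>U\<close> the mollified indicator is eventually equal to 1, so the
  positive part \<open>h n\<close> of indicator minus mollification tends to 0 pointwise, dominated
  by the indicator. Indicator and mollification have the same integral, hence the error is exactly
  twice the integral of \<open>h n\<close>, and the region outside \<open>U\<close> needs no
  separate estimate.\<close>

lemma conv_approx_open:
  fixes U :: "(real^4) set"
  assumes U: "open U" and fin: "emeasure lborel U < \<infinity>"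
  shows "conv_approx (indicator U :: real^4 \<Rightarrow> real)"
proof -
  let ?u = "indicator U :: real^4 \<Rightarrow> real"
  define g where "g n = conv (radius n) ?u" for n
  have u_int: "integrable lborel ?u" using U fin by simp
  have [measurable]: "U \<in> sets borel" using U by simp
  have [measurable]: "g n \<in> borel_measurable borel" for n unfolding g_def by measurable
  have g_nonneg: "0 \<le> g n x" for n x
    unfolding g_def conv_def by (intro integral_nonneg_AE) (auto simp: mollifier_nonneg radius_pos)
  have "(\<integral>\<^sup>+x. ennreal (g n x) \<partial>lborel) = (\<integral>\<^sup>+x. ennreal (?u x) \<partial>lborel)" for n
  proof -
    have "ennreal (g n x) = (\<integral>\<^sup>+y. ennreal (mollifier (radius n) (x - y)) * ennreal (?u y) \<partial>lborel)" for x
      unfolding g_def conv_def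
      using integrable_conv_kernel[OF integrable_imp_loc_int[OF u_int] radius_pos, of n x]
      by (subst nn_integral_eq_integral[symmetric])
        (auto simp: mollifier_nonneg radius_pos ennreal_mult' simp flip: ennreal_indicator)
    then show ?thesis
      using nn_integral_conv[OF radius_pos, of "\<lambda>y. ennreal (?u y)" n] by simp
  qed
  moreover have "(\<integral>\<^sup>+x. ennreal (?u x) \<partial>lborel) = ennreal (\<integral>x. ?u x \<partial>lborel)"
    using u_int by (intro nn_integral_eq_integral) auto
  ultimately have gnn: "(\<integral>\<^sup>+x. ennreal (g n x) \<partial>lborel) = ennreal (\<integral>x. ?u x \<partial>lborel)" for n by simp
  have g_int: "integrable lborel (g n)" for n
    using gnn g_nonneg by (intro integrableI_nonneg) auto
  have g_eq: "(\<integral>x. g n x \<partial>lborel) = (\<integral>x. ?u x \<partial>lborel)" for n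
    using g_nonneg by (subst integral_eq_nn_integral) (auto simp: gnn)
  define h where "h n x = max 0 (?u x - g n x)" for n x
  have h_int: "integrable lborel (h n)" for n
    unfolding h_def using u_int g_int by (intro integrable_max) auto
  have h_lim: "(\<lambda>n. \<integral>x. h n x \<partial>lborel) \<longlonglongrightarrow> (\<integral>x. (0::real) \<partial>(lborel :: (real^4) measure))"
  proof (rule integral_dominated_convergence[where w = ?u])
    show "AE x in lborel. (\<lambda>n. h n x) \<longlonglongrightarrow> 0"
    proof (rule AE_I2, rule tendsto_eventually)
      fix x
      show "\<forall>\<^sub>F n in sequentially. h n x = 0"
      proof (cases "x \<in> U")
        case True
        then obtain d where d: "d > 0" "ball x d \<subseteq> U" using U open_contains_ball by blast
        have "\<forall>\<^sub>F n in sequentially. radius n < d"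
          using radius_tendsto d(1) by (rule order_tendstoD)
        then show ?thesis
        proof eventually_elim
          case (elim n)
          have "mollifier (radius n) (x - y) *\<^sub>R ?u y = mollifier (radius n) (x - y)" for y
          proof (cases "y \<in> U")
            case False
            then have "d \<le> norm (x - y)" using d by (auto simp: subset_iff dist_norm not_less[symmetric])
            then show ?thesis using elim by (simp add: mollifier_eq_0 radius_pos)
          qed simp
          then have "g n x = (\<integral>y. mollifier (radius n) (x - y) \<partial>lborel)"
            unfolding g_def conv_def by (rule Bochner_Integration.integral_cong[OF refl])
          then have "g n x = 1" by (simp add: integral_mollifier radius_pos)
          then show ?case using True by (simp add: h_def)
        qed
      qed (simp add: h_def g_nonneg)
    qed
    show "AE x in lborel. norm (h n x) \<le> ?u x" for n
      using g_nonneg[of n] by (auto simp: h_def indicator_def max_def)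
  qed (use u_int in \<open>auto simp: h_def[abs_def]\<close>)
  have err: "conv_error n ?u = ennreal (2 * (\<integral>x. h n x \<partial>lborel))" for n
  proof -
    have "conv_error n ?u = (\<integral>\<^sup>+x. ennreal (norm (g n x - ?u x)) \<partial>lborel)"
      by (simp add: conv_error_def g_def)
    also have "\<dots> = ennreal (\<integral>x. norm (g n x - ?u x) \<partial>lborel)"
      using g_int u_int by (intro nn_integral_eq_integral) auto
    also have "(\<integral>x. norm (g n x - ?u x) \<partial>lborel) = (\<integral>x. (g n x - ?u x) + 2 * h n x \<partial>lborel)"
      by (intro Bochner_Integration.integral_cong) (auto simp: h_def max_def)
    also have "\<dots> = 2 * (\<integral>x. h n x \<partial>lborel)"
      using g_int u_int h_int by (subst Bochner_Integration.integral_add) (auto simp: g_eq simp del: Bochner_Integration.integral_indicator)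
    finally show ?thesis .
  qed
  show ?thesis
    unfolding conv_approx_def err
  proof (intro allI impI)
    fix e :: real assume "e > 0"
    then have "\<forall>\<^sub>F n in sequentially. (\<integral>x. h n x \<partial>lborel) < e / 2"
      using h_lim by (intro order_tendstoD(2)) auto
    then show "\<forall>\<^sub>F n in sequentially. ennreal (2 * (\<integral>x. h n x \<partial>lborel)) \<le> ennreal e"
      by eventually_elim (auto intro!: ennreal_leI)
  qed
qed

lemma conv_approx_indicator:
  fixes A :: "(real^4) set"
  assumes A: "A \<in> sets borel" and fin: "emeasure lborel A < \<infinity>"
  shows "conv_approx (indicator A :: real^4 \<Rightarrow> real)"
proof (rule conv_approx_closure)
  show "integrable lborel (indicator A :: real^4 \<Rightarrow> real)" using A fin by simp
  fix e :: real assume e: "e > 0"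
  obtain U where U: "open U" "A \<subseteq> U" "emeasure lborel (U - A) < ennreal e"
    using outer_regular_lborel[OF A e] by blast
  have U_fin: "emeasure lborel U < \<infinity>"
  proof -
    have "emeasure lborel U = emeasure lborel A + emeasure lborel (U - A)"
      using U(1,2) A by (subst plus_emeasure) (auto simp: Un_absorb1)
    also have "\<dots> < \<infinity>" using fin U(3) by (auto simp: less_top dest: less_trans[OF _ ennreal_less_top])
    finally show ?thesis .
  qed
  have "(\<integral>\<^sup>+x. ennreal (norm (indicator A x - indicator U x :: real)) \<partial>lborel) = (\<integral>\<^sup>+x. indicator (U - A) x \<partial>lborel)"
    using U(2) by (intro nn_integral_cong) (auto simp: indicator_def)
  also have "\<dots> \<le> ennreal e" using U A by (subst nn_integral_indicator) (auto intro: less_imp_le)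
  finally show "\<exists>v :: real^4 \<Rightarrow> real. integrable lborel v \<and> conv_approx v \<and>
      (\<integral>\<^sup>+x. ennreal (norm (indicator A x - v x)) \<partial>lborel) \<le> ennreal e"
    using conv_approx_open[OF U(1) U_fin] U(1) U_fin by (intro exI[of _ "indicator U"]) auto
qed

lemma conv_approx_integrable:
  fixes u :: "real^4 \<Rightarrow> 'b::{banach, second_countable_topology}"
  assumes "integrable lborel u"
  shows "conv_approx u"
  using assms
proof (induction rule: integrable_induct)
  case (base A c)
  then have A: "conv_approx (indicator A :: real^4 \<Rightarrow> real)" by (intro conv_approx_indicator) auto
  have i: "integrable lborel (indicator A :: real^4 \<Rightarrow> real)" using base by simp
  have "conv_error n (\<lambda>x. indicator A x *\<^sub>R c) = ennreal (norm c) * conv_error n (indicator A :: real^4 \<Rightarrow> real)" for n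
  proof -
    have "conv (radius n) (\<lambda>x. indicator A x *\<^sub>R c) x = conv (radius n) (indicator A :: real^4 \<Rightarrow> real) x *\<^sub>R c" for x
      unfolding conv_def using integrable_conv_kernel[OF integrable_imp_loc_int[OF i] radius_pos, of n x]
      by (subst integral_scaleR_left[symmetric]) auto
    then have "norm (conv (radius n) (\<lambda>x. indicator A x *\<^sub>R c) x - indicator A x *\<^sub>R c) =
       norm c * norm (conv (radius n) (indicator A :: real^4 \<Rightarrow> real) x - indicator A x)" for x
      by (simp flip: scaleR_diff_left)
    moreover have [measurable]: "A \<in> sets borel" using base by simp
    ultimately show ?thesis
      unfolding conv_error_def by (simp add: ennreal_mult nn_integral_cmult)
  qed
  then show ?case
    unfolding conv_approx_def
  proof (intro allI impI)
    fix e :: real assume e: "e > 0"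
    \<comment> \<open>The added 1 keeps the quotient defined when \<open>c = 0\<close>.\<close>
    then have "\<forall>\<^sub>F n in sequentially. conv_error n (indicator A :: real^4 \<Rightarrow> real) \<le> ennreal (e / (norm c + 1))"
      using A unfolding conv_approx_def by (auto simp: add_nonneg_pos)
    then show "\<forall>\<^sub>F n in sequentially. conv_error n (\<lambda>x. indicator A x *\<^sub>R c) \<le> ennreal e"
    proof eventually_elim
      case (elim n)
      have "ennreal (norm c) * conv_error n (indicator A :: real^4 \<Rightarrow> real) \<le> ennreal (norm c) * ennreal (e / (norm c + 1))"
        using elim by (intro mult_left_mono) auto
      also have "\<dots> = ennreal (norm c * (e / (norm c + 1)))" using e by (intro ennreal_mult'[symmetric]) auto
      also have "\<dots> \<le> ennreal e"
        using e by (intro ennreal_leI) (simp add: divide_le_eq add_nonneg_pos mult.commute)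
      finally show ?case
        using \<open>\<And>n. conv_error n (\<lambda>x. indicator A x *\<^sub>R c) = _ n\<close> by simp
    qed
  qed
next
  case (add f g)
  then show ?case by (intro conv_approx_add)
next
  case (lim f s)
  have s_lim: "(\<lambda>i. s i x) \<longlonglongrightarrow> f x" and s_bound: "norm (s i x) \<le> 2 * norm (f x)" for i x
    using lim by auto
  have "(\<lambda>i. \<integral>x. norm (f x - s i x) \<partial>lborel) \<longlonglongrightarrow> (\<integral>x. (0::real) \<partial>(lborel :: (real^4) measure))"
  proof (rule integral_dominated_convergence[where w = "\<lambda>x. 3 * norm (f x)"])
    show "AE x in lborel. (\<lambda>i. norm (f x - s i x)) \<longlonglongrightarrow> 0"
    proof (rule AE_I2)
      fix x
      show "(\<lambda>i. norm (f x - s i x)) \<longlonglongrightarrow> 0"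
        using tendsto_norm[OF tendsto_diff[OF tendsto_const[of "f x"] s_lim[of x]]] by simp
    qed
    show "AE x in lborel. norm (norm (f x - s i x)) \<le> 3 * norm (f x)" for i
    proof (rule AE_I2)
      fix x
      show "norm (norm (f x - s i x)) \<le> 3 * norm (f x)"
        using norm_triangle_ineq4[of "f x" "s i x"] s_bound[of i x] by simp
    qed
  qed (use lim in auto)
  then have l: "(\<lambda>i. \<integral>x. norm (f x - s i x) \<partial>lborel) \<longlonglongrightarrow> 0" by simp
  show ?case
  proof (rule conv_approx_closure)
    fix e :: real assume "e > 0"
    then have "\<forall>\<^sub>F i in sequentially. (\<integral>x. norm (f x - s i x) \<partial>lborel) < e"
      using l by (intro order_tendstoD(2)) auto
    then obtain i where i: "(\<integral>x. norm (f x - s i x) \<partial>lborel) < e"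
      by (auto simp: eventually_sequentially)
    have "(\<integral>\<^sup>+x. ennreal (norm (f x - s i x)) \<partial>lborel) = ennreal (\<integral>x. norm (f x - s i x) \<partial>lborel)"
      using lim by (intro nn_integral_eq_integral) auto
    also have "\<dots> \<le> ennreal e" using i by (intro ennreal_leI) simp
    finally show "\<exists>v. integrable lborel v \<and> conv_approx v \<and> (\<integral>\<^sup>+x. ennreal (norm (f x - v x)) \<partial>lborel) \<le> ennreal e"
      using lim by blast
  qed (use lim in auto)
qed

lemma conv_cong_ball:
  assumes "\<And>y. norm (x - y) < r \<Longrightarrow> f y = g y" "r > 0"
  shows "conv r f x = conv r g x"
  unfolding conv_def
proof (intro Bochner_Integration.integral_cong refl)
  fix y
  show "mollifier r (x - y) *\<^sub>R f y = mollifier r (x - y) *\<^sub>R g y"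
    using assms mollifier_eq_0[of r "x - y"] by (cases "norm (x - y) < r") auto
qed

text \<open>The radii are at most 1, so on the ball of radius \<open>R\<close> the mollification
  only sees \<open>f\<close> on radius \<open>R + 1\<close>, where it can be cut off to an
  integrable function.\<close>

lemma conv_approx_on_ball:
  fixes f :: "real^4 \<Rightarrow> 'b::{banach, second_countable_topology}"
  assumes f: "loc_int f" and e: "e > 0"
  shows "\<forall>\<^sub>F n in sequentially.
    (\<integral>\<^sup>+x. ennreal (norm (conv (radius n) f x - f x)) * indicator (cball 0 R) x \<partial>lborel) \<le> ennreal e"
proof -
  define u where "u x = indicator (cball 0 (R + 1)) x *\<^sub>R f x" for x
  have "conv_approx u" using f unfolding u_def loc_int_def by (intro conv_approx_integrable) simp
  then have "\<forall>\<^sub>F n in sequentially. conv_error n u \<le> ennreal e"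
    using e by (simp add: conv_approx_def)
  then show ?thesis
  proof eventually_elim
    case (elim n)
    have r1: "radius n \<le> 1" by (simp add: radius_def inverse_le_1_iff)
    have "ennreal (norm (conv (radius n) f x - f x)) * indicator (cball 0 R) x \<le> ennreal (norm (conv (radius n) u x - u x))" for x
    proof (cases "norm x \<le> R")
      case True
      have "conv (radius n) f x = conv (radius n) u x"
      proof (rule conv_cong_ball[OF _ radius_pos])
        fix y assume "norm (x - y) < radius n"
        then have "norm y \<le> R + 1" using r1 True norm_triangle_sub[of y x] by (simp add: norm_minus_commute)
        then show "f y = u y" by (simp add: u_def)
      qed
      then show ?thesis using True by (simp add: u_def)
    qed simp
    then have "(\<integral>\<^sup>+x. ennreal (norm (conv (radius n) f x - f x)) * indicator (cball 0 R) x \<partial>lborel) \<le> conv_error n u"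
      unfolding conv_error_def by (intro nn_integral_mono)
    then show ?case using elim by simp
  qed
qed

text \<open>The reflected and translated mollifiers are test functions, so every mollification of
  \<open>f\<close> vanishes identically; on each ball they converge to \<open>f\<close> in
  mean.\<close>

lemma test_functions_separate:
  fixes f :: "real^4 \<Rightarrow> complex"
  assumes f: "loc_int f" and zero: "\<And>\<eta>. test_function \<eta> \<Longrightarrow> (\<integral>x. \<eta> x *\<^sub>R f x \<partial>lborel) = 0"
  shows "AE x in lborel. f x = 0"
proof -
  have [measurable]: "f \<in> borel_measurable borel" using f by (simp add: loc_int_def)
  have conv0: "conv r f x = 0" if "r > 0" for r x
    unfolding conv_def using zero[OF test_function_mollifier[OF that]] .
  have "AE x in lborel. x \<in> cball 0 (real R) \<longrightarrow> f x = 0" for R :: nat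
  proof -
    let ?I = "\<integral>\<^sup>+x. ennreal (norm (f x)) * indicator (cball 0 (real R)) x \<partial>lborel"
    have le: "?I \<le> ennreal e" if "e > 0" for e
      using conv_approx_on_ball[OF f that, of "real R"] by (simp add: conv0 radius_pos)
    have "?I \<le> 0"
    proof (rule ennreal_le_epsilon)
      fix e :: real assume "0 < e"
      from le[OF this] show "?I \<le> 0 + ennreal e" by simp
    qed
    then have "?I = 0" by simp
    have cb: "cball (0 :: real^4) (real R) \<in> sets lborel" by simp
    have "(\<lambda>x. ennreal (norm (f x)) * indicator (cball 0 (real R)) x) \<in> borel_measurable lborel"
      by (intro borel_measurable_times_ennreal borel_measurable_indicator cb) simp
    from nn_integral_0_iff_AE[OF this, THEN iffD1, OF \<open>?I = 0\<close>]
    have "AE x in lborel. ennreal (norm (f x)) * indicator (cball 0 (real R)) x = 0" .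
    then show ?thesis
    proof eventually_elim
      case (elim x)
      show ?case
      proof
        assume "x \<in> cball 0 (real R)"
        then show "f x = 0" using elim by (simp add: ennreal_eq_0_iff)
      qed
    qed
  qed
  then have "AE x in lborel. \<forall>R::nat. x \<in> cball 0 (real R) \<longrightarrow> f x = 0"
    unfolding AE_all_countable by blast
  then show ?thesis
  proof eventually_elim
    case (elim x)
    have "x \<in> cball 0 (real (nat \<lceil>norm x\<rceil>))" using real_nat_ceiling_ge[of "norm x"] by simp
    then show ?case using elim by blast
  qed
qed

section \<open>Uniqueness of weak gradients\<close>

lemma test_function_continuous:
  assumes "test_function \<eta>"
  shows "continuous_on UNIV \<eta>" "continuous_on UNIV (partial i \<eta>)"
proof -
  have "smooth \<eta>" using assms by (simp add: test_function_def)
  then have "foldr partial [] \<eta> differentiable_on UNIV" "foldr partial [i] \<eta> differentiable_on UNIV"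
    unfolding smooth_def by blast+
  then show "continuous_on UNIV \<eta>" "continuous_on UNIV (partial i \<eta>)"
    by (simp_all add: differentiable_imp_continuous_on)
qed

lemma test_function_measurable:
  assumes "test_function \<eta>"
  shows "\<eta> \<in> borel_measurable borel" "partial i \<eta> \<in> borel_measurable borel"
  using test_function_continuous[OF assms] by (auto intro: borel_measurable_continuous_onI)

lemma test_function_bound:
  assumes "test_function \<eta>"
  shows "\<exists>R. \<forall>x. R < norm x \<longrightarrow> \<eta> x = 0"
proof -
  have "bounded (closure {x. \<eta> x \<noteq> 0})" using assms by (auto simp: test_function_def intro: compact_imp_bounded)
  then obtain R where R: "\<forall>x\<in>closure {x. \<eta> x \<noteq> 0}. norm x \<le> R"
    unfolding bounded_iff by blast
  have "\<eta> x = 0" if "R < norm x" for x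
  proof -
    have "x \<notin> closure {x. \<eta> x \<noteq> 0}" using R that by (meson not_le)
    then show ?thesis using closure_subset[of "{x. \<eta> x \<noteq> 0}"] by blast
  qed
  then show ?thesis by blast
qed

lemma integrable_test_function:
  assumes \<eta>: "test_function \<eta>" and f: "loc_int f"
  shows "integrable lborel (\<lambda>x. \<eta> x *\<^sub>R f x)"
proof -
  obtain R where R: "\<forall>x. R < norm x \<longrightarrow> \<eta> x = 0"
    using test_function_bound[OF \<eta>] by blast
  have "compact (\<eta> ` cball 0 R)"
    by (intro compact_continuous_image continuous_on_subset[OF test_function_continuous(1)[OF \<eta>]]) auto
  then have "bounded (\<eta> ` cball 0 R)" by (rule compact_imp_bounded)
  then obtain C where "\<forall>y\<in>\<eta> ` cball 0 R. norm y \<le> C" unfolding bounded_iff by blast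
  then have C: "\<And>x. norm x \<le> R \<Longrightarrow> \<bar>\<eta> x\<bar> \<le> C" by simp
  have bound: "\<bar>\<eta> y\<bar> \<le> C * indicator (cball 0 R) y" for y
    using R C[of y] by (cases "norm y \<le> R") simp_all
  show ?thesis
    by (rule integral_kernel(1)[OF f test_function_measurable(1)[OF \<eta>] bound tendsto_const])
qed

section \<open>Borel representatives of Lebesgue measurable functions\<close>

lemma locally_integrable_measurable:
  assumes "locally_integrable f" shows "f \<in> borel_measurable lebesgue"
proof (rule borel_measurable_LIMSEQ_metric)
  show "(\<lambda>x. indicator (cball 0 (real n)) x *\<^sub>R f x) \<in> borel_measurable lebesgue" for n
    using assms unfolding locally_integrable_def set_integrable_def
    by (intro borel_measurable_integrable) auto
  fix x
  show "(\<lambda>n. indicator (cball 0 (real n)) x *\<^sub>R f x) \<longlonglongrightarrow> f x"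
  proof (rule tendsto_eventually, rule eventually_sequentiallyI[of "nat \<lceil>norm x\<rceil>"])
    fix n assume "nat \<lceil>norm x\<rceil> \<le> n"
    then have "x \<in> cball 0 (real n)" by (simp add: ceiling_le_iff nat_le_iff)
    then show "indicator (cball 0 (real n)) x *\<^sub>R f x = f x" by simp
  qed
qed

lemma borel_representative:
  fixes f :: "real^4 \<Rightarrow> complex"
  assumes f: "f \<in> borel_measurable lebesgue"
  shows "\<exists>f'\<in>borel_measurable borel. AE x in lborel. f x = f' x"
proof -
  have re: "(\<lambda>x. Re (f x)) \<in> borel_measurable lebesgue" and im: "(\<lambda>x. Im (f x)) \<in> borel_measurable lebesgue"
    using f by simp_all
  from completion_ex_borel_measurable_real[OF re] obtain a where
    a: "a \<in> borel_measurable lborel" "AE x in lborel. Re (f x) = a x" by (rule bexE)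
  from completion_ex_borel_measurable_real[OF im] obtain b where
    b: "b \<in> borel_measurable lborel" "AE x in lborel. Im (f x) = b x" by (rule bexE)
  show ?thesis
  proof (rule bexI)
    show "AE x in lborel. f x = Complex (a x) (b x)"
      using a(2) b(2) by eventually_elim (simp add: complex_eq_iff)
    show "(\<lambda>x. Complex (a x) (b x)) \<in> borel_measurable borel"
      using a(1) b(1) by (simp add: borel_measurable_complex_iff)
  qed
qed

text \<open>Weak gradients are defined with the completed measure, whereas Tonelli's theorem and the
  convolution estimates are used for Borel functions and \<open>lborel\<close>. Changing the
  function on a null set connects the two.\<close>

lemma locally_integrable_representative:
  assumes f: "locally_integrable f"
  shows "\<exists>f'. loc_int f' \<and> (AE x in lborel. f x = f' x)"
proof -
  note meas = locally_integrable_measurable[OF f]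
  obtain f' where [measurable]: "f' \<in> borel_measurable borel" and eq: "AE x in lborel. f x = f' x"
    using borel_representative[OF meas] by (rule bexE)
  have "integrable lborel (\<lambda>x. indicator (cball 0 R) x *\<^sub>R f' x)" for R
  proof -
    have m: "(\<lambda>x. indicator (cball 0 R) x *\<^sub>R f' x) \<in> borel_measurable lborel"
      by (intro borel_measurable_scaleR borel_measurable_indicator) simp_all
    have "integrable lebesgue (\<lambda>x. indicator (cball 0 R) x *\<^sub>R f x)"
      using f unfolding locally_integrable_def set_integrable_def by auto
    moreover have "(\<lambda>x. indicator (cball 0 R) x *\<^sub>R f' x) \<in> borel_measurable lebesgue"
      by (rule measurable_completion[OF m])
    moreover have "AE x in lebesgue. indicator (cball 0 R) x *\<^sub>R f x = indicator (cball 0 R) x *\<^sub>R f' x"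
      using AE_completion[OF eq] by eventually_elim simp
    ultimately have "integrable lebesgue (\<lambda>x. indicator (cball 0 R) x *\<^sub>R f' x)"
      by (rule integrable_cong_AE_imp)
    then show ?thesis by (subst (asm) integrable_completion[OF m])
  qed
  then have "loc_int f'" by (simp add: loc_int_def)
  with eq show ?thesis by (intro exI conjI)
qed

lemma weak_gradient_representative:
  assumes "has_weak_gradient \<phi> G"
  shows "\<exists>\<phi>' G'. loc_int \<phi>' \<and> (AE x in lborel. \<phi> x = \<phi>' x) \<and>
    (\<forall>i. loc_int (G' i) \<and> (AE x in lborel. G x $ i = G' i x)) \<and>
    (\<forall>\<eta> i. test_function \<eta> \<longrightarrow> (\<integral>x. partial i \<eta> x *\<^sub>R \<phi>' x \<partial>lborel) = - (\<integral>x. \<eta> x *\<^sub>R G' i x \<partial>lborel))"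
proof -
  have li: "locally_integrable \<phi>" "\<And>i. locally_integrable (\<lambda>x. G x $ i)"
    using assms by (auto simp: has_weak_gradient_def)
  obtain \<phi>' where \<phi>': "loc_int \<phi>'" "AE x in lborel. \<phi> x = \<phi>' x"
    using locally_integrable_representative[OF li(1)] by blast
  have "\<forall>i. \<exists>g. loc_int g \<and> (AE x in lborel. G x $ i = g x)"
    using locally_integrable_representative[OF li(2)] by blast
  then obtain G' where G': "\<And>i. loc_int (G' i)" "\<And>i. AE x in lborel. G x $ i = G' i x"
    by metis
  have conv: "(\<integral>x. k x *\<^sub>R f x \<partial>lebesgue) = (\<integral>x. k x *\<^sub>R f' x \<partial>lborel)"
    if k[measurable]: "k \<in> borel_measurable borel" and f: "locally_integrable f" and f': "loc_int f'" and eq: "AE x in lborel. f x = f' x"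
    for k and f f' :: "real^4 \<Rightarrow> complex"
  proof -
    have m: "(\<lambda>x. k x *\<^sub>R f' x) \<in> borel_measurable lborel" using f' by (auto simp: loc_int_def)
    have km: "k \<in> borel_measurable lebesgue" by (rule measurable_completion) simp
    have "(\<integral>x. k x *\<^sub>R f x \<partial>lebesgue) = (\<integral>x. k x *\<^sub>R f' x \<partial>lebesgue)"
    proof (rule integral_cong_AE)
      show "(\<lambda>x. k x *\<^sub>R f x) \<in> borel_measurable lebesgue"
        using km locally_integrable_measurable[OF f] by (rule borel_measurable_scaleR)
      show "(\<lambda>x. k x *\<^sub>R f' x) \<in> borel_measurable lebesgue"
        using m by (rule measurable_completion)
      show "AE x in lebesgue. k x *\<^sub>R f x = k x *\<^sub>R f' x"
        using AE_completion[OF eq] by eventually_elim simp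
    qed
    then show ?thesis using integral_completion[OF m] by simp
  qed
  have "(\<integral>x. partial i \<eta> x *\<^sub>R \<phi>' x \<partial>lborel) = - (\<integral>x. \<eta> x *\<^sub>R G' i x \<partial>lborel)" if \<eta>: "test_function \<eta>" for \<eta> i
  proof -
    have "(\<integral>x. partial i \<eta> x *\<^sub>R \<phi> x \<partial>lebesgue) = - (\<integral>x. \<eta> x *\<^sub>R G x $ i \<partial>lebesgue)"
      using assms \<eta> unfolding has_weak_gradient_def by blast
    moreover note conv[OF test_function_measurable(2)[OF \<eta>, of i] li(1) \<phi>']
      conv[OF test_function_measurable(1)[OF \<eta>] li(2)[of i] G'(1)[of i] G'(2)[of i]]
    ultimately show ?thesis by simp
  qed
  then show ?thesis using \<phi>' G' by blast
qed

text \<open>Component by component, the difference of two weak gradients integrates to zero against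
  every test function; the exceptional null sets of the four components are then united.\<close>

lemma weak_gradient_unique:
  assumes G: "has_weak_gradient \<phi> G" and H: "has_weak_gradient \<phi> H"
  shows "AE x in lborel. G x = H x"
proof -
  obtain \<phi>1 G' where 1: "loc_int \<phi>1" "AE x in lborel. \<phi> x = \<phi>1 x" "\<And>i. loc_int (G' i)"
    "\<And>i. AE x in lborel. G x $ i = G' i x"
    "\<And>\<eta> i. test_function \<eta> \<Longrightarrow> (\<integral>x. partial i \<eta> x *\<^sub>R \<phi>1 x \<partial>lborel) = - (\<integral>x. \<eta> x *\<^sub>R G' i x \<partial>lborel)"
    using weak_gradient_representative[OF G] by blast
  obtain \<phi>2 H' where 2: "loc_int \<phi>2" "AE x in lborel. \<phi> x = \<phi>2 x" "\<And>i. loc_int (H' i)"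
    "\<And>i. AE x in lborel. H x $ i = H' i x"
    "\<And>\<eta> i. test_function \<eta> \<Longrightarrow> (\<integral>x. partial i \<eta> x *\<^sub>R \<phi>2 x \<partial>lborel) = - (\<integral>x. \<eta> x *\<^sub>R H' i x \<partial>lborel)"
    using weak_gradient_representative[OF H] by blast
  have "AE x in lborel. G x $ i = H x $ i" for i
  proof -
    have "AE x in lborel. G' i x - H' i x = 0"
    proof (rule test_functions_separate)
      show "loc_int (\<lambda>x. G' i x - H' i x)"
        using 1(3)[of i] 2(3)[of i] by (auto simp: loc_int_def scaleR_diff_right)
      fix \<eta> assume \<eta>: "test_function \<eta>"
      have "(\<integral>x. partial i \<eta> x *\<^sub>R \<phi>1 x \<partial>lborel) = (\<integral>x. partial i \<eta> x *\<^sub>R \<phi>2 x \<partial>lborel)"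
      proof (rule integral_cong_AE)
        show "AE x in lborel. partial i \<eta> x *\<^sub>R \<phi>1 x = partial i \<eta> x *\<^sub>R \<phi>2 x"
          using 1(2) 2(2) by eventually_elim simp
      qed (use 1(1) 2(1) test_function_measurable[OF \<eta>] in \<open>auto simp: loc_int_def\<close>)
      then show "(\<integral>x. \<eta> x *\<^sub>R (G' i x - H' i x) \<partial>lborel) = 0"
        using 1(5)[OF \<eta>, of i] 2(5)[OF \<eta>, of i] integrable_test_function[OF \<eta> 1(3)[of i]] integrable_test_function[OF \<eta> 2(3)[of i]]
        by (simp add: scaleR_diff_right)
    qed
    then show ?thesis using 1(4)[of i] 2(4)[of i] by eventually_elim simp
  qed
  then have "AE x in lborel. \<forall>i. G x $ i = H x $ i"
    unfolding AE_all_countable by blast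
  then show ?thesis by eventually_elim (simp add: vec_eq_iff)
qed

section \<open>The Sobolev inequality for weakly differentiable functions\<close>

lemma max_0_square_deriv: "((\<lambda>s::real. (max 0 s)\<^sup>2) has_real_derivative 2 * max 0 s) (at s)"
proof (cases s "0::real" rule: linorder_cases)
  case greater
  have "((\<lambda>s::real. s\<^sup>2) has_real_derivative 2 * max 0 s) (at s)"
    using greater by (auto intro!: derivative_eq_intros)
  then show ?thesis
    by (rule has_field_derivative_transform_within_open[of _ _ _ "{0<..}"]) (use greater in auto)
next
  case less
  have "((\<lambda>s::real. 0) has_real_derivative 2 * max 0 s) (at s)"
    using less by simp
  then show ?thesis
    by (rule has_field_derivative_transform_within_open[of _ _ _ "{..<0}"]) (use less in auto)
next
  case equal
  have eq: "((max 0 h)\<^sup>2 - (max 0 0)\<^sup>2) / (h - 0) = max 0 h" for h :: real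
    by (simp add: max_def power2_eq_square)
  have "((\<lambda>h::real. max 0 h) \<longlongrightarrow> max 0 0) (at 0)"
    by (intro tendsto_intros)
  then show ?thesis
    using equal unfolding has_field_derivative_iff by (simp only: eq) simp
qed

text \<open>The square of a positive part is continuously differentiable, which is the regularity
  that \<open>sobolev_C1\<close> asks for, and its gradient is explicit and of order
  \<open>1 / N\<close>.\<close>

definition cutoff :: "real \<Rightarrow> real^4 \<Rightarrow> real" where
  "cutoff N x = (max 0 (1 - norm x ^ 2 / N\<^sup>2))\<^sup>2"

definition cutoff_grad :: "real \<Rightarrow> 4 \<Rightarrow> real^4 \<Rightarrow> real" where
  "cutoff_grad N i x = 2 * max 0 (1 - norm x ^ 2 / N\<^sup>2) * (- 2 * (x $ i) / N\<^sup>2)"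

lemma cutoff_line_deriv:
  "((\<lambda>t. cutoff N (x + t *\<^sub>R axis i 1)) has_real_derivative cutoff_grad N i x) (at 0)"
proof -
  have norm_line: "norm (x + t *\<^sub>R axis i 1) ^ 2 = norm x ^ 2 + 2 * (t * (x $ i)) + t ^ 2" for t
    by (simp add: norm_add_squared inner_axis power_mult_distrib)
  have "((\<lambda>t. norm x ^ 2 + 2 * (t * (x $ i)) + t ^ 2) has_real_derivative 2 * (x $ i)) (at 0)"
    by (auto intro!: derivative_eq_intros)
  from DERIV_chain2[OF max_0_square_deriv DERIV_diff[OF DERIV_const DERIV_cdivide[OF this]], of 1 "N\<^sup>2"]
  show ?thesis unfolding cutoff_def cutoff_grad_def norm_line by simp
qed

lemma continuous_on_cutoff: "continuous_on S (cutoff N)" "continuous_on S (cutoff_grad N i)"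
  unfolding cutoff_def[abs_def] cutoff_grad_def[abs_def] divide_inverse by (intro continuous_intros)+

lemma cutoff_bounds: "0 \<le> cutoff N x" "cutoff N x \<le> 1"
proof -
  have "max 0 (1 - norm x ^ 2 / N\<^sup>2) \<le> 1" by simp
  then show "cutoff N x \<le> 1" unfolding cutoff_def by (intro power_le_one) auto
qed (simp add: cutoff_def)

lemma cutoff_eq_0:
  assumes "N > 0" "N \<le> norm x" shows "cutoff N x = 0" "cutoff_grad N i x = 0"
proof -
  have "N\<^sup>2 \<le> norm x ^ 2" using assms by (intro power_mono) auto
  then have "1 - norm x ^ 2 / N\<^sup>2 \<le> 0" using assms by (simp add: divide_simps)
  then show "cutoff N x = 0" "cutoff_grad N i x = 0" by (simp_all add: cutoff_def cutoff_grad_def)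
qed

lemma sum_cutoff_grad_sq:
  assumes N: "N > 0"
  shows "(\<Sum>i\<in>UNIV. (cutoff_grad N i x)\<^sup>2) \<le> 16 / N\<^sup>2"
proof (cases "norm x < N")
  case True
  let ?m = "max 0 (1 - norm x ^ 2 / N\<^sup>2)"
  have "(\<Sum>i\<in>UNIV. (cutoff_grad N i x)\<^sup>2) = 16 * (?m\<^sup>2 * ((\<Sum>i\<in>UNIV. (x $ i)\<^sup>2) / N ^ 4))"
    by (simp add: cutoff_grad_def power_mult_distrib power_divide sum_distrib_left sum_divide_distrib flip: power_mult)
  also have "(\<Sum>i\<in>UNIV. (x $ i)\<^sup>2) = norm x ^ 2"
    by (simp add: norm_vec_def L2_set_def sum_nonneg)
  also have "?m\<^sup>2 * (norm x ^ 2 / N ^ 4) \<le> 1 * (N ^ 2 / N ^ 4)"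
    using True N by (intro mult_mono power_le_one divide_right_mono power_mono) auto
  also have "1 * (N ^ 2 / N ^ 4) = 1 / N\<^sup>2"
    using N by (simp add: power2_eq_square power4_eq_xxxx)
  finally show ?thesis by simp
next
  case False
  then show ?thesis using N by (simp add: cutoff_eq_0)
qed

lemma cutoff_tendsto: "(\<lambda>n. cutoff (real (Suc n)) x) \<longlonglongrightarrow> 1"
proof -
  have "(\<lambda>n. (max 0 (1 - norm x ^ 2 * (inverse (real (Suc n)))\<^sup>2))\<^sup>2) \<longlonglongrightarrow> (max 0 (1 - norm x ^ 2 * 0\<^sup>2))\<^sup>2"
    by (intro tendsto_intros LIMSEQ_inverse_real_of_nat)
  then show ?thesis by (simp add: cutoff_def divide_inverse power_inverse)
qed

text \<open>A smooth nonnegative substitute for the modulus. It vanishes at 0, so compact support is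
  preserved, and its gradient has norm at most 1, so passing from a complex function to a real one
  does not increase the Dirichlet integral.\<close>

definition soft_abs :: "real \<Rightarrow> complex \<Rightarrow> real" where
  "soft_abs \<epsilon> z = sqrt (\<epsilon>\<^sup>2 + norm z ^ 2) - \<epsilon>"

text \<open>Young's inequality with a free weight. For \<open>d\<close> tending to 0 the second
  term, which will hold the gradient, keeps a factor tending to 1, as the sharp constant requires;
  the large factor falls on the cutoff error.\<close>

lemma norm_add_sq_le:
  fixes a b :: "'b::real_normed_vector"
  assumes d: "d > 0"
  shows "norm (a + b) ^ 2 \<le> (1 + 1 / d) * norm a ^ 2 + (1 + d) * norm b ^ 2"
proof -
  have "norm (a + b) ^ 2 \<le> (norm a + norm b) ^ 2" by (intro power_mono norm_triangle_ineq) simp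
  also have "\<dots> \<le> (1 + 1 / d) * norm a ^ 2 + (1 + d) * norm b ^ 2"
  proof -
    have "0 \<le> (norm a - d * norm b) ^ 2 / d" using d by simp
    also have "\<dots> = norm a ^ 2 / d - 2 * norm a * norm b + d * norm b ^ 2"
      using d by (simp add: power2_eq_square field_simps)
    finally show ?thesis by (simp add: power2_eq_square algebra_simps)
  qed
  finally show ?thesis .
qed

definition regularize :: "nat \<Rightarrow> (real^4 \<Rightarrow> complex) \<Rightarrow> real^4 \<Rightarrow> real" where
  "regularize n \<phi> x = soft_abs (radius n) (cutoff (real (Suc n)) x *\<^sub>R conv (radius n) \<phi> x)"

locale weakly_differentiable =
  fixes \<phi> :: "real^4 \<Rightarrow> complex" and G :: "4 \<Rightarrow> real^4 \<Rightarrow> complex"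
  assumes \<phi>: "loc_int \<phi>" and G: "\<And>i. loc_int (G i)"
    and weak: "\<And>\<eta> i. test_function \<eta> \<Longrightarrow> (\<integral>x. partial i \<eta> x *\<^sub>R \<phi> x \<partial>lborel) = - (\<integral>x. \<eta> x *\<^sub>R G i x \<partial>lborel)"
begin

text \<open>The derivative of the convolution falls on the mollifier, and the weak formulation moves
  it to \<open>\<phi>\<close>. Its minus sign cancels the one from differentiating
  \<open>mollifier r (x - y)\<close> in \<open>y\<close>.\<close>

lemma conv_partial:
  assumes r: "r > 0"
  shows "((\<lambda>t. conv r \<phi> (x + t *\<^sub>R axis i 1)) has_vector_derivative conv r (G i) x) (at 0)"
proof -
  have "(\<integral>y. mollifier_deriv r (axis i 1) (x - y) *\<^sub>R \<phi> y \<partial>lborel) = conv r (G i) x"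
    using weak[OF test_function_mollifier[OF r], of i x] unfolding partial_mollifier conv_def by simp
  with conv_line_deriv[OF \<phi> r, of x "axis i 1"] show ?thesis by simp
qed

definition D\<psi> where
  "D\<psi> n i x = cutoff_grad (real (Suc n)) i x *\<^sub>R conv (radius n) \<phi> x + cutoff (real (Suc n)) x *\<^sub>R conv (radius n) (G i) x"

text \<open>Chain rule for the regularised modulus of the cut off mollification: the real inner
  product of that complex function with its derivative \<open>D\<psi>\<close>, divided by the square
  root.\<close>

definition Dreg where
  "Dreg n x = (\<chi> i. ((cutoff (real (Suc n)) x *\<^sub>R conv (radius n) \<phi> x) \<bullet> D\<psi> n i x) /
     sqrt ((radius n)\<^sup>2 + norm (cutoff (real (Suc n)) x *\<^sub>R conv (radius n) \<phi> x) ^ 2))"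

lemma sqrt_pos: "0 < sqrt ((radius n)\<^sup>2 + norm z ^ 2)"
  using radius_pos[of n] by (simp add: add_pos_nonneg)

lemma sqrt_nonzero: "sqrt ((radius n)\<^sup>2 + norm z ^ 2) \<noteq> 0"
  using sqrt_pos[of n z] by (rule less_imp_neq[THEN not_sym])

lemma continuous_regularize: "continuous_on UNIV (regularize n \<phi>)" "continuous_on UNIV (Dreg n)"
proof -
  have c: "continuous_on UNIV (\<lambda>x. cutoff (real (Suc n)) x *\<^sub>R conv (radius n) \<phi> x)"
    by (intro continuous_on_scaleR continuous_on_cutoff continuous_on_conv \<phi> radius_pos)
  show "continuous_on UNIV (regularize n \<phi>)"
    unfolding regularize_def[abs_def] soft_abs_def by (intro continuous_intros c)
  have d: "continuous_on UNIV (D\<psi> n i)" for i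
    unfolding D\<psi>_def[abs_def]
    by (intro continuous_on_scaleR continuous_on_add continuous_on_cutoff continuous_on_conv \<phi> G radius_pos)
  show "continuous_on UNIV (Dreg n)"
    unfolding Dreg_def[abs_def]
    by (intro continuous_on_vec_lambda continuous_on_divide continuous_on_inner c d ballI sqrt_nonzero
        continuous_on_real_sqrt continuous_on_add continuous_on_const continuous_on_power continuous_on_norm)
qed

lemma regularize_deriv:
  "((\<lambda>t. regularize n \<phi> (x + t *\<^sub>R axis i 1)) has_real_derivative Dreg n x $ i) (at 0)"
proof -
  let ?\<psi> = "\<lambda>t. cutoff (real (Suc n)) (x + t *\<^sub>R axis i 1) *\<^sub>R conv (radius n) \<phi> (x + t *\<^sub>R axis i 1)"
  have "(?\<psi> has_vector_derivative cutoff (real (Suc n)) (x + 0 *\<^sub>R axis i 1) *\<^sub>R conv (radius n) (G i) x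
      + cutoff_grad (real (Suc n)) i x *\<^sub>R conv (radius n) \<phi> (x + 0 *\<^sub>R axis i 1)) (at 0)"
    by (rule has_vector_derivative_scaleR[OF cutoff_line_deriv conv_partial[OF radius_pos]])
  then have d: "(?\<psi> has_vector_derivative D\<psi> n i x) (at 0)"
    by (simp add: D\<psi>_def add.commute)
  have "((\<lambda>t. ?\<psi> t \<bullet> ?\<psi> t) has_real_derivative 2 * (?\<psi> 0 \<bullet> D\<psi> n i x)) (at 0)"
    unfolding has_field_derivative_def
    by (rule has_derivative_eq_rhs[OF has_derivative_inner[OF d[unfolded has_vector_derivative_def] d[unfolded has_vector_derivative_def]]])
      (simp add: fun_eq_iff inner_commute)
  from DERIV_add[OF DERIV_const[of "(radius n)\<^sup>2"] this]
  have sq: "((\<lambda>t. (radius n)\<^sup>2 + ?\<psi> t \<bullet> ?\<psi> t) has_real_derivative 2 * (?\<psi> 0 \<bullet> D\<psi> n i x)) (at 0)"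
    unfolding add_0_left .
  have cancel: "inverse (sqrt P) / 2 * (2 * c) = c / sqrt P" for P c :: real
  proof -
    have "inverse (sqrt P) / 2 * (2 * c) = c * inverse (sqrt P)" by simp
    then show ?thesis by (simp only: divide_inverse)
  qed
  have pos: "(radius n)\<^sup>2 + ?\<psi> 0 \<bullet> ?\<psi> 0 > 0"
    by (intro add_pos_nonneg inner_ge_zero zero_less_power radius_pos)
  from DERIV_chain2[OF DERIV_real_sqrt[OF pos] sq]
  have "((\<lambda>t. sqrt ((radius n)\<^sup>2 + ?\<psi> t \<bullet> ?\<psi> t)) has_real_derivative
      (?\<psi> 0 \<bullet> D\<psi> n i x) / sqrt ((radius n)\<^sup>2 + ?\<psi> 0 \<bullet> ?\<psi> 0)) (at 0)"
    by (rule DERIV_cong[OF _ cancel])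
  from DERIV_diff[OF this DERIV_const[of "radius n"]]
  have "((\<lambda>t. sqrt ((radius n)\<^sup>2 + ?\<psi> t \<bullet> ?\<psi> t) - radius n) has_real_derivative
      (?\<psi> 0 \<bullet> D\<psi> n i x) / sqrt ((radius n)\<^sup>2 + ?\<psi> 0 \<bullet> ?\<psi> 0)) (at 0)"
    unfolding diff_0_right .
  then show ?thesis
    unfolding regularize_def soft_abs_def Dreg_def vec_lambda_beta power2_norm_eq_inner scaleR_zero_left add_0_right .
qed

text \<open>The modulus of the cut off function never exceeds the square root in the denominator, so
  each component of \<open>Dreg\<close> is at most \<open>|D\<psi>|\<close>. The two terms of the
  product rule are then separated by the weighted inequality.\<close>

lemma norm_Dreg_le:
  assumes d: "d > 0"
  shows "norm (Dreg n x) ^ 2 \<le> (1 + 1 / d) * (16 / (real (Suc n))\<^sup>2) * norm (conv (radius n) \<phi> x) ^ 2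
    + (1 + d) * (\<Sum>i\<in>UNIV. norm (conv (radius n) (G i) x) ^ 2)"
proof -
  let ?N = "real (Suc n)"
  let ?\<psi> = "cutoff ?N x *\<^sub>R conv (radius n) \<phi> x"
  let ?s = "sqrt ((radius n)\<^sup>2 + norm ?\<psi> ^ 2)"
  have comp: "(Dreg n x $ i)\<^sup>2 \<le> (1 + 1 / d) * (cutoff_grad ?N i x)\<^sup>2 * norm (conv (radius n) \<phi> x) ^ 2
      + (1 + d) * norm (conv (radius n) (G i) x) ^ 2" for i
  proof -
    have "norm ?\<psi> \<le> ?s" by (rule real_le_rsqrt) simp
    have "\<bar>Dreg n x $ i\<bar> = \<bar>?\<psi> \<bullet> D\<psi> n i x\<bar> / ?s"
      by (simp only: Dreg_def vec_lambda_beta abs_divide abs_of_pos[OF sqrt_pos])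
    also have "\<dots> \<le> (norm ?\<psi> * norm (D\<psi> n i x)) / ?s"
      using sqrt_pos[of n ?\<psi>] by (intro divide_right_mono Cauchy_Schwarz_ineq2) auto
    also have "\<dots> \<le> (?s * norm (D\<psi> n i x)) / ?s"
      using sqrt_pos[of n ?\<psi>] \<open>norm ?\<psi> \<le> ?s\<close> by (intro divide_right_mono mult_right_mono) auto
    also have "\<dots> = norm (D\<psi> n i x)" by (rule nonzero_mult_div_cancel_left[OF sqrt_nonzero])
    finally have "(Dreg n x $ i)\<^sup>2 \<le> norm (D\<psi> n i x) ^ 2"
      by (metis abs_le_square_iff abs_norm_cancel)
    also have "\<dots> \<le> (1 + 1 / d) * norm (cutoff_grad ?N i x *\<^sub>R conv (radius n) \<phi> x) ^ 2 + (1 + d) * norm (cutoff ?N x *\<^sub>R conv (radius n) (G i) x) ^ 2"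
      unfolding D\<psi>_def by (rule norm_add_sq_le[OF d])
    also have "norm (cutoff ?N x *\<^sub>R conv (radius n) (G i) x) ^ 2 \<le> norm (conv (radius n) (G i) x) ^ 2"
      using cutoff_bounds[of ?N x] by (intro power_mono) (auto simp: mult_left_le_one_le)
    finally show ?thesis using d by (simp add: power_mult_distrib mult.assoc)
  qed
  have "norm (Dreg n x) ^ 2 = (\<Sum>i\<in>UNIV. (Dreg n x $ i)\<^sup>2)"
    by (simp add: norm_vec_def L2_set_def sum_nonneg)
  also have "\<dots> \<le> (\<Sum>i\<in>UNIV. (1 + 1 / d) * (cutoff_grad ?N i x)\<^sup>2 * norm (conv (radius n) \<phi> x) ^ 2
      + (1 + d) * norm (conv (radius n) (G i) x) ^ 2)"
    by (intro sum_mono comp)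
  also have "\<dots> = (1 + 1 / d) * (\<Sum>i\<in>UNIV. (cutoff_grad ?N i x)\<^sup>2) * norm (conv (radius n) \<phi> x) ^ 2
    + (1 + d) * (\<Sum>i\<in>UNIV. norm (conv (radius n) (G i) x) ^ 2)"
    by (simp add: sum.distrib sum_distrib_left sum_distrib_right)
  also have "\<dots> \<le> (1 + 1 / d) * (16 / ?N\<^sup>2) * norm (conv (radius n) \<phi> x) ^ 2
    + (1 + d) * (\<Sum>i\<in>UNIV. norm (conv (radius n) (G i) x) ^ 2)"
    using d by (intro add_right_mono mult_right_mono mult_left_mono sum_cutoff_grad_sq) auto
  finally show ?thesis .
qed

lemma regularize_support:
  assumes "x \<notin> cube (real (Suc n))" shows "regularize n \<phi> x = 0" "Dreg n x = 0"
proof -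
  obtain b :: "real^4" where "b \<in> Basis" "real (Suc n) < \<bar>x \<bullet> b\<bar>" using assms by (auto simp: cube_def not_le)
  then have le: "real (Suc n) \<le> norm x" using Basis_le_norm[of b x] by simp
  have "cutoff (real (Suc n)) x = 0" using le by (intro cutoff_eq_0) auto
  then show "regularize n \<phi> x = 0" "Dreg n x = 0"
    using radius_pos[of n] by (auto simp: regularize_def soft_abs_def Dreg_def vec_eq_iff)
qed

lemma regularize_nonneg: "0 \<le> regularize n \<phi> x"
  using radius_pos[of n] by (simp add: regularize_def soft_abs_def real_le_rsqrt)

lemma sobolev_regularize:
  "(\<integral>x. regularize n \<phi> x ^ 4 \<partial>lborel) * (\<integral>x. bubble (x::real^4) ^ 4 \<partial>lborel) \<le> (\<integral>x. norm (Dreg n x) ^ 2 \<partial>lborel)\<^sup>2"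
proof (rule sobolev_C1)
  show "DIM(real^4) = 4" by simp
  show "knothe TYPE(real^4)" by (rule knothe_R4)
  fix x b :: "real^4" assume "b \<in> Basis"
  then obtain i where "b = axis i 1" by (auto simp: Basis_vec_def)
  then show "((\<lambda>t. regularize n \<phi> (x + t *\<^sub>R b)) has_real_derivative Dreg n x \<bullet> b) (at 0)"
    using regularize_deriv[of n x i] by (simp add: inner_axis)
qed (use continuous_regularize regularize_support regularize_nonneg in auto)

text \<open>Only the limit of the upper bounds \<open>a n\<close> for the Dirichlet integrals
  matters, so no convergence of the gradients is required: contraction in \<open>L^2\<close> bounds
  the mollified gradients, and Fatou's lemma transfers the inequality to
  \<open>\<phi>\<close>.\<close>

lemma sobolev:
  assumes \<phi>2: "integrable lborel (\<lambda>x. norm (\<phi> x) ^ 2)" and G2: "\<And>i. integrable lborel (\<lambda>x. norm (G i x) ^ 2)"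
  defines "A \<equiv> \<Sum>i\<in>UNIV. (\<integral>x. norm (G i x) ^ 2 \<partial>lborel)"
  defines "S \<equiv> (\<integral>x. bubble (x::real^4) ^ 4 \<partial>lborel)"
  shows "(\<integral>\<^sup>+x. ennreal (norm (\<phi> x) ^ 4) \<partial>lborel) \<le> ennreal (A\<^sup>2 / S)"
proof -
  have [measurable]: "\<phi> \<in> borel_measurable borel" using \<phi> by (simp add: loc_int_def)
  have Gm[measurable]: "G i \<in> borel_measurable borel" for i using G[of i] by (simp add: loc_int_def)
  have S_pos: "S > 0" unfolding S_def by (rule bubble_integrals) simp
  define Q where "Q = (\<integral>x. norm (\<phi> x) ^ 2 \<partial>lborel)"
  have nonneg: "0 \<le> Q" "0 \<le> A"
    unfolding Q_def A_def by (auto intro!: integral_nonneg_AE sum_nonneg)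
  \<comment> \<open>The bound from \<open>norm_Dreg_le\<close> with weight
    \<open>d = 1 / (n + 1)\<close>: the cutoff term then has a coefficient of order
    \<open>1 / n\<close> and the gradient term a coefficient tending to 1.\<close>
  define a where "a n = (1 + real (Suc n)) * (16 / (real (Suc n))\<^sup>2) * Q + (1 + inverse (real (Suc n))) * A" for n
  have a_nonneg: "0 \<le> a n" for n unfolding a_def using nonneg by (intro add_nonneg_nonneg mult_nonneg_nonneg) auto
  have a_lim: "a \<longlonglongrightarrow> A"
  proof -
    have "a = (\<lambda>n. 16 * (inverse (real (Suc n)) * inverse (real (Suc n)) + inverse (real (Suc n))) * Q + (1 + inverse (real (Suc n))) * A)"
    proof -
      have "(1 + N) * (16 / N\<^sup>2) = 16 * (inverse N * inverse N + inverse N)" if "N \<noteq> 0" for N :: real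
        using that by (simp add: power2_eq_square field_simps)
      from this[of "real (Suc _)"] show ?thesis unfolding a_def[abs_def] by simp
    qed
    moreover have "\<dots> \<longlonglongrightarrow> 16 * (0 * 0 + 0) * Q + (1 + 0) * A"
      by (intro tendsto_intros LIMSEQ_inverse_real_of_nat)
    ultimately show ?thesis by simp
  qed
  have L2: "(\<integral>\<^sup>+x. ennreal (norm (conv (radius n) f x) ^ 2) \<partial>lborel) \<le> ennreal (\<integral>x. norm (f x) ^ 2 \<partial>lborel)"
    if f: "integrable lborel (\<lambda>x. norm (f x) ^ 2)" "f \<in> borel_measurable borel" for f :: "real^4 \<Rightarrow> complex" and n
    using conv_L2_contraction[OF radius_pos f(2), of n] f(1) by (simp add: nn_integral_eq_integral)
  have grad: "(\<integral>x. norm (Dreg n x) ^ 2 \<partial>lborel) \<le> a n" for n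
  proof -
    define c1 where "c1 = (1 + real (Suc n)) * (16 / (real (Suc n))\<^sup>2)"
    define c2 where "c2 = 1 + inverse (real (Suc n))"
    have c: "c1 \<ge> 0" "c2 \<ge> 0" by (auto simp: c1_def c2_def intro!: mult_nonneg_nonneg)
    have Dint: "integrable lborel (\<lambda>x. norm (Dreg n x) ^ 2)"
      by (rule integrable_compact_support[where R = "real (Suc n)"])
        (use continuous_regularize(2)[of n] regularize_support in \<open>auto intro!: continuous_intros\<close>)
    have "ennreal (\<integral>x. norm (Dreg n x) ^ 2 \<partial>lborel) = (\<integral>\<^sup>+x. ennreal (norm (Dreg n x) ^ 2) \<partial>lborel)"
      using Dint by (intro nn_integral_eq_integral[symmetric]) auto
    also have "\<dots> \<le> (\<integral>\<^sup>+x. ennreal c1 * ennreal (norm (conv (radius n) \<phi> x) ^ 2) + ennreal c2 * (\<Sum>i\<in>UNIV. ennreal (norm (conv (radius n) (G i) x) ^ 2)) \<partial>lborel)"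
    proof (rule nn_integral_mono)
      fix x
      have "norm (Dreg n x) ^ 2 \<le> c1 * norm (conv (radius n) \<phi> x) ^ 2 + c2 * (\<Sum>i\<in>UNIV. norm (conv (radius n) (G i) x) ^ 2)"
        proof -
        have inv: "1 / inverse (real (Suc n)) = real (Suc n)"
          by (simp only: divide_inverse inverse_inverse_eq mult_1_left)
        have pos: "0 < inverse (real (Suc n))" by simp
        show ?thesis unfolding c1_def c2_def by (rule norm_Dreg_le[OF pos, unfolded inv])
      qed
      then have "ennreal (norm (Dreg n x) ^ 2) \<le> ennreal (c1 * norm (conv (radius n) \<phi> x) ^ 2 + c2 * (\<Sum>i\<in>UNIV. norm (conv (radius n) (G i) x) ^ 2))"
        by (rule ennreal_leI)
      also have "\<dots> = ennreal c1 * ennreal (norm (conv (radius n) \<phi> x) ^ 2) + ennreal c2 * (\<Sum>i\<in>UNIV. ennreal (norm (conv (radius n) (G i) x) ^ 2))"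
        using c by (simp add: ennreal_plus ennreal_mult' sum_nonneg sum_ennreal)
      finally show "ennreal (norm (Dreg n x) ^ 2) \<le> ennreal c1 * ennreal (norm (conv (radius n) \<phi> x) ^ 2) + ennreal c2 * (\<Sum>i\<in>UNIV. ennreal (norm (conv (radius n) (G i) x) ^ 2))" .
    qed
    also have "\<dots> = ennreal c1 * (\<integral>\<^sup>+x. ennreal (norm (conv (radius n) \<phi> x) ^ 2) \<partial>lborel)
        + ennreal c2 * (\<Sum>i\<in>UNIV. (\<integral>\<^sup>+x. ennreal (norm (conv (radius n) (G i) x) ^ 2) \<partial>lborel))"
    proof -
      have m1: "(\<lambda>x. ennreal (norm (conv (radius n) \<phi> x) ^ 2)) \<in> borel_measurable lborel"
        by measurable
      have m2: "(\<lambda>x. ennreal (norm (conv (radius n) (G i) x) ^ 2)) \<in> borel_measurable lborel" for i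
        by measurable
      have m3: "(\<lambda>x. \<Sum>i\<in>UNIV. ennreal (norm (conv (radius n) (G i) x) ^ 2)) \<in> borel_measurable lborel"
        by (intro borel_measurable_sum m2)
      show ?thesis
        unfolding nn_integral_add[OF borel_measurable_times_ennreal[OF borel_measurable_const m1] borel_measurable_times_ennreal[OF borel_measurable_const m3]]
          nn_integral_cmult[OF m1] nn_integral_cmult[OF m3] nn_integral_sum[OF m2] ..
    qed
    also have "\<dots> \<le> ennreal c1 * ennreal Q + ennreal c2 * (\<Sum>i\<in>UNIV. ennreal (\<integral>x. norm (G i x) ^ 2 \<partial>lborel))"
      unfolding Q_def by (intro add_mono mult_left_mono sum_mono L2 \<phi>2 G2) auto
    also have "\<dots> = ennreal (c1 * Q + c2 * A)"
      using c nonneg by (simp add: ennreal_plus ennreal_mult' sum_ennreal A_def sum_nonneg)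
    finally show ?thesis
      using a_nonneg[of n] by (simp add: a_def c1_def c2_def)
  qed
  have bound: "(\<integral>\<^sup>+x. ennreal (regularize n \<phi> x ^ 4) \<partial>lborel) \<le> ennreal ((a n)\<^sup>2 / S)" for n
  proof -
    have "(\<integral>x. regularize n \<phi> x ^ 4 \<partial>lborel) * S \<le> (\<integral>x. norm (Dreg n x) ^ 2 \<partial>lborel)\<^sup>2"
      unfolding S_def by (rule sobolev_regularize)
    also have "\<dots> \<le> (a n)\<^sup>2" using grad by (intro power_mono) auto
    finally have le: "(\<integral>x. regularize n \<phi> x ^ 4 \<partial>lborel) \<le> (a n)\<^sup>2 / S" using S_pos by (simp add: le_divide_eq)
    have "integrable lborel (\<lambda>x. regularize n \<phi> x ^ 4)"
      by (rule integrable_compact_support[where R = "real (Suc n)"])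
        (use continuous_regularize(1)[of n] regularize_support in \<open>auto intro!: continuous_intros\<close>)
    then have "(\<integral>\<^sup>+x. ennreal (regularize n \<phi> x ^ 4) \<partial>lborel) = ennreal (\<integral>x. regularize n \<phi> x ^ 4 \<partial>lborel)"
      by (intro nn_integral_eq_integral) auto
    with le show ?thesis by (simp add: ennreal_leI)
  qed
  have meas[measurable]: "regularize n \<phi> \<in> borel_measurable borel" for n
    by (intro borel_measurable_continuous_onI continuous_regularize)
  \<comment> \<open>Mollifications converge in mean on balls only, and the subsequence converging
    almost everywhere depends on the ball. Fatou's lemma is therefore used on each ball with the
    same bound, and once more as the balls exhaust the space.\<close>
  have ball: "(\<integral>\<^sup>+x. ennreal (norm (\<phi> x) ^ 4) * indicator (cball 0 (real R)) x \<partial>lborel) \<le> ennreal (A\<^sup>2 / S)" for R :: nat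
  proof -
    have cb[measurable]: "cball (0::real^4) (real R) \<in> sets borel" by simp
    define u where "u n x = indicator (cball 0 (real R)) x *\<^sub>R (conv (radius n) \<phi> x - \<phi> x)" for n x
    have u_int: "integrable lborel (u n)" for n
    proof -
      have "integrable lborel (\<lambda>x. indicator (cball 0 (real R)) x *\<^sub>R conv (radius n) \<phi> x)"
        by (rule borel_integrable_compact) (auto intro: continuous_on_subset[OF continuous_on_conv[OF \<phi> radius_pos]])
      moreover have "integrable lborel (\<lambda>x. indicator (cball 0 (real R)) x *\<^sub>R \<phi> x)"
        using \<phi> by (simp add: loc_int_def)
      ultimately show ?thesis unfolding u_def by (simp add: scaleR_diff_right)
    qed
    have "(\<lambda>n. \<integral>x. norm (u n x) \<partial>lborel) \<longlonglongrightarrow> 0"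
    proof (rule tendstoI)
      fix e :: real assume e: "e > 0"
      then have "e / 2 > 0" by simp
      from conv_approx_on_ball[OF \<phi> this, of "real R"]
      show "\<forall>\<^sub>F n in sequentially. dist (\<integral>x. norm (u n x) \<partial>lborel) 0 < e"
      proof eventually_elim
        case (elim n)
        have "ennreal (\<integral>x. norm (u n x) \<partial>lborel) = (\<integral>\<^sup>+x. ennreal (norm (u n x)) \<partial>lborel)"
          using u_int by (intro nn_integral_eq_integral[symmetric]) auto
        also have "\<dots> = (\<integral>\<^sup>+x. ennreal (norm (conv (radius n) \<phi> x - \<phi> x)) * indicator (cball 0 (real R)) x \<partial>lborel)"
          by (intro nn_integral_cong) (auto simp: u_def indicator_def)
        also note elim
        finally have "(\<integral>x. norm (u n x) \<partial>lborel) \<le> e / 2" using e by simp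
        moreover have "0 \<le> (\<integral>x. norm (u n x) \<partial>lborel)" by (intro integral_nonneg_AE) auto
        ultimately show ?case using e by simp
      qed
    qed
    from tendsto_L1_AE_subseq[OF u_int this] obtain s :: "nat \<Rightarrow> nat" where s: "strict_mono s"
      and ae: "AE x in lborel. (\<lambda>n. u (s n) x) \<longlonglongrightarrow> 0" by blast
    have "(\<integral>\<^sup>+x. ennreal (norm (\<phi> x) ^ 4) * indicator (cball 0 (real R)) x \<partial>lborel) \<le>
        (\<integral>\<^sup>+x. liminf (\<lambda>n. ennreal (regularize (s n) \<phi> x ^ 4)) \<partial>lborel)"
    proof (rule nn_integral_mono_AE, use ae in eventually_elim)
      case (elim x)
      show "ennreal (norm (\<phi> x) ^ 4) * indicator (cball 0 (real R)) x \<le> liminf (\<lambda>n. ennreal (regularize (s n) \<phi> x ^ 4))"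
      proof (cases "x \<in> cball 0 (real R)")
        case True
        have "(\<lambda>n. u (s n) x + \<phi> x) \<longlonglongrightarrow> 0 + \<phi> x" using elim by (intro tendsto_intros)
        then have c: "(\<lambda>n. conv (radius (s n)) \<phi> x) \<longlonglongrightarrow> \<phi> x" using True by (simp add: u_def)
        have k: "(\<lambda>n. cutoff (real (Suc (s n))) x) \<longlonglongrightarrow> 1"
          using LIMSEQ_subseq_LIMSEQ[OF cutoff_tendsto s] by (simp add: comp_def)
        have r: "(\<lambda>n. radius (s n)) \<longlonglongrightarrow> 0"
          using LIMSEQ_subseq_LIMSEQ[OF radius_tendsto s] by (simp add: comp_def)
        have "(\<lambda>n. regularize (s n) \<phi> x ^ 4) \<longlonglongrightarrow> (sqrt (0\<^sup>2 + norm (1 *\<^sub>R \<phi> x) ^ 2) - 0) ^ 4"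
          unfolding regularize_def soft_abs_def by (intro tendsto_intros c k r)
        then have "(\<lambda>n. ennreal (regularize (s n) \<phi> x ^ 4)) \<longlonglongrightarrow> ennreal (norm (\<phi> x) ^ 4)"
          by (intro tendsto_ennrealI) simp
        from lim_imp_Liminf[OF _ this] show ?thesis using True by simp
      qed simp
    qed
    also have "\<dots> \<le> liminf (\<lambda>n. \<integral>\<^sup>+x. ennreal (regularize (s n) \<phi> x ^ 4) \<partial>lborel)"
      by (rule nn_integral_liminf) measurable
    also have "\<dots> \<le> liminf (\<lambda>n. ennreal ((a (s n))\<^sup>2 / S))"
      by (intro Liminf_mono always_eventually allI bound)
    also have "\<dots> = ennreal (A\<^sup>2 / S)"
    proof (rule lim_imp_Liminf)
      have "(\<lambda>n. a (s n)) \<longlonglongrightarrow> A" using LIMSEQ_subseq_LIMSEQ[OF a_lim s] by (simp add: comp_def)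
      then show "(\<lambda>n. ennreal ((a (s n))\<^sup>2 / S)) \<longlonglongrightarrow> ennreal (A\<^sup>2 / S)"
        using S_pos by (intro tendsto_ennrealI tendsto_intros) auto
    qed simp
    finally show ?thesis .
  qed
  have "(\<integral>\<^sup>+x. ennreal (norm (\<phi> x) ^ 4) \<partial>lborel) =
      (\<integral>\<^sup>+x. liminf (\<lambda>R. ennreal (norm (\<phi> x) ^ 4) * indicator (cball 0 (real R)) x) \<partial>lborel)"
  proof (rule nn_integral_cong)
    fix x
    have "(\<lambda>R. ennreal (norm (\<phi> x) ^ 4) * indicator (cball 0 (real R)) x) \<longlonglongrightarrow> ennreal (norm (\<phi> x) ^ 4)"
    proof (rule tendsto_eventually, rule eventually_sequentiallyI[of "nat \<lceil>norm x\<rceil>"])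
      fix n assume "nat \<lceil>norm x\<rceil> \<le> n"
      then have "x \<in> cball 0 (real n)" by (simp add: ceiling_le_iff nat_le_iff)
      then show "ennreal (norm (\<phi> x) ^ 4) * indicator (cball 0 (real n)) x = ennreal (norm (\<phi> x) ^ 4)" by simp
    qed
    from lim_imp_Liminf[OF _ this]
    show "ennreal (norm (\<phi> x) ^ 4) = liminf (\<lambda>R. ennreal (norm (\<phi> x) ^ 4) * indicator (cball 0 (real R)) x)" by simp
  qed
  also have "\<dots> \<le> liminf (\<lambda>R. \<integral>\<^sup>+x. ennreal (norm (\<phi> x) ^ 4) * indicator (cball 0 (real R)) x \<partial>lborel)"
    by (rule nn_integral_liminf) (intro borel_measurable_times_ennreal borel_measurable_indicator; simp)
  also have "\<dots> \<le> liminf (\<lambda>R::nat. ennreal (A\<^sup>2 / S))"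
    by (intro Liminf_mono always_eventually allI ball)
  also have "\<dots> = ennreal (A\<^sup>2 / S)"
    by (rule lim_imp_Liminf) auto
  finally show ?thesis .
qed

end

section \<open>From Borel representatives back to \<open>H1\<close>\<close>

lemma
  fixes f f' :: "real^4 \<Rightarrow> real"
  assumes f: "f \<in> borel_measurable lebesgue" and f': "f' \<in> borel_measurable borel" and eq: "AE x in lborel. f x = f' x"
  shows integrable_representative: "integrable lebesgue f \<longleftrightarrow> integrable lborel f'"
    and integral_representative: "(\<integral>x. f x \<partial>lebesgue) = (\<integral>x. f' x \<partial>lborel)"
proof -
  have f'1: "f' \<in> borel_measurable lborel" using f' by simp
  then have f'2: "f' \<in> borel_measurable lebesgue" by (rule measurable_completion)
  have eq': "AE x in lebesgue. f x = f' x" using eq by (rule AE_completion)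
  show "integrable lebesgue f \<longleftrightarrow> integrable lborel f'"
    using integrable_cong_AE[OF f f'2 eq'] integrable_completion[OF f'1] by simp
  show "(\<integral>x. f x \<partial>lebesgue) = (\<integral>x. f' x \<partial>lborel)"
    using integral_cong_AE[OF f f'2 eq'] integral_completion[OF f'1] by simp
qed

lemma norm_complex4_sq: "norm (G :: complex^4) ^ 2 = (\<Sum>i\<in>UNIV. cmod (G $ i) ^ 2)"
  by (simp add: norm_vec_def L2_set_def sum_nonneg)

lemma weak_gradient_measurable:
  assumes "has_weak_gradient \<phi> G"
  shows "(\<lambda>x. norm (G x) ^ 2) \<in> borel_measurable lebesgue"
proof -
  have "(\<lambda>x. G x $ i) \<in> borel_measurable lebesgue" for i
    using assms by (intro locally_integrable_measurable) (simp add: has_weak_gradient_def)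
  then show ?thesis unfolding norm_complex4_sq by measurable
qed

text \<open>Since \<open>weak_gradient\<close> is an arbitrary choice, its values are known only up
  to a null set; its square integral may be computed from any explicit weak gradient.\<close>

lemma weak_gradient_properties:
  assumes G: "has_weak_gradient \<phi> G"
  shows "has_weak_gradient \<phi> (weak_gradient \<phi>)"
    and "AE x in lebesgue. weak_gradient \<phi> x = G x"
    and "integrable lebesgue (\<lambda>x. norm (weak_gradient \<phi> x) ^ 2) \<longleftrightarrow> integrable lebesgue (\<lambda>x. norm (G x) ^ 2)"
    and "(\<integral>x. norm (weak_gradient \<phi> x) ^ 2 \<partial>lebesgue) = (\<integral>x. norm (G x) ^ 2 \<partial>lebesgue)"
proof -
  show wg: "has_weak_gradient \<phi> (weak_gradient \<phi>)"
    unfolding weak_gradient_def by (rule someI[of "has_weak_gradient \<phi>", OF G])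
  show eq: "AE x in lebesgue. weak_gradient \<phi> x = G x"
    using weak_gradient_unique[OF wg G] by (rule AE_completion)
  then have eq2: "AE x in lebesgue. norm (weak_gradient \<phi> x) ^ 2 = norm (G x) ^ 2"
    by eventually_elim simp
  show "integrable lebesgue (\<lambda>x. norm (weak_gradient \<phi> x) ^ 2) \<longleftrightarrow> integrable lebesgue (\<lambda>x. norm (G x) ^ 2)"
    by (rule integrable_cong_AE[OF weak_gradient_measurable[OF wg] weak_gradient_measurable[OF G] eq2])
  show "(\<integral>x. norm (weak_gradient \<phi> x) ^ 2 \<partial>lebesgue) = (\<integral>x. norm (G x) ^ 2 \<partial>lebesgue)"
    by (rule integral_cong_AE[OF weak_gradient_measurable[OF wg] weak_gradient_measurable[OF G] eq2])
qed

text \<open>The common value of the gradient and quartic integrals of \<open>W\<close>. In these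
  terms the sharp inequality carries no further constant.\<close>

definition sobolev_level :: real where
  "sobolev_level = (\<integral>x. bubble (x::real^4) ^ 4 \<partial>lborel)"

lemma sobolev_level_pos: "sobolev_level > 0"
  unfolding sobolev_level_def by (rule bubble_integrals) simp

lemma sobolev_H1:
  assumes "\<phi> \<in> H1"
  shows "integrable lebesgue (\<lambda>x. norm (weak_gradient \<phi> x) ^ 2)"
    and "integrable lebesgue (\<lambda>x. cmod (\<phi> x) ^ 4)"
    and "(\<integral>x. cmod (\<phi> x) ^ 4 \<partial>lebesgue) * sobolev_level \<le> (\<integral>x. norm (weak_gradient \<phi> x) ^ 2 \<partial>lebesgue)\<^sup>2"
proof -
  obtain G where \<phi>_meas: "\<phi> \<in> borel_measurable lebesgue" and \<phi>2: "integrable lebesgue (\<lambda>x. cmod (\<phi> x) ^ 2)"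
    and hG: "has_weak_gradient \<phi> G" and G2: "integrable lebesgue (\<lambda>x. norm (G x) ^ 2)"
    using assms by (auto simp: H1_def)
  show "integrable lebesgue (\<lambda>x. norm (weak_gradient \<phi> x) ^ 2)"
    using weak_gradient_properties(3)[OF hG] G2 by simp
  obtain \<phi>' G' where \<phi>': "loc_int \<phi>'" "AE x in lborel. \<phi> x = \<phi>' x" and G': "\<And>i. loc_int (G' i)"
    "\<And>i. AE x in lborel. G x $ i = G' i x"
    and weak: "\<And>\<eta> i. test_function \<eta> \<Longrightarrow> (\<integral>x. partial i \<eta> x *\<^sub>R \<phi>' x \<partial>lborel) = - (\<integral>x. \<eta> x *\<^sub>R G' i x \<partial>lborel)"
    using weak_gradient_representative[OF hG] by blast
  interpret weakly_differentiable \<phi>' G'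
    by unfold_locales (use \<phi>' G' weak in auto)
  have [measurable]: "\<phi>' \<in> borel_measurable borel" and G'm[measurable]: "G' i \<in> borel_measurable borel" for i
    using \<phi>' G' by (auto simp: loc_int_def)
  have pow: "(\<lambda>x. cmod (\<phi> x) ^ k) \<in> borel_measurable lebesgue" "AE x in lborel. cmod (\<phi> x) ^ k = cmod (\<phi>' x) ^ k" for k
    using \<phi>_meas \<phi>'(2) by auto
  have pow': "(\<lambda>x. cmod (\<phi>' x) ^ k) \<in> borel_measurable borel" for k by measurable
  have i2: "integrable lborel (\<lambda>x. cmod (\<phi>' x) ^ 2)"
    using integrable_representative[OF pow(1) pow' pow(2)] \<phi>2 by simp
  have "AE x in lborel. \<forall>i. G x $ i = G' i x"
    unfolding AE_all_countable using G'(2) by blast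
  then have Geq: "AE x in lborel. norm (G x) ^ 2 = (\<Sum>i\<in>UNIV. cmod (G' i x) ^ 2)"
    by eventually_elim (simp add: norm_complex4_sq)
  have sm: "(\<lambda>x. \<Sum>i\<in>UNIV. cmod (G' i x) ^ 2) \<in> borel_measurable borel" by measurable
  have sum_int: "integrable lborel (\<lambda>x. \<Sum>i\<in>UNIV. cmod (G' i x) ^ 2)"
    using integrable_representative[OF weak_gradient_measurable[OF hG] sm Geq] G2 by simp
  have Gi: "integrable lborel (\<lambda>x. cmod (G' i x) ^ 2)" for i
  proof (rule Bochner_Integration.integrable_bound[OF sum_int])
    show "(\<lambda>x. cmod (G' i x) ^ 2) \<in> borel_measurable lborel" by measurable
    have "cmod (G' i x) ^ 2 \<le> (\<Sum>i\<in>UNIV. cmod (G' i x) ^ 2)" for x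
      by (rule member_le_sum) auto
    then show "AE x in lborel. norm (cmod (G' i x) ^ 2) \<le> norm (\<Sum>i\<in>UNIV. cmod (G' i x) ^ 2)"
      by (auto simp: sum_nonneg)
  qed
  define A where "A = (\<Sum>i\<in>UNIV. (\<integral>x. cmod (G' i x) ^ 2 \<partial>lborel))"
  have A: "A = (\<integral>x. norm (weak_gradient \<phi> x) ^ 2 \<partial>lebesgue)"
    using weak_gradient_properties(4)[OF hG] integral_representative[OF weak_gradient_measurable[OF hG] sm Geq] Gi
    by (simp add: A_def)
  have le: "(\<integral>\<^sup>+x. ennreal (cmod (\<phi>' x) ^ 4) \<partial>lborel) \<le> ennreal (A\<^sup>2 / sobolev_level)"
    using sobolev[OF i2 Gi] by (simp add: A_def sobolev_level_def)
  have i4: "integrable lborel (\<lambda>x. cmod (\<phi>' x) ^ 4)"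
    using le by (intro integrableI_nonneg) (auto simp: le_less_trans[OF _ ennreal_less_top])
  then show "integrable lebesgue (\<lambda>x. cmod (\<phi> x) ^ 4)"
    using integrable_representative[OF pow(1) pow' pow(2)] by simp
  have "ennreal (\<integral>x. cmod (\<phi>' x) ^ 4 \<partial>lborel) \<le> ennreal (A\<^sup>2 / sobolev_level)"
    using le i4 by (subst (asm) nn_integral_eq_integral) auto
  then have "(\<integral>x. cmod (\<phi>' x) ^ 4 \<partial>lborel) \<le> A\<^sup>2 / sobolev_level"
    using sobolev_level_pos by (subst (asm) ennreal_le_iff) auto
  then show "(\<integral>x. cmod (\<phi> x) ^ 4 \<partial>lebesgue) * sobolev_level \<le> (\<integral>x. norm (weak_gradient \<phi> x) ^ 2 \<partial>lebesgue)\<^sup>2"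
    using sobolev_level_pos unfolding A integral_representative[OF pow(1) pow' pow(2)]
    by (simp add: le_divide_eq)
qed

section \<open>The lower bound\<close>

lemma powr_interpolation:
  assumes "t \<ge> (0::real)" shows "t powr (10/3) \<le> t ^ 2 + t ^ 4"
proof (cases "t \<le> 1")
  case True
  then have "t powr (10/3) \<le> t powr 2" using assms by (intro powr_mono') auto
  also have "t powr 2 = t ^ 2" using assms by (cases "t = 0") (auto simp: powr_numeral)
  finally show ?thesis using assms by (simp add: add_increasing2)
next
  case False
  then have "t powr (10/3) \<le> t powr 4" by (intro powr_mono) auto
  also have "t powr 4 = t ^ 4" using False by (simp add: powr_numeral)
  finally show ?thesis by (simp add: add_increasing)
qed

lemma integrable_H1_powr:
  assumes "\<phi> \<in> H1" shows "integrable lebesgue (\<lambda>x. cmod (\<phi> x) powr (10/3))"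
proof (rule Bochner_Integration.integrable_bound)
  show "integrable lebesgue (\<lambda>x. cmod (\<phi> x) ^ 2 + cmod (\<phi> x) ^ 4)"
    using assms sobolev_H1(2)[OF assms] by (auto simp: H1_def)
  show "(\<lambda>x. cmod (\<phi> x) powr (10/3)) \<in> borel_measurable lebesgue"
    using assms by (auto simp: H1_def)
  show "AE x in lebesgue. norm (cmod (\<phi> x) powr (10/3)) \<le> norm (cmod (\<phi> x) ^ 2 + cmod (\<phi> x) ^ 4)"
    using powr_interpolation by (intro AE_I2) (simp add: abs_of_nonneg)
qed

lemma energy_H1:
  assumes "\<phi> \<in> H1"
  shows "energy \<phi> = 1/2 * (\<integral>x. norm (weak_gradient \<phi> x) ^ 2 \<partial>lebesgue) - 1/4 * (\<integral>x. cmod (\<phi> x) ^ 4 \<partial>lebesgue)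
      + 3/10 * (\<integral>x. cmod (\<phi> x) powr (10/3) \<partial>lebesgue)"
    and "K \<alpha> \<beta> \<phi> = (\<alpha> + \<beta>) * ((\<integral>x. norm (weak_gradient \<phi> x) ^ 2 \<partial>lebesgue) - (\<integral>x. cmod (\<phi> x) ^ 4 \<partial>lebesgue))
      + (\<alpha> + 6/5 * \<beta>) * (\<integral>x. cmod (\<phi> x) powr (10/3) \<partial>lebesgue)"
  unfolding energy_def K_def using sobolev_H1(1,2)[OF assms] integrable_H1_powr[OF assms] by simp_all

text \<open>All that is used of Omega. The last inequality is \<alpha> \<ge> 0, because
  \<open>\<alpha> + 6/5 * \<beta> = 6/5 * (\<alpha> + \<beta>) - \<alpha> / 5\<close>.\<close>

lemma Omega_coefficients:
  assumes "(\<alpha>, \<beta>) \<in> Omega"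
  shows "\<alpha> + \<beta> > 0" "\<alpha> + 6/5 * \<beta> \<ge> 0" "\<alpha> + 6/5 * \<beta> \<le> 6/5 * (\<alpha> + \<beta>)"
proof -
  have *: "\<alpha> \<ge> 0" "5 * \<alpha> + 6 * \<beta> \<ge> 0" "\<not> (\<alpha> = 0 \<and> \<beta> = 0)" using assms by (auto simp: Omega_def)
  then show "\<alpha> + \<beta> > 0" by linarith
  show "\<alpha> + 6/5 * \<beta> \<ge> 0" "\<alpha> + 6/5 * \<beta> \<le> 6/5 * (\<alpha> + \<beta>)" using * by simp_all
qed

text \<open>The bound \<open>b \<le> 6/5 a\<close> turns the constraint into
  \<open>B \<le> A + 6/5 C\<close>; in the energy the resulting loss of \<open>3/10 C\<close> is
  exactly covered by the last term, which leaves \<open>A / 4\<close>. On the other hand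
  \<open>b \<ge> 0\<close> gives \<open>A \<le> B\<close>, and the sharp inequality then forces
  \<open>A\<close> to be at least \<open>sobolev_level\<close>.\<close>

lemma energy_lower_bound:
  assumes \<Omega>: "(\<alpha>, \<beta>) \<in> Omega" and \<phi>: "\<phi> \<in> H1 - H1_zero" and K0: "K \<alpha> \<beta> \<phi> = 0"
  shows "sobolev_level / 4 \<le> energy \<phi>"
proof -
  define a where "a = \<alpha> + \<beta>"
  define b where "b = \<alpha> + 6/5 * \<beta>"
  define A where "A = (\<integral>x. norm (weak_gradient \<phi> x) ^ 2 \<partial>lebesgue)"
  define B where "B = (\<integral>x. cmod (\<phi> x) ^ 4 \<partial>lebesgue)"
  define C where "C = (\<integral>x. cmod (\<phi> x) powr (10/3) \<partial>lebesgue)"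
  have H: "\<phi> \<in> H1" using \<phi> by simp
  have ab: "a > 0" "b \<ge> 0" "b \<le> 6/5 * a" using Omega_coefficients[OF \<Omega>] by (simp_all add: a_def b_def)
  have nonneg: "A \<ge> 0" "B \<ge> 0" "C \<ge> 0" unfolding A_def B_def C_def by (auto intro!: integral_nonneg_AE)
  have sob: "B * sobolev_level \<le> A\<^sup>2" unfolding A_def B_def by (rule sobolev_H1(3)[OF H])
  have K: "a * (A - B) + b * C = 0" using K0 unfolding energy_H1(2)[OF H] a_def b_def A_def B_def C_def .
  have B_pos: "B > 0"
  proof (rule ccontr)
    assume "\<not> B > 0"
    then have "B = 0" using nonneg by simp
    then have "AE x in lebesgue. cmod (\<phi> x) ^ 4 = 0"
      unfolding B_def using sobolev_H1(2)[OF H] by (subst (asm) integral_nonneg_eq_0_iff_AE) auto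
    then have "AE x in lebesgue. \<phi> x = 0" by eventually_elim simp
    then show False using \<phi> by (simp add: H1_zero_def)
  qed
  have "A \<le> B"
  proof -
    have "a * (A - B) \<le> 0" using K mult_nonneg_nonneg[OF ab(2) nonneg(3)] by linarith
    then show ?thesis using ab(1) by (simp add: mult_le_0_iff)
  qed
  \<comment> \<open>Needed to cancel one factor in \<open>A * sobolev_level \<le> A^2\<close>; this
    is where a nonzero \<open>\<phi>\<close> matters, through \<open>B > 0\<close>.\<close>
  have A_pos: "A > 0"
    using sob B_pos sobolev_level_pos nonneg(1) mult_pos_pos[OF B_pos sobolev_level_pos] by (cases "A = 0") auto
  have "A * sobolev_level \<le> B * sobolev_level"
    using \<open>A \<le> B\<close> sobolev_level_pos by (intro mult_right_mono) auto
  also note sob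
  finally have "sobolev_level \<le> A" using A_pos by (simp add: power2_eq_square)
  have BA: "B = A + b * C / a" using K ab(1) by (simp add: field_simps)
  have "b * C / a \<le> 6/5 * C"
  proof -
    have "b * C \<le> 6/5 * a * C" using ab(3) nonneg(3) by (intro mult_right_mono)
    then show ?thesis using ab(1) by (simp add: divide_le_eq mult.commute mult.left_commute)
  qed
  then have "B \<le> A + 6/5 * C" unfolding BA by simp
  then have "1/4 * A \<le> 1/2 * A - 1/4 * B + 3/10 * C" by simp
  then show ?thesis
    using \<open>sobolev_level \<le> A\<close> unfolding energy_H1(1)[OF H] A_def[symmetric] B_def[symmetric] C_def[symmetric] by linarith
qed

section \<open>Weak gradients of continuously differentiable functions\<close>

lemma test_function_line_deriv:
  assumes "test_function \<eta>"
  shows "((\<lambda>t. \<eta> (x + t *\<^sub>R axis i 1)) has_real_derivative partial i \<eta> x) (at 0)"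
proof -
  have "smooth \<eta>" using assms by (simp add: test_function_def)
  then have "foldr partial [] \<eta> differentiable_on UNIV" unfolding smooth_def by blast
  then have "\<eta> differentiable at x" by (simp add: differentiable_on_def)
  then have "(\<eta> has_derivative frechet_derivative \<eta> (at x)) (at (x + 0 *\<^sub>R axis i 1))"
    by (simp add: frechet_derivative_works[symmetric])
  moreover have "((\<lambda>t. x + t *\<^sub>R axis i 1) has_derivative (\<lambda>h. h *\<^sub>R axis i 1)) (at (0::real))"
    by (auto intro!: derivative_eq_intros)
  ultimately have "((\<lambda>t. \<eta> (x + t *\<^sub>R axis i 1)) has_derivative (\<lambda>h. frechet_derivative \<eta> (at x) (h *\<^sub>R axis i 1))) (at (0::real))"
    by (rule has_derivative_compose[rotated])
  moreover have "(\<lambda>h. frechet_derivative \<eta> (at x) (h *\<^sub>R axis i 1)) = (*) (partial i \<eta> x)"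
    using linear_frechet_derivative[OF \<open>\<eta> differentiable at x\<close>]
    by (simp add: partial_def linear_scale fun_eq_iff mult.commute)
  ultimately show ?thesis
    by (simp add: has_field_derivative_def)
qed

lemma partial_test_function_eq_0:
  assumes \<eta>: "test_function \<eta>" and R: "\<forall>x. R < norm x \<longrightarrow> \<eta> x = 0" and x: "R < norm x"
  shows "partial i \<eta> x = 0"
proof -
  have o: "open {x :: real^4. R < norm x}" by (intro open_Collect_less continuous_intros)
  have "((\<lambda>_. 0::real) has_derivative (\<lambda>_. 0)) (at x)" by simp
  then have "(\<eta> has_derivative (\<lambda>_. 0)) (at x)"
    by (rule has_derivative_transform_within_open[OF _ o]) (use R x in auto)
  from frechet_derivative_at[OF this] show ?thesis
    by (simp add: partial_def fun_eq_iff)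
qed

lemma locally_integrable_continuous:
  assumes "continuous_on UNIV f" shows "locally_integrable f"
  unfolding locally_integrable_def set_integrable_def
proof (intro allI impI)
  fix K :: "(real^4) set" assume K: "compact K"
  have "integrable lborel (\<lambda>x. indicator K x *\<^sub>R f x)"
    using K by (rule borel_integrable_compact) (rule continuous_on_subset[OF assms subset_UNIV])
  then show "integrable lebesgue (\<lambda>x. indicator K x *\<^sub>R f x)"
    by (subst integrable_completion) auto
qed

text \<open>For a test function \<open>\<eta>\<close> the product \<open>\<eta> \<phi>\<close> has
  compact support, so the integral of its derivative along an axis is zero; the product rule splits
  it into the two sides of the weak formulation.\<close>

lemma has_weak_gradient_C1:
  fixes \<phi> :: "real^4 \<Rightarrow> complex"
  assumes \<phi>: "continuous_on UNIV \<phi>" and D: "\<And>i. continuous_on UNIV (D i)"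
    and deriv: "\<And>x i. ((\<lambda>t. \<phi> (x + t *\<^sub>R axis i 1)) has_vector_derivative D i x) (at 0)"
  shows "has_weak_gradient \<phi> (\<lambda>x. \<chi> i. D i x)"
  unfolding has_weak_gradient_def
proof (intro conjI allI impI)
  show "locally_integrable \<phi>" using \<phi> by (rule locally_integrable_continuous)
  show "locally_integrable (\<lambda>x. (\<chi> i. D i x) $ i)" for i
    using D[of i] by (simp add: locally_integrable_continuous)
  fix \<eta> i assume \<eta>: "test_function \<eta>"
  obtain R where R: "\<forall>x. R < norm x \<longrightarrow> \<eta> x = 0" using test_function_bound[OF \<eta>] by blast
  have out: "R < norm x" if nx: "x \<notin> cube R" for x :: "real^4"
  proof -
    obtain b :: "real^4" where "b \<in> Basis" "R < \<bar>x \<bullet> b\<bar>" using nx by (auto simp: cube_def not_le)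
    then show ?thesis using Basis_le_norm[of b x] by simp
  qed
  note \<eta>c = test_function_continuous[OF \<eta>]
  have int1: "integrable lborel (\<lambda>x. \<eta> x *\<^sub>R \<phi> x)"
    by (rule integrable_compact_support[where R = R]) (use R out in \<open>auto intro!: continuous_intros \<eta>c \<phi>\<close>)
  have int2: "integrable lborel (\<lambda>x. \<eta> x *\<^sub>R D i x)"
    by (rule integrable_compact_support[where R = R]) (use R out in \<open>auto intro!: continuous_intros \<eta>c D\<close>)
  have int3: "integrable lborel (\<lambda>x. partial i \<eta> x *\<^sub>R \<phi> x)"
    by (rule integrable_compact_support[where R = R])
      (use partial_test_function_eq_0[OF \<eta> R] out in \<open>auto intro!: continuous_intros \<eta>c \<phi>\<close>)
  have "(\<integral>x. \<eta> x *\<^sub>R D i x + partial i \<eta> x *\<^sub>R \<phi> x \<partial>lborel) = 0"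
  proof (rule integral_directional_derivative[where b = "axis i 1"])
    fix x
    show "((\<lambda>t. \<eta> (x + t *\<^sub>R axis i 1) *\<^sub>R \<phi> (x + t *\<^sub>R axis i 1)) has_vector_derivative \<eta> x *\<^sub>R D i x + partial i \<eta> x *\<^sub>R \<phi> x) (at 0)"
      using has_vector_derivative_scaleR[OF test_function_line_deriv[OF \<eta>, of x i] deriv[of x i]] by simp
  qed (use int1 int2 int3 in \<open>auto intro!: continuous_intros \<eta>c \<phi> D\<close>)
  then have "(\<integral>x. partial i \<eta> x *\<^sub>R \<phi> x \<partial>lborel) = - (\<integral>x. \<eta> x *\<^sub>R D i x \<partial>lborel)"
    using int2 int3 by (simp add: add_eq_0_iff)
  then show "(\<integral>x. partial i \<eta> x *\<^sub>R \<phi> x \<partial>lebesgue) = - (\<integral>x. \<eta> x *\<^sub>R (\<chi> i. D i x) $ i \<partial>lebesgue)"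
    using borel_measurable_integrable[OF int2] borel_measurable_integrable[OF int3] by (simp add: integral_completion)
qed

section \<open>The gradient and quartic integrals of \<open>W\<close>\<close>

lemma W_bubble: "W x = of_real (bubble x)"
  by (simp add: W_def bubble_def)

lemma bubble_axis_deriv:
  "((\<lambda>t. bubble (x + t *\<^sub>R axis i 1)) has_real_derivative - (x $ i) / 4 * bubble x ^ 2) (at 0)" for x :: "real^4"
  using bubble_directional_derivative[of "axis i 1" x] by (simp add: inner_axis axis_in_Basis_iff)

text \<open>Pointwise \<open>|grad W|^2 = |x|^2 bubble^4 / 16\<close>, and 16 is exactly the ratio
  of the second moment of \<open>bubble^4\<close> to its integral, so the two integrals
  coincide.\<close>

lemma W_integrals:
  shows "integrable lebesgue (\<lambda>x. norm (weak_gradient W x) ^ 2)"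
    and "(\<integral>x. norm (weak_gradient W x) ^ 2 \<partial>lebesgue) = sobolev_level"
    and "integrable lebesgue (\<lambda>x. cmod (W x) ^ 4)"
    and "(\<integral>x. cmod (W x) ^ 4 \<partial>lebesgue) = sobolev_level"
proof -
  have dim: "DIM(real^4) = 4" by simp
  define D where "D i x = complex_of_real (- (x $ i) / 4 * bubble x ^ 2)" for i and x :: "real^4"
  have G: "has_weak_gradient W (\<lambda>x. \<chi> i. D i x)"
  proof (rule has_weak_gradient_C1)
    show "continuous_on UNIV W"
      unfolding W_bubble[abs_def] by (intro continuous_intros continuous_on_bubble)
    show "continuous_on UNIV (D i)" for i
      unfolding D_def[abs_def] by (intro continuous_intros continuous_on_bubble) auto
    show "((\<lambda>t. W (x + t *\<^sub>R axis i 1)) has_vector_derivative D i x) (at 0)" for x i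
      unfolding W_bubble D_def by (rule has_vector_derivative_of_real[OF bubble_axis_deriv])
  qed
  have norm_D: "norm (\<chi> i. D i x) ^ 2 = norm x ^ 2 * bubble x ^ 4 / 16" for x
  proof -
    have "norm (\<chi> i. D i x) ^ 2 = (\<Sum>i\<in>UNIV. (x $ i)\<^sup>2) * (bubble x ^ 4 / 16)"
      unfolding norm_complex4_sq sum_distrib_right
      by (intro sum.cong) (simp_all add: D_def norm_mult norm_power power_mult_distrib power_divide flip: power_mult)
    also have "(\<Sum>i\<in>UNIV. (x $ i)\<^sup>2) = norm x ^ 2" by (simp add: norm_vec_def L2_set_def sum_nonneg)
    finally show ?thesis by simp
  qed
  have 1: "integrable lborel (\<lambda>x::real^4. norm x ^ 2 * bubble x ^ 4 / 16)"
    using integrable_norm_sq_bubble[OF dim] by simp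
  have 2: "(\<integral>x. norm (x::real^4) ^ 2 * bubble x ^ 4 / 16 \<partial>lborel) = sobolev_level"
    using bubble_integrals(2)[OF dim] by (simp add: sobolev_level_def)
  have m: "(\<lambda>x::real^4. norm x ^ 2 * bubble x ^ 4 / 16) \<in> borel_measurable lborel" by measurable
  show "integrable lebesgue (\<lambda>x. norm (weak_gradient W x) ^ 2)"
    unfolding weak_gradient_properties(3)[OF G] norm_D integrable_completion[OF m] by (rule 1)
  show "(\<integral>x. norm (weak_gradient W x) ^ 2 \<partial>lebesgue) = sobolev_level"
    unfolding weak_gradient_properties(4)[OF G] norm_D integral_completion[OF m] by (rule 2)
  have W4: "cmod (W x) ^ 4 = bubble x ^ 4" for x by (simp add: W_bubble bubble_nonneg)
  have m': "(\<lambda>x::real^4. bubble x ^ 4) \<in> borel_measurable lborel" by measurable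
  show "integrable lebesgue (\<lambda>x. cmod (W x) ^ 4)"
    unfolding W4 integrable_completion[OF m'] by (rule integrable_bubble_power[OF dim]) simp
  show "(\<integral>x. cmod (W x) ^ 4 \<partial>lebesgue) = sobolev_level"
    unfolding W4 integral_completion[OF m'] sobolev_level_def ..
qed

lemma energy_c_W: "energy_c W = sobolev_level / 4"
  unfolding energy_c_def using W_integrals by simp

lemma L2_norm_gradient_W: "L2_norm (weak_gradient W) ^ 2 = sobolev_level"
  unfolding L2_norm_def W_integrals(2) using sobolev_level_pos by simp

section \<open>Trial functions\<close>

lemma
  fixes f :: "real^4 \<Rightarrow> real"
  assumes f: "integrable lborel f" and r: "r > 0"
  shows integrable_rescale: "integrable lborel (\<lambda>x. f (x /\<^sub>R r))"
    and integral_rescale: "(\<integral>x. f (x /\<^sub>R r) \<partial>lborel) = r ^ 4 * (\<integral>x. f x \<partial>lborel)"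
proof -
  have [measurable]: "f \<in> borel_measurable borel" using f by auto
  have lb: "lborel = density (distr lborel borel (\<lambda>x::real^4. 0 + r *\<^sub>R x)) (\<lambda>_. ennreal (\<bar>r\<bar> ^ DIM(real^4)))"
    using lborel_affine[of r "0::real^4"] r by simp
  have inv: "f ((0 + r *\<^sub>R x) /\<^sub>R r) = f x" for x using r by simp
  have "integrable (density (distr lborel borel (\<lambda>x::real^4. 0 + r *\<^sub>R x)) (\<lambda>_. ennreal (\<bar>r\<bar> ^ DIM(real^4)))) (\<lambda>x. f (x /\<^sub>R r))"
    using r f by (subst integrable_density) (auto simp: integrable_distr_eq)
  then show "integrable lborel (\<lambda>x. f (x /\<^sub>R r))" using lb by simp
  have "(\<integral>x. f (x /\<^sub>R r) \<partial>lborel) =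
      (\<integral>x. f (x /\<^sub>R r) \<partial>density (distr lborel borel (\<lambda>x::real^4. 0 + r *\<^sub>R x)) (\<lambda>_. ennreal (\<bar>r\<bar> ^ DIM(real^4))))"
    using lb by simp
  also have "\<dots> = r ^ 4 * (\<integral>x. f x \<partial>lborel)"
    using r by (subst integral_density) (auto simp: integral_distr)
  finally show "(\<integral>x. f (x /\<^sub>R r) \<partial>lborel) = r ^ 4 * (\<integral>x. f x \<partial>lborel)" .
qed

locale trial_function =
  fixes F :: "real^4 \<Rightarrow> real" and D :: "4 \<Rightarrow> real^4 \<Rightarrow> real" and R :: real
  assumes F_cont: "continuous_on UNIV F" and D_cont: "\<And>i. continuous_on UNIV (D i)"
    and F_nonneg: "\<And>x. 0 \<le> F x"
    and support: "\<And>x i. x \<notin> cube R \<Longrightarrow> F x = 0 \<and> D i x = 0"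
    and deriv: "\<And>x i. ((\<lambda>t. F (x + t *\<^sub>R axis i 1)) has_real_derivative D i x) (at 0)"
begin

definition A where "A = (\<integral>x. (\<Sum>i\<in>UNIV. (D i x)\<^sup>2) \<partial>lborel)"
definition B where "B = (\<integral>x. F x ^ 4 \<partial>lborel)"
definition C where "C = (\<integral>x. F x powr (10/3) \<partial>lborel)"

lemma integrable_F: "integrable lborel (\<lambda>x. F x ^ 2)" "integrable lborel (\<lambda>x. F x ^ 4)"
  "integrable lborel (\<lambda>x. F x powr (10/3))" "integrable lborel (\<lambda>x. \<Sum>i\<in>UNIV. (D i x)\<^sup>2)"
proof -
  show 2: "integrable lborel (\<lambda>x. F x ^ 2)"
    by (rule integrable_compact_support[where R = R]) (use support in \<open>auto intro!: continuous_intros F_cont\<close>)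
  show 4: "integrable lborel (\<lambda>x. F x ^ 4)"
    by (rule integrable_compact_support[where R = R]) (use support in \<open>auto intro!: continuous_intros F_cont\<close>)
  have [measurable]: "F \<in> borel_measurable borel" using F_cont by (rule borel_measurable_continuous_onI)
  show "integrable lborel (\<lambda>x. F x powr (10/3))"
  proof (rule Bochner_Integration.integrable_bound)
    show "integrable lborel (\<lambda>x. F x ^ 2 + F x ^ 4)" using 2 4 by simp
    show "AE x in lborel. norm (F x powr (10/3)) \<le> norm (F x ^ 2 + F x ^ 4)"
      using powr_interpolation F_nonneg by (intro AE_I2) (simp add: abs_of_nonneg)
  qed measurable
  show "integrable lborel (\<lambda>x. \<Sum>i\<in>UNIV. (D i x)\<^sup>2)"
    by (rule integrable_compact_support[where R = R]) (use support in \<open>auto intro!: continuous_intros D_cont\<close>)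
qed

definition scaled :: "real \<Rightarrow> real \<Rightarrow> real^4 \<Rightarrow> complex" where
  "scaled c r x = of_real (c / r * F (x /\<^sub>R r))"

lemma scaled:
  assumes c: "c > 0" and r: "r > 0"
  shows "scaled c r \<in> H1"
    and "(\<integral>x. norm (weak_gradient (scaled c r) x) ^ 2 \<partial>lebesgue) = c\<^sup>2 * A"
    and "(\<integral>x. cmod (scaled c r x) ^ 4 \<partial>lebesgue) = c ^ 4 * B"
    and "(\<integral>x. cmod (scaled c r x) powr (10/3) \<partial>lebesgue) = c powr (10/3) * r powr (2/3) * C"
proof -
  have [measurable]: "F \<in> borel_measurable borel" and Dm[measurable]: "D i \<in> borel_measurable borel" for i
    using F_cont D_cont by (auto intro: borel_measurable_continuous_onI)
  define G where "G i x = complex_of_real (c / r\<^sup>2 * D i (x /\<^sub>R r))" for i x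
  have hc: "continuous_on UNIV (\<lambda>x::real^4. x /\<^sub>R r)" by (intro continuous_intros)
  have cF: "continuous_on UNIV (\<lambda>x. F (x /\<^sub>R r))" by (rule continuous_on_compose2[OF F_cont hc]) simp
  have cD: "continuous_on UNIV (\<lambda>x. D i (x /\<^sub>R r))" for i by (rule continuous_on_compose2[OF D_cont hc]) simp
  have wg: "has_weak_gradient (scaled c r) (\<lambda>x. \<chi> i. G i x)"
  proof (rule has_weak_gradient_C1)
    show "continuous_on UNIV (scaled c r)"
      unfolding scaled_def[abs_def] by (intro continuous_on_of_real continuous_on_mult continuous_on_const cF)
    show "continuous_on UNIV (G i)" for i
      unfolding G_def[abs_def] by (intro continuous_on_of_real continuous_on_mult continuous_on_const cD)
    fix x i
    have "((\<lambda>s. F (x /\<^sub>R r + s *\<^sub>R axis i 1)) has_real_derivative D i (x /\<^sub>R r)) (at (0 / r))"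
      using deriv[of "x /\<^sub>R r" i] by simp
    moreover have "((\<lambda>t. t / r) has_real_derivative 1 / r) (at 0)"
      using DERIV_cdivide[OF DERIV_ident] by blast
    ultimately have "((\<lambda>t. F (x /\<^sub>R r + (t / r) *\<^sub>R axis i 1)) has_real_derivative D i (x /\<^sub>R r) * (1 / r)) (at 0)"
      by (rule DERIV_chain2)
    note d = DERIV_cmult[OF this, of "c / r"]
    have "((\<lambda>t. c / r * F ((x + t *\<^sub>R axis i 1) /\<^sub>R r)) has_real_derivative c / r\<^sup>2 * D i (x /\<^sub>R r)) (at 0)"
    proof -
      have "(x + t *\<^sub>R axis i 1) /\<^sub>R r = x /\<^sub>R r + (t / r) *\<^sub>R axis i 1" for t
      proof -
        have "inverse r * t = t / r" using r by (simp add: field_simps)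
        then show ?thesis by (simp only: scaleR_add_right scaleR_scaleR)
      qed
      moreover have "c / r * (d * (1 / r)) = c / r\<^sup>2 * d" for d
        by (simp add: power2_eq_square)
      ultimately show ?thesis using d by (simp only:)
    qed
    then show "((\<lambda>t. scaled c r (x + t *\<^sub>R axis i 1)) has_vector_derivative G i x) (at 0)"
      unfolding scaled_def G_def by (rule has_vector_derivative_of_real)
  qed
  have cm: "cmod (scaled c r x) = c / r * F (x /\<^sub>R r)" for x
    using c r F_nonneg[of "x /\<^sub>R r"] by (simp add: scaled_def norm_mult norm_divide)
  have sc: "scaled c r \<in> borel_measurable lborel" unfolding scaled_def[abs_def] by measurable
  have p: "(\<lambda>x. (c / r * F (x /\<^sub>R r)) ^ k) \<in> borel_measurable lborel" for k by measurable
  have p2: "(\<lambda>x. (c / r * F (x /\<^sub>R r)) powr (10/3)) \<in> borel_measurable lborel" by measurable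
  have G2: "norm (\<chi> i. G i x) ^ 2 = (c / r\<^sup>2)\<^sup>2 * (\<Sum>i\<in>UNIV. (D i (x /\<^sub>R r))\<^sup>2)" for x
    unfolding norm_complex4_sq sum_distrib_left
    by (intro sum.cong refl) (simp only: vec_lambda_beta G_def norm_of_real power2_abs power_mult_distrib)
  have p3: "(\<lambda>x. (c / r\<^sup>2)\<^sup>2 * (\<Sum>i\<in>UNIV. (D i (x /\<^sub>R r))\<^sup>2)) \<in> borel_measurable lborel" by measurable
  have i2: "integrable lebesgue (\<lambda>x. cmod (scaled c r x) ^ 2)"
    unfolding cm unfolding integrable_completion[OF p[of 2]] unfolding power_mult_distrib
    by (intro integrable_mult_right integrable_rescale[of "\<lambda>x. F x ^ 2"] integrable_F r)
  have iG: "integrable lebesgue (\<lambda>x. norm (\<chi> i. G i x) ^ 2)"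
    unfolding G2 integrable_completion[OF p3]
    by (intro integrable_mult_right integrable_rescale[of "\<lambda>x. \<Sum>i\<in>UNIV. (D i x)\<^sup>2"] integrable_F r)
  show "scaled c r \<in> H1"
    unfolding H1_def using measurable_completion[OF sc] i2 wg iG by blast
  show "(\<integral>x. norm (weak_gradient (scaled c r) x) ^ 2 \<partial>lebesgue) = c\<^sup>2 * A"
    unfolding weak_gradient_properties(4)[OF wg] G2 integral_completion[OF p3] A_def
    using integral_rescale[OF integrable_F(4) r] r by (simp add: power_divide flip: power_mult)
  show "(\<integral>x. cmod (scaled c r x) ^ 4 \<partial>lebesgue) = c ^ 4 * B"
    unfolding cm unfolding integral_completion[OF p[of 4]] unfolding power_mult_distrib B_def
    using integral_rescale[OF integrable_F(2) r] r by (simp add: power_divide)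
  have e: "(c / r * F (x /\<^sub>R r)) powr (10/3) = (c / r) powr (10/3) * F (x /\<^sub>R r) powr (10/3)" for x
    by (rule powr_mult)
  have "(\<integral>x. cmod (scaled c r x) powr (10/3) \<partial>lebesgue) = (c / r) powr (10/3) * (r ^ 4 * C)"
    unfolding cm unfolding integral_completion[OF p2] unfolding e C_def
    using integral_rescale[OF integrable_F(3) r] by simp
  \<comment> \<open>The amplitude contributes the exponent -10/3 and the change of variables 4,
    which leaves 2/3.\<close>
  also have "\<dots> = c powr (10/3) * (r powr (- (10/3)) * r powr 4) * C"
    using c r by (simp add: powr_divide powr_minus_divide powr_numeral)
  also have "r powr (- (10/3)) * r powr 4 = r powr (2/3)"
    by (simp flip: powr_add)
  finally show "(\<integral>x. cmod (scaled c r x) powr (10/3) \<partial>lebesgue) = c powr (10/3) * r powr (2/3) * C" .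
qed

text \<open>At the amplitude \<open>c0\<close>, with \<open>c0^2 = A / B\<close>, the gradient and
  quartic terms balance, and their energy is \<open>A^2 / (4 B)\<close>. If \<open>b = 0\<close>,
  this balance is the whole constraint, and the scale serves to make the last energy term as small
  as desired. If \<open>b > 0\<close>, an amplitude slightly above \<open>c0\<close> makes the
  quartic term dominate, so that the constraint has a positive solution for the scale.\<close>

lemma m_le_trial:
  assumes \<Omega>: "(\<alpha>, \<beta>) \<in> Omega" and B: "B > 0" and \<delta>: "\<delta> > 0"
  shows "m \<alpha> \<beta> \<le> ereal (A\<^sup>2 / (4 * B) + \<delta>)"
proof -
  define a where "a = \<alpha> + \<beta>"
  define b where "b = \<alpha> + 6/5 * \<beta>"
  have ab: "a > 0" "b \<ge> 0" using Omega_coefficients[OF \<Omega>] by (simp_all add: a_def b_def)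
  have nz: "scaled c r \<notin> H1_zero" if "c > 0" "r > 0" for c r
  proof
    assume "scaled c r \<in> H1_zero"
    then have "AE x in lebesgue. cmod (scaled c r x) ^ 4 = 0" by (auto simp: H1_zero_def)
    then have "(\<integral>x. cmod (scaled c r x) ^ 4 \<partial>lebesgue) = 0" by (rule integral_eq_zero_AE)
    then show False using scaled(3)[OF that] that B by simp
  qed
  have C_pos: "C > 0"
  proof -
    have "C \<noteq> 0"
    proof
      assume "C = 0"
      then have "AE x in lborel. F x powr (10/3) = 0"
        unfolding C_def using integrable_F(3) by (subst (asm) integral_nonneg_eq_0_iff_AE) auto
      then have "AE x in lborel. F x ^ 4 = 0" by eventually_elim simp
      then have "B = 0" unfolding B_def by (rule integral_eq_zero_AE)
      then show False using B by simp
    qed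
    moreover have "C \<ge> 0" unfolding C_def by (intro integral_nonneg_AE) auto
    ultimately show ?thesis by simp
  qed
  \<comment> \<open>Applied to the trial function itself, the Sobolev inequality excludes
    \<open>A = 0\<close>.\<close>
  have A_pos: "A > 0"
  proof -
    have "c ^ 4 * B * sobolev_level \<le> (c\<^sup>2 * A)\<^sup>2" if "c > 0" for c
      using sobolev_H1(3)[OF scaled(1)[OF that zero_less_one]] scaled[OF that zero_less_one] by simp
    from this[of 1] have "B * sobolev_level \<le> A\<^sup>2" by simp
    moreover have "0 < B * sobolev_level" using B sobolev_level_pos by simp
    ultimately have "A \<noteq> 0" by auto
    moreover have "A \<ge> 0" unfolding A_def by (intro integral_nonneg_AE) (auto intro!: sum_nonneg)
    ultimately show ?thesis by simp
  qed
  have trial: "m \<alpha> \<beta> \<le> ereal (1/2 * (c\<^sup>2 * A) - 1/4 * (c ^ 4 * B) + 3/10 * (c powr (10/3) * s * C))"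
    if c: "c > 0" and s: "s > 0" and K: "a * (c\<^sup>2 * A - c ^ 4 * B) + b * (c powr (10/3) * s * C) = 0" for c s
  proof -
    \<comment> \<open>The last integral depends on the scale through \<open>r powr (2/3)\<close>,
      which takes every positive value \<open>s\<close>.\<close>
    define r where "r = s powr (3/2)"
    have r: "r > 0" "r powr (2/3) = s" using s by (simp_all add: r_def powr_powr)
    note sc = scaled[OF c r(1), unfolded r(2)]
    have "K \<alpha> \<beta> (scaled c r) = 0"
      using K unfolding energy_H1(2)[OF sc(1)] sc a_def b_def .
    moreover have "energy (scaled c r) = 1/2 * (c\<^sup>2 * A) - 1/4 * (c ^ 4 * B) + 3/10 * (c powr (10/3) * s * C)"
      unfolding energy_H1(1)[OF sc(1)] sc ..
    ultimately show ?thesis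
      unfolding m_def using sc(1) nz[OF c r(1)] by (intro Inf_lower CollectI exI[of _ "scaled c r"]) simp
  qed
  define c0 where "c0 = sqrt (A / B)"
  have c0: "c0 > 0" "c0\<^sup>2 = A / B" using A_pos B by (simp_all add: c0_def)
  then have c04: "c0 ^ 4 = (A / B)\<^sup>2" by (metis power2_eq_square power4_eq_xxxx mult.assoc)
  have level: "1/2 * (c0\<^sup>2 * A) - 1/4 * (c0 ^ 4 * B) = A\<^sup>2 / (4 * B)"
    unfolding c0(2) c04 using B by (simp add: power2_eq_square field_simps)
  show ?thesis
  proof (cases "b = 0")
    case True
    define s where "s = \<delta> / (3/10 * (c0 powr (10/3) * C))"
    have "s > 0" using \<delta> c0 C_pos by (simp add: s_def)
    moreover have "a * (c0\<^sup>2 * A - c0 ^ 4 * B) + b * (c0 powr (10/3) * s * C) = 0"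
      unfolding c0(2) c04 using True B by (simp add: power2_eq_square)
    ultimately have "m \<alpha> \<beta> \<le> ereal (1/2 * (c0\<^sup>2 * A) - 1/4 * (c0 ^ 4 * B) + 3/10 * (c0 powr (10/3) * s * C))"
      by (intro trial c0)
    also have "3/10 * (c0 powr (10/3) * s * C) = \<delta>" using c0 C_pos by (simp add: s_def)
    finally show ?thesis unfolding level .
  next
    case False
    then have b: "b > 0" using ab by simp
    \<comment> \<open>The energy at amplitude \<open>c\<close> after the constraint has been used to
      eliminate the term of order 10/3; at \<open>c0\<close> the eliminated part vanishes.\<close>
    define e where "e c = 1/2 * (c\<^sup>2 * A) - 1/4 * (c ^ 4 * B) + 3/10 * (a / b * (c ^ 4 * B - c\<^sup>2 * A))" for c
    have balance: "c0 ^ 4 * B - c0\<^sup>2 * A = 0"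
      unfolding c0(2) c04 using B by (simp add: power2_eq_square)
    have ec0: "e c0 = A\<^sup>2 / (4 * B)"
      unfolding e_def balance level by simp
    have "isCont e c0" unfolding e_def by (intro continuous_intros)
    \<comment> \<open>The limit is taken from the right because only \<open>c > c0\<close> makes the
      scale positive.\<close>
    from continuous_at_imp_continuous_at_within[OF this, of "{c0<..}"]
    have "(e \<longlongrightarrow> e c0) (at_right c0)"
      unfolding continuous_within .
    then have "\<forall>\<^sub>F c in at_right c0. e c < A\<^sup>2 / (4 * B) + \<delta>"
      unfolding ec0 by (rule order_tendstoD) (use \<delta> in simp)
    then have "\<forall>\<^sub>F c in at_right c0. e c < A\<^sup>2 / (4 * B) + \<delta> \<and> c0 < c"
      using eventually_at_right_less by (rule eventually_conj)
    then obtain c where c: "e c < A\<^sup>2 / (4 * B) + \<delta>" "c0 < c"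
      using eventually_happens[of _ "at_right c0"] by auto
    define s where "s = a / b * (c ^ 4 * B - c\<^sup>2 * A) / (c powr (10/3) * C)"
    have c_pos: "c > 0" using c c0 by simp
    have "A / B < c\<^sup>2" unfolding c0(2)[symmetric] using c c0 by (intro power_strict_mono) auto
    then have "A < c\<^sup>2 * B" using B by (simp add: divide_less_eq)
    then have "c\<^sup>2 * A < c\<^sup>2 * (c\<^sup>2 * B)" using c_pos by (intro mult_strict_left_mono) auto
    then have pos: "c ^ 4 * B - c\<^sup>2 * A > 0" by (simp add: power2_eq_square power4_eq_xxxx mult.assoc)
    have s: "s > 0" unfolding s_def using pos ab b c_pos C_pos by (intro divide_pos_pos mult_pos_pos) auto
    have cs: "c powr (10/3) * s * C = a / b * (c ^ 4 * B - c\<^sup>2 * A)"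
      using c_pos C_pos by (simp add: s_def)
    have "m \<alpha> \<beta> \<le> ereal (1/2 * (c\<^sup>2 * A) - 1/4 * (c ^ 4 * B) + 3/10 * (c powr (10/3) * s * C))"
    proof (rule trial[OF c_pos s])
      show "a * (c\<^sup>2 * A - c ^ 4 * B) + b * (c powr (10/3) * s * C) = 0"
        unfolding cs using b by (simp add: algebra_simps)
    qed
    also have "\<dots> = ereal (e c)" unfolding cs e_def ..
    also have "\<dots> \<le> ereal (A\<^sup>2 / (4 * B) + \<delta>)" using c by simp
    finally show ?thesis .
  qed
qed

end

text \<open>The truncation \<open>s \<mapsto> (s - \<epsilon>)\<^sub>+\<^sup>2 / s\<close> is \<open>C\<^sup>1\<close> and 1-Lipschitz on the positive half-line and
  vanishes near \<open>0\<close>, so that composing the bubble with it gives compactly supported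
  trial functions without increasing the Dirichlet integral.\<close>

definition trunc :: "real \<Rightarrow> real \<Rightarrow> real" where
  "trunc \<epsilon> s = (max 0 (s - \<epsilon>))\<^sup>2 / s"

text \<open>Written as one minus a square, which makes the bounds 0 and 1 visible, as the inner
  quotient lies in [0, 1] for positive \<open>s\<close> and \<open>\<epsilon>\<close>.\<close>

definition trunc_deriv :: "real \<Rightarrow> real \<Rightarrow> real" where
  "trunc_deriv \<epsilon> s = 1 - (1 - max 0 (s - \<epsilon>) / s)\<^sup>2"

lemma trunc_has_derivative:
  assumes "s > 0" shows "(trunc \<epsilon> has_real_derivative trunc_deriv \<epsilon> s) (at s)"
proof -
  have "((\<lambda>s. s - \<epsilon>) has_real_derivative 1) (at s)" by (auto intro!: derivative_eq_intros)
  from DERIV_divide[OF DERIV_chain2[OF max_0_square_deriv this] DERIV_ident] assms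
  have "((\<lambda>s. (max 0 (s - \<epsilon>))\<^sup>2 / s) has_real_derivative
     (2 * max 0 (s - \<epsilon>) * 1 * s - (max 0 (s - \<epsilon>))\<^sup>2 * 1) / (s * s)) (at s)" by simp
  moreover have "(2 * max 0 (s - \<epsilon>) * 1 * s - (max 0 (s - \<epsilon>))\<^sup>2 * 1) / (s * s) = trunc_deriv \<epsilon> s"
    using assms by (simp add: trunc_deriv_def power2_eq_square field_simps)
  ultimately show ?thesis by (simp add: trunc_def[abs_def])
qed

lemma trunc_bounds:
  assumes "\<epsilon> > 0" "s > 0"
  shows "0 \<le> trunc_deriv \<epsilon> s" "trunc_deriv \<epsilon> s \<le> 1" "0 \<le> trunc \<epsilon> s" "trunc \<epsilon> s \<le> s"
proof -
  let ?m = "max 0 (s - \<epsilon>)"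
  have q: "0 \<le> ?m / s" "?m / s \<le> 1" using assms by (auto simp: divide_le_eq_1)
  then have "(1 - ?m / s)\<^sup>2 \<le> 1" by (intro power_le_one) auto
  then show "0 \<le> trunc_deriv \<epsilon> s" "trunc_deriv \<epsilon> s \<le> 1" by (simp_all add: trunc_deriv_def)
  show "0 \<le> trunc \<epsilon> s" using assms by (simp add: trunc_def)
  have "?m\<^sup>2 \<le> s\<^sup>2" using assms by (intro power_mono) auto
  then show "trunc \<epsilon> s \<le> s" using assms by (simp add: trunc_def divide_le_eq power2_eq_square)
qed

lemma trunc_eq_0: "s \<le> \<epsilon> \<Longrightarrow> trunc \<epsilon> s = 0 \<and> trunc_deriv \<epsilon> s = 0"
  by (simp add: trunc_def trunc_deriv_def)

lemma trial_bubble: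
  assumes \<epsilon>: "\<epsilon> > 0"
  shows "trial_function (\<lambda>x. trunc \<epsilon> (bubble x)) (\<lambda>i x. trunc_deriv \<epsilon> (bubble x) * (- (x $ i) / 4 * bubble x ^ 2)) (8 / \<epsilon> + 8)"
proof
  show "continuous_on UNIV (\<lambda>x::real^4. trunc \<epsilon> (bubble x))"
    unfolding trunc_def by (intro continuous_intros continuous_on_bubble) (simp add: bubble_nonzero)
  show "continuous_on UNIV (\<lambda>x::real^4. trunc_deriv \<epsilon> (bubble x) * (- (x $ i) / 4 * bubble x ^ 2))" for i
    unfolding trunc_deriv_def by (intro continuous_intros continuous_on_bubble) (auto simp: bubble_nonzero)
  show "0 \<le> trunc \<epsilon> (bubble x)" for x :: "real^4"
    using trunc_bounds(3)[OF \<epsilon> bubble_pos] .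
  show "trunc \<epsilon> (bubble x) = 0 \<and> trunc_deriv \<epsilon> (bubble x) * (- (x $ i) / 4 * bubble x ^ 2) = 0"
    if nx: "x \<notin> cube (8 / \<epsilon> + 8)" for x :: "real^4" and i
  proof -
    obtain b :: "real^4" where "b \<in> Basis" "8 / \<epsilon> + 8 < \<bar>x \<bullet> b\<bar>" using nx by (auto simp: cube_def not_le)
    then have n: "8 / \<epsilon> + 8 < norm x" using Basis_le_norm[of b x] by linarith
    moreover have "0 < 8 / \<epsilon>" using \<epsilon> by simp
    \<comment> \<open>The bubble is at most \<open>\<epsilon>\<close> once
      \<open>norm x ^ 2 \<ge> 8 / \<epsilon>\<close>. The added 8 in the radius ensures
      \<open>norm x \<ge> 1\<close>, hence \<open>norm x \<le> norm x ^ 2\<close>, and avoids a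
      square root.\<close>
    ultimately have "1 \<le> norm x" by linarith
    then have "norm x \<le> norm x ^ 2" using mult_left_mono[of 1 "norm x" "norm x"] by (simp add: power2_eq_square)
    then have "1 / \<epsilon> \<le> 1 + norm x ^ 2 / 8" using n by simp
    then have "bubble x \<le> inverse (1 / \<epsilon>)" unfolding bubble_def using \<epsilon> by (intro le_imp_inverse_le) auto
    then show ?thesis using trunc_eq_0[of "bubble x" \<epsilon>] by simp
  qed
  show "((\<lambda>t. trunc \<epsilon> (bubble (x + t *\<^sub>R axis i 1))) has_real_derivative
      trunc_deriv \<epsilon> (bubble x) * (- (x $ i) / 4 * bubble x ^ 2)) (at 0)" for x :: "real^4" and i
  proof (rule DERIV_chain2[OF _ bubble_axis_deriv])
    show "(trunc \<epsilon> has_real_derivative trunc_deriv \<epsilon> (bubble x)) (at (bubble (x + 0 *\<^sub>R axis i 1)))"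
      using trunc_has_derivative[OF bubble_pos] by simp
  qed
qed

lemma trial_gradient_le:
  assumes \<epsilon>: "\<epsilon> > 0"
  shows "(\<integral>x. (\<Sum>i\<in>UNIV. (trunc_deriv \<epsilon> (bubble x) * (- ((x::real^4) $ i) / 4 * bubble x ^ 2))\<^sup>2) \<partial>lborel) \<le> sobolev_level"
proof -
  have dim: "DIM(real^4) = 4" by simp
  interpret trial_function "\<lambda>x. trunc \<epsilon> (bubble x)" "\<lambda>i x. trunc_deriv \<epsilon> (bubble x) * (- (x $ i) / 4 * bubble x ^ 2)" "8 / \<epsilon> + 8"
    by (rule trial_bubble[OF \<epsilon>])
  have "(\<integral>x. (\<Sum>i\<in>UNIV. (trunc_deriv \<epsilon> (bubble x) * (- ((x::real^4) $ i) / 4 * bubble x ^ 2))\<^sup>2) \<partial>lborel) \<le>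
      (\<integral>x. norm (x::real^4) ^ 2 * bubble x ^ 4 / 16 \<partial>lborel)"
  proof (rule integral_mono[OF integrable_F(4)])
    show "integrable lborel (\<lambda>x::real^4. norm x ^ 2 * bubble x ^ 4 / 16)"
      using integrable_norm_sq_bubble[OF dim] by simp
    fix x :: "real^4"
    have "(trunc_deriv \<epsilon> (bubble x))\<^sup>2 \<le> 1"
      using trunc_bounds(1,2)[OF \<epsilon> bubble_pos[of x]] by (intro power_le_one) auto
    then have "(\<Sum>i\<in>UNIV. (trunc_deriv \<epsilon> (bubble x) * (- (x $ i) / 4 * bubble x ^ 2))\<^sup>2) \<le> (\<Sum>i\<in>UNIV. 1 * (- (x $ i) / 4 * bubble x ^ 2)\<^sup>2)"
      unfolding power_mult_distrib[of "trunc_deriv \<epsilon> (bubble x)"] by (intro sum_mono mult_right_mono) auto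
    also have "\<dots> = (\<Sum>i\<in>UNIV. (x $ i)\<^sup>2) * (bubble x ^ 4 / 16)"
      unfolding sum_distrib_right by (intro sum.cong refl) (simp add: power_mult_distrib power_divide flip: power_mult)
    also have "(\<Sum>i\<in>UNIV. (x $ i)\<^sup>2) = norm x ^ 2" by (simp add: norm_vec_def L2_set_def sum_nonneg)
    finally show "(\<Sum>i\<in>UNIV. (trunc_deriv \<epsilon> (bubble x) * (- (x $ i) / 4 * bubble x ^ 2))\<^sup>2) \<le> norm x ^ 2 * bubble x ^ 4 / 16" by simp
  qed
  also have "\<dots> = sobolev_level" using bubble_integrals(2)[OF dim] by (simp add: sobolev_level_def)
  finally show ?thesis .
qed

lemma trial_L4_tendsto:
  "(\<lambda>n. \<integral>x. trunc (radius n) (bubble (x::real^4)) ^ 4 \<partial>lborel) \<longlonglongrightarrow> sobolev_level"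
  unfolding sobolev_level_def
proof (rule integral_dominated_convergence[where w = "\<lambda>x::real^4. bubble x ^ 4"])
  show "integrable lborel (\<lambda>x::real^4. bubble x ^ 4)" by (rule integrable_bubble_power) simp_all
  show "AE x in lborel. (\<lambda>n. trunc (radius n) (bubble (x::real^4)) ^ 4) \<longlonglongrightarrow> bubble x ^ 4"
  proof (rule AE_I2)
    fix x :: "real^4"
    have "(\<lambda>n. ((max 0 (bubble x - radius n))\<^sup>2 / bubble x) ^ 4) \<longlonglongrightarrow> ((max 0 (bubble x - 0))\<^sup>2 / bubble x) ^ 4"
      by (intro tendsto_intros radius_tendsto) (simp add: bubble_nonzero)
    also have "((max 0 (bubble x - 0))\<^sup>2 / bubble x) ^ 4 = bubble x ^ 4"
      by (simp add: bubble_nonneg bubble_nonzero power2_eq_square max_absorb2)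
    finally show "(\<lambda>n. trunc (radius n) (bubble x) ^ 4) \<longlonglongrightarrow> bubble x ^ 4"
      unfolding trunc_def .
  qed
  show "AE x in lborel. norm (trunc (radius n) (bubble (x::real^4)) ^ 4) \<le> bubble x ^ 4" for n
  proof (rule AE_I2)
    fix x :: "real^4"
    show "norm (trunc (radius n) (bubble x) ^ 4) \<le> bubble x ^ 4"
      using trunc_bounds(3,4)[OF radius_pos[of n] bubble_pos[of x]] by (auto intro!: power_mono)
  qed
  show "(\<lambda>x::real^4. trunc (radius n) (bubble x) ^ 4) \<in> borel_measurable lborel" for n
    unfolding trunc_def by measurable
qed measurable

text \<open>For the truncated bubbles an upper bound on the gradient integrals and convergence of
  the quartic integrals suffice: \<open>A^2 / (4 B n)\<close> is at most
  \<open>sobolev_level^2 / (4 B n)\<close>, which tends to \<open>sobolev_level / 4\<close>. Half of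
  \<open>\<delta>\<close> is spent on this limit and half on \<open>m_le_trial\<close>.\<close>

lemma m_upper_bound:
  assumes \<Omega>: "(\<alpha>, \<beta>) \<in> Omega"
  shows "m \<alpha> \<beta> \<le> ereal (sobolev_level / 4)"
proof (rule ereal_le_epsilon2)
  fix \<delta> :: real assume \<delta>: "0 < \<delta>"
  define B where "B n = (\<integral>x. trunc (radius n) (bubble (x::real^4)) ^ 4 \<partial>lborel)" for n
  have "(\<lambda>n. sobolev_level\<^sup>2 / (4 * B n)) \<longlonglongrightarrow> sobolev_level\<^sup>2 / (4 * sobolev_level)"
    unfolding B_def using sobolev_level_pos by (intro tendsto_intros trial_L4_tendsto) simp
  also have "sobolev_level\<^sup>2 / (4 * sobolev_level) = sobolev_level / 4"
    using sobolev_level_pos by (simp add: power2_eq_square)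
  finally have "\<forall>\<^sub>F n in sequentially. sobolev_level\<^sup>2 / (4 * B n) < sobolev_level / 4 + \<delta> / 2"
    by (rule order_tendstoD) (use \<delta> in simp)
  moreover have "\<forall>\<^sub>F n in sequentially. 0 < B n"
    unfolding B_def using trial_L4_tendsto sobolev_level_pos by (rule order_tendstoD)
  ultimately have "\<forall>\<^sub>F n in sequentially. sobolev_level\<^sup>2 / (4 * B n) < sobolev_level / 4 + \<delta> / 2 \<and> 0 < B n"
    by (rule eventually_conj)
  then obtain n where n: "sobolev_level\<^sup>2 / (4 * B n) < sobolev_level / 4 + \<delta> / 2" "0 < B n"
    unfolding eventually_sequentially by blast
  interpret T: trial_function "\<lambda>x. trunc (radius n) (bubble x)"
    "\<lambda>i x. trunc_deriv (radius n) (bubble x) * (- (x $ i) / 4 * bubble x ^ 2)" "8 / radius n + 8"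
    by (rule trial_bubble[OF radius_pos])
  have TB: "T.B = B n" by (simp add: T.B_def B_def)
  have TA: "T.A \<le> sobolev_level" unfolding T.A_def by (rule trial_gradient_le[OF radius_pos])
  have "0 \<le> T.A" unfolding T.A_def by (intro integral_nonneg_AE) (auto intro!: sum_nonneg)
  have "m \<alpha> \<beta> \<le> ereal (T.A\<^sup>2 / (4 * T.B) + \<delta> / 2)"
    using n \<delta> by (intro T.m_le_trial \<Omega>) (simp_all add: TB)
  also have "T.A\<^sup>2 / (4 * T.B) \<le> sobolev_level\<^sup>2 / (4 * B n)"
    unfolding TB using TA \<open>0 \<le> T.A\<close> n by (intro divide_right_mono power_mono) auto
  then have "ereal (T.A\<^sup>2 / (4 * T.B) + \<delta> / 2) \<le> ereal (sobolev_level / 4) + ereal \<delta>"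
    using n by simp
  finally show "m \<alpha> \<beta> \<le> ereal (sobolev_level / 4) + ereal \<delta>" .
qed

theorem proposition1p3:
  fixes \<alpha> \<beta> :: real
  assumes "(\<alpha>, \<beta>) \<in> Omega"
  shows "m \<alpha> \<beta> = ereal (energy_c W) \<and> energy_c W = 1/4 * L2_norm (weak_gradient W) ^ 2"
proof
  have "ereal (sobolev_level / 4) \<le> m \<alpha> \<beta>"
    unfolding m_def using energy_lower_bound[OF assms] by (intro Inf_greatest) auto
  then show "m \<alpha> \<beta> = ereal (energy_c W)"
    using m_upper_bound[OF assms] unfolding energy_c_W by (intro antisym)
  show "energy_c W = 1/4 * L2_norm (weak_gradient W) ^ 2"
    unfolding energy_c_W L2_norm_gradient_W by simp
qed

end
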